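(* Let $\mathcal{C}$ be a graph class of tree rank $d$. Then every first-order formula $\phi(\bar x)$ is equivalent on $\mathcal{C}$ to some first-order formula $\psi(\bar x)$ of alternation rank at most $3d-1$ (i.e., for all $G\in\mathcal{C}$ and tuples $\bar a$ of vertices, $G\models\phi(\bar a)\iff G\models\psi(\bar a)$). Moreover, if $\mathcal{C}$ has elementary tree rank $d$, then $\psi$ can be chosen with size bounded by an elementary function of the size of $\phi$.
   Context: Graphs are finite, simple, undirected; formulas are first-order over the signature with one binary edge relation $E$. A rooted tree has depth equal to the maximum number of vertices on a root-to-leaf path; $\mathcal{T}_d$ is the class of trees of depth $d$. For $r\in\mathbb{N}$, $H$ is an $r$-shallow topological minor of $G$ if $G$ contains as a subgraph a graph obtained from $H$ by replacing each edge $uv$ by a $u$–$v$ path with at most $r$ internal vertices; $\mathrm{TopMinors}_r(\mathcal{C})$ is the class of these for $G\in\mathcal{C}$. Tree rank of $\mathcal{C}$: $\max\{d\in\mathbb{N}:\exists r,\ \mathcal{T}_d\subseteq\mathrm{TopMinors}_r(\mathcal{C})\}$. With $\mathsf{tower}(0,b)=b$, $\mathsf{tower}(a,b)=2^{\mathsf{tower}(a-1,b)}$, a function is elementary if bounded by $\mathsf{tower}(h,\cdot)$ for some fixed $h$. Elementary tree rank: the least $d$ such that there is an elementary $f$ such that for every $r$ some tree of depth $d+1$ with $f(r)$ vertices is not in $\mathrm{TopMinors}_r(\mathcal{C})$. Alternation rank of a formula: convert it to negation normal form (negations only applied to atomic formulas); for each branch of its syntax tree, delete the symbols $\wedge,\vee$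 and count the occurrences of consecutive pairs $\exists\forall$ or $\forall\exists$ among the remaining quantifier symbols; the alternation rank is the maximum of this count over all branches. *)

theory Defs
  imports "Graph_Theory.Graph_Theory"
begin

section \<open>Trees\<close>

text \<open>
  A finite simple undirected graph is a \<^locale>\<open>pair_graph\<close>: every undirected edge is stored as a
  pair of opposite arcs.  The empty graph is allowed.

  The constant \<^const>\<open>Digraph_Component.tree\<close> cannot be used for such graphs: it counts the
  closed walk u, v, u as a cycle, so only one-vertex graphs would be trees.
\<close>

definition has_cycle :: "'a pair_pre_digraph \<Rightarrow> bool" where
  "has_cycle G \<longleftrightarrow>
     (\<exists>p. vpath p (with_proj G) \<and> 3 \<le> length p \<and> (last p, hd p) \<in> parcs G)"

definition undirected_tree :: "'a pair_pre_digraph \<Rightarrow> bool" where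
  "undirected_tree T \<longleftrightarrow>
     pair_graph T \<and> Digraph_Component.connected (with_proj T) \<and> \<not> has_cycle T"

text \<open>
  On the path from the root \<open>z\<close> to a vertex \<open>v\<close> of a tree, the only neighbour of \<open>v\<close> is its
  parent; so \<open>v\<close> is a leaf iff all its neighbours lie on that path.  If \<open>z\<close> is the only
  vertex, it is itself a leaf.
\<close>

definition root_leaf_path :: "'a pair_pre_digraph \<Rightarrow> 'a \<Rightarrow> 'a list \<Rightarrow> bool" where
  "root_leaf_path T z p \<longleftrightarrow>
     vpath p (with_proj T) \<and> hd p = z \<and> (\<forall>w. (last p, w) \<in> parcs T \<longrightarrow> w \<in> set p)"

definition depth_from :: "'a pair_pre_digraph \<Rightarrow> 'a \<Rightarrow> nat" where
  "depth_from T z = Max (length ` {p. root_leaf_path T z p})"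

text \<open>
  Every finite tree has an isomorphic copy on natural numbers.  The root is forgotten: a tree
  belongs to the class iff it has depth \<open>d\<close> for some choice of the root.
\<close>

definition trees_of_depth :: "nat \<Rightarrow> nat pair_pre_digraph set" where
  "trees_of_depth d = {T. undirected_tree T \<and> (\<exists>z\<in>pverts T. depth_from T z = d)}"


section \<open>Shallow topological minors\<close>

text \<open>
  \<open>K\<close> is obtained from \<open>H\<close> by replacing each edge by a path with at most \<open>r\<close> internal vertices,
  up to renaming: \<open>\<iota>\<close> names the vertices of \<open>H\<close> in \<open>K\<close>, and \<open>I (u, v)\<close> lists the internal
  vertices of the path replacing the edge \<open>uv\<close>, in order from \<open>u\<close> to \<open>v\<close>.
\<close>

definition shallow_subdivision ::
  "nat \<Rightarrow> 'b pair_pre_digraph \<Rightarrow> 'a pair_pre_digraph \<Rightarrow> bool" where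
  "shallow_subdivision r H K \<longleftrightarrow>
     (\<exists>(\<iota> :: 'b \<Rightarrow> 'a) (I :: 'b \<times> 'b \<Rightarrow> 'a list).
        inj_on \<iota> (pverts H)
      \<and> (\<forall>(u, v) \<in> parcs H.
            distinct (I (u, v)) \<and> length (I (u, v)) \<le> r
          \<and> set (I (u, v)) \<inter> \<iota> ` pverts H = {}
          \<and> I (v, u) = rev (I (u, v)))
      \<and> (\<forall>(u, v) \<in> parcs H. \<forall>(u', v') \<in> parcs H.
            {u, v} \<noteq> {u', v'} \<longrightarrow> set (I (u, v)) \<inter> set (I (u', v')) = {})
      \<and> pverts K = \<iota> ` pverts H \<union> (\<Union>e\<in>parcs H. set (I e))
      \<and> parcs K = (\<Union>(u, v)\<in>parcs H. set (vwalk_arcs (\<iota> u # I (u, v) @ [\<iota> v]))))"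

definition shallow_topological_minor ::
  "nat \<Rightarrow> 'b pair_pre_digraph \<Rightarrow> 'a pair_pre_digraph \<Rightarrow> bool" where
  "shallow_topological_minor r H G \<longleftrightarrow>
     (\<exists>K. shallow_subdivision r H K \<and> subgraph (with_proj K) (with_proj G))"

definition TopMinors ::
  "nat \<Rightarrow> 'a pair_pre_digraph set \<Rightarrow> 'b pair_pre_digraph set" where
  "TopMinors r C = {H. pair_graph H \<and> (\<exists>G\<in>C. shallow_topological_minor r H G)}"


section \<open>Tree rank and elementary tree rank\<close>

text \<open>
  Both ranks are relations, since the maximum (minimum) need not exist.  There are no trees of
  depth \<open>0\<close>, so a class has tree rank \<open>0\<close> iff it contains no graph with a vertex.
  For such classes the bound \<open>3 * d - 1\<close> of the theorem, a subtraction of natural numbers, reads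
  \<open>0\<close>; for \<open>d \<ge> 1\<close> no truncation occurs.
\<close>

definition has_tree_rank :: "'a pair_pre_digraph set \<Rightarrow> nat \<Rightarrow> bool" where
  "has_tree_rank C d \<longleftrightarrow>
     (\<exists>r. trees_of_depth d \<subseteq> TopMinors r C)
   \<and> (\<forall>d'. (\<exists>r. trees_of_depth d' \<subseteq> TopMinors r C) \<longrightarrow> d' \<le> d)"

fun tower :: "nat \<Rightarrow> nat \<Rightarrow> nat" where
  "tower 0 b = b"
| "tower (Suc a) b = 2 ^ tower a b"

definition elementary :: "(nat \<Rightarrow> nat) \<Rightarrow> bool" where
  "elementary f \<longleftrightarrow> (\<exists>h. \<forall>n. f n \<le> tower h n)"

definition elementary_excludes :: "'a pair_pre_digraph set \<Rightarrow> nat \<Rightarrow> bool" where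
  "elementary_excludes C d \<longleftrightarrow>
     (\<exists>f. elementary f \<and>
        (\<forall>r. \<exists>T\<in>trees_of_depth (d + 1). card (pverts T) = f r \<and> T \<notin> TopMinors r C))"

definition has_elementary_tree_rank :: "'a pair_pre_digraph set \<Rightarrow> nat \<Rightarrow> bool" where
  "has_elementary_tree_rank C d \<longleftrightarrow>
     elementary_excludes C d \<and> (\<forall>d'. elementary_excludes C d' \<longrightarrow> d \<le> d')"


section \<open>First-order formulas over graphs\<close>

datatype fo =
    Eq nat nat
  | Edge nat nat
  | Neg fo
  | Conj fo fo
  | Disj fo fo
  | Ex nat fo
  | All nat fo

primrec fv :: "fo \<Rightarrow> nat set" where
  "fv (Eq x y) = {x, y}"
| "fv (Edge x y) = {x, y}"
| "fv (Neg \<phi>) = fv \<phi>"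
| "fv (Conj \<phi> \<psi>) = fv \<phi> \<union> fv \<psi>"
| "fv (Disj \<phi> \<psi>) = fv \<phi> \<union> fv \<psi>"
| "fv (Ex x \<phi>) = fv \<phi> - {x}"
| "fv (All x \<phi>) = fv \<phi> - {x}"

primrec sat :: "'a pair_pre_digraph \<Rightarrow> (nat \<Rightarrow> 'a) \<Rightarrow> fo \<Rightarrow> bool" where
  "sat G a (Eq x y) \<longleftrightarrow> a x = a y"
| "sat G a (Edge x y) \<longleftrightarrow> (a x, a y) \<in> parcs G"
| "sat G a (Neg \<phi>) \<longleftrightarrow> \<not> sat G a \<phi>"
| "sat G a (Conj \<phi> \<psi>) \<longleftrightarrow> sat G a \<phi> \<and> sat G a \<psi>"
| "sat G a (Disj \<phi> \<psi>) \<longleftrightarrow> sat G a \<phi> \<or> sat G a \<psi>"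
| "sat G a (Ex x \<phi>) \<longleftrightarrow> (\<exists>v\<in>pverts G. sat G (a(x := v)) \<phi>)"
| "sat G a (All x \<phi>) \<longleftrightarrow> (\<forall>v\<in>pverts G. sat G (a(x := v)) \<phi>)"

text \<open>
  A formula with free variables among the tuple \<open>xs\<close> is evaluated under valuations sending the
  variables in \<open>xs\<close> to vertices; the values of all other variables are irrelevant.
\<close>

definition equivalent_on :: "'a pair_pre_digraph set \<Rightarrow> nat list \<Rightarrow> fo \<Rightarrow> fo \<Rightarrow> bool" where
  "equivalent_on C xs \<phi> \<psi> \<longleftrightarrow>
     (\<forall>G\<in>C. \<forall>a. a ` set xs \<subseteq> pverts G \<longrightarrow> (sat G a \<phi> \<longleftrightarrow> sat G a \<psi>))"

text \<open>
  The library function \<^const>\<open>size\<close> would give atoms size \<open>0\<close>; here every node of the syntax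
  tree counts.
\<close>

primrec fo_size :: "fo \<Rightarrow> nat" where
  "fo_size (Eq x y) = 1"
| "fo_size (Edge x y) = 1"
| "fo_size (Neg \<phi>) = Suc (fo_size \<phi>)"
| "fo_size (Conj \<phi> \<psi>) = Suc (fo_size \<phi> + fo_size \<psi>)"
| "fo_size (Disj \<phi> \<psi>) = Suc (fo_size \<phi> + fo_size \<psi>)"
| "fo_size (Ex x \<phi>) = Suc (fo_size \<phi>)"
| "fo_size (All x \<phi>) = Suc (fo_size \<phi>)"


section \<open>Alternation rank\<close>

fun nnf :: "fo \<Rightarrow> fo" where
  "nnf (Eq x y) = Eq x y"
| "nnf (Edge x y) = Edge x y"
| "nnf (Conj \<phi> \<psi>) = Conj (nnf \<phi>) (nnf \<psi>)"
| "nnf (Disj \<phi> \<psi>) = Disj (nnf \<phi>) (nnf \<psi>)"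
| "nnf (Ex x \<phi>) = Ex x (nnf \<phi>)"
| "nnf (All x \<phi>) = All x (nnf \<phi>)"
| "nnf (Neg (Eq x y)) = Neg (Eq x y)"
| "nnf (Neg (Edge x y)) = Neg (Edge x y)"
| "nnf (Neg (Neg \<phi>)) = nnf \<phi>"
| "nnf (Neg (Conj \<phi> \<psi>)) = Disj (nnf (Neg \<phi>)) (nnf (Neg \<psi>))"
| "nnf (Neg (Disj \<phi> \<psi>)) = Conj (nnf (Neg \<phi>)) (nnf (Neg \<psi>))"
| "nnf (Neg (Ex x \<phi>)) = All x (nnf (Neg \<phi>))"
| "nnf (Neg (All x \<phi>)) = Ex x (nnf (Neg \<phi>))"

datatype quantifier = Exists | Forall

text \<open>
  The branches of the syntax tree, each reduced to its sequence of quantifier symbols.  In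
  negation normal form the \<^const>\<open>Neg\<close> case arises only at literals.
\<close>

primrec branches :: "fo \<Rightarrow> quantifier list set" where
  "branches (Eq x y) = {[]}"
| "branches (Edge x y) = {[]}"
| "branches (Neg \<phi>) = branches \<phi>"
| "branches (Conj \<phi> \<psi>) = branches \<phi> \<union> branches \<psi>"
| "branches (Disj \<phi> \<psi>) = branches \<phi> \<union> branches \<psi>"
| "branches (Ex x \<phi>) = (\<lambda>w. Exists # w) ` branches \<phi>"
| "branches (All x \<phi>) = (\<lambda>w. Forall # w) ` branches \<phi>"

definition alternations :: "quantifier list \<Rightarrow> nat" where
  "alternations w = card {i. Suc i < length w \<and> w ! i \<noteq> w ! Suc i}"

definition alternation_rank :: "fo \<Rightarrow> nat" where
  "alternation_rank \<phi> = Max (alternations ` branches (nnf \<phi>))"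

end

(*
  The proof replaces formulas by games. With batch moves, in which a player picks many vertices at once,
  k rounds correspond to formulas of alternation rank k - 1 whose size is elementary in the batch size.
  So it suffices to show that 3d batch rounds determine all q-round games on the graphs of the class.

  A vertex has rank at least i + 1 if short walks lead from it to vertices of rank at least i around every small
  set of other vertices. A vertex of rank d would be the root of a shallow subdivision of any given tree of
  depth d + 1, so an excluded tree rules it out. Therefore balls contain few vertices of top rank, and the
  rest of a ball has smaller rank. By induction on the rank, one round that names the top vertices near a
  tuple, one that checks that none is missing, and the 3(d - 1) rounds for the rest determine the local type
  of the tuple. By Gaifman's locality argument, the local type and the sizes of scattered families of
  vertices with the same local type (one more round) determine the outcome of all q-round games.
*)

theory Submission
  imports Defs
begin

section \<open>Walks, balls and games\<close>

text \<open>The constants must be chosen in a fixed order. The walk length \<open>r\<close> in the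
  rank has to exceed every locality radius of the argument, while the excluded tree, and with it the
  size \<open>m\<close> of the cuts, is known only after \<open>r\<close>. So the radii may depend
  on \<open>d\<close> and the number of rounds alone, and only the batch size may depend on
  \<open>m\<close> and \<open>r\<close>. The rank is defined by small cuts because it must be
  compared across graphs by one batch move: in this form it has a certificate of bounded size, and
  the certificate survives every injective map that preserves edges. Vertices of top rank leave the
  arena once they are named, but adjacency to them still matters. Positions may therefore contain
  pairs outside the arenas (\<open>P\<close> below). Their number is never bounded; only the pairs
  inside the arenas, the centres of balls, are counted. The smaller arena must be won for more
  rounds (\<open>rounds L q\<close> instead of \<open>q\<close>) and more centres, so the induction
  on the rank treats all \<open>q\<close> and \<open>l\<close> at once.\<close>

locale symmetric_graph =
  fixes E :: "'u \<Rightarrow> 'u \<Rightarrow> bool"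
  assumes E_sym: "E x y \<Longrightarrow> E y x"
begin

primrec near :: "'u set \<Rightarrow> nat \<Rightarrow> 'u \<Rightarrow> 'u \<Rightarrow> bool" where
  "near D 0 x y \<longleftrightarrow> x = y \<and> x \<in> D"
| "near D (Suc n) x y \<longleftrightarrow> x \<in> D \<and> (x = y \<or> (\<exists>z. E x z \<and> near D n z y))"

definition ball :: "'u set \<Rightarrow> 'u set \<Rightarrow> nat \<Rightarrow> 'u set" where
  "ball D S n = {x. \<exists>a\<in>S. near D n a x}"

lemma near_dom: "near D n x y \<Longrightarrow> x \<in> D \<and> y \<in> D"
  by (induction n arbitrary: x) auto

lemma near_refl: "x \<in> D \<Longrightarrow> near D n x x"
  by (cases n) auto

lemma near_mono: "near D n x y \<Longrightarrow> D \<subseteq> D' \<Longrightarrow> n \<le> n' \<Longrightarrow> near D' n' x y"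
proof (induction n arbitrary: n' x)
  case 0
  then show ?case by (auto simp: near_refl)
next
  case (Suc n)
  then obtain k where k: "n' = Suc k" "n \<le> k" by (cases n') auto
  with Suc show ?case by auto
qed

lemma near_trans: "near D n x y \<Longrightarrow> near D m y z \<Longrightarrow> near D (n + m) x z"
proof (induction n arbitrary: x)
  case 0
  then show ?case by simp
next
  case (Suc n)
  show ?case
  proof (cases "x = y")
    case True
    then show ?thesis using Suc.prems(2) near_mono[of D m y z D "Suc n + m"] by simp
  next
    case False
    with Suc show ?thesis by auto
  qed
qed

lemma near_edge: "E x y \<Longrightarrow> x \<in> D \<Longrightarrow> y \<in> D \<Longrightarrow> near D (Suc 0) x y"
  by auto

lemma near_sym: "near D n x y \<Longrightarrow> near D n y x"
proof (induction n arbitrary: x)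
  case 0
  then show ?case by auto
next
  case (Suc n)
  show ?case
  proof (cases "x = y")
    case True
    then show ?thesis using Suc.prems by simp
  next
    case False
    with Suc.prems obtain z where z: "E x z" "near D n z y" "x \<in> D" by auto
    then have "near D n y z" "near D (Suc 0) z x"
      using Suc.IH[OF z(2)] near_edge[OF E_sym[OF z(1)]] near_dom[OF z(2)] by auto
    from near_trans[OF this] show ?thesis by simp
  qed
qed

lemma near_witness:
  "near D n x y \<Longrightarrow> \<exists>P\<subseteq>D. finite P \<and> card P \<le> Suc n \<and> near P n x y"
proof (induction n arbitrary: x)
  case 0
  then show ?case by (intro exI[of _ "{x}"]) auto
next
  case (Suc n)
  show ?case
  proof (cases "x = y")
    case True
    with Suc.prems show ?thesis by (intro exI[of _ "{x}"]) auto
  next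
    case False
    with Suc.prems obtain z where z: "E x z" "near D n z y" "x \<in> D" by auto
    from Suc.IH[OF z(2)] obtain P where P: "P \<subseteq> D" "finite P" "card P \<le> Suc n" "near P n z y"
      by auto
    have "near (insert x P) n z y" using near_mono[OF P(4), of "insert x P" n] by auto
    then show ?thesis using P z
      by (intro exI[of _ "insert x P"]) (auto simp: card_insert_if)
  qed
qed

text \<open>The walk is cut at its first vertex in \<open>S\<close>. As it starts outside
  \<open>S\<close>, a strictly shorter walk remains; this lost step drives the induction in
  \<open>card_rich_near\<close>.\<close>

lemma near_avoid_or_hit:
  assumes "near D n x y" and "x \<notin> S"
  shows "near (D - S) n x y \<or> (\<exists>s\<in>S. \<exists>k<n. near D k s y)"
  using assms
proof (induction n arbitrary: x)
  case 0
  then show ?case by auto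
next
  case (Suc n)
  show ?case
  proof (cases "x = y")
    case True
    then show ?thesis using Suc.prems by auto
  next
    case False
    with Suc.prems obtain z where z: "E x z" "near D n z y" "x \<in> D" by auto
    show ?thesis
    proof (cases "z \<in> S")
      case True
      then show ?thesis using z by blast
    next
      case False
      from Suc.IH[OF z(2) this] show ?thesis
      proof
        assume "near (D - S) n z y"
        then show ?thesis using z Suc.prems(2) by auto
      next
        assume "\<exists>s\<in>S. \<exists>k<n. near D k s y"
        then show ?thesis using less_SucI by blast
      qed
    qed
  qed
qed

lemma ball_mono: "D \<subseteq> D' \<Longrightarrow> S \<subseteq> S' \<Longrightarrow> n \<le> n' \<Longrightarrow> ball D S n \<subseteq> ball D' S' n'"
  unfolding ball_def using near_mono by blast

lemma ball_subset: "ball D S n \<subseteq> D"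
  unfolding ball_def using near_dom by blast

lemma ball_Un: "ball D (S \<union> T) n = ball D S n \<union> ball D T n"
  unfolding ball_def by blast

lemma ball_center: "S \<inter> D \<subseteq> ball D S n"
  unfolding ball_def using near_refl by blast

text \<open>All vertices of a walk of length at most \<open>m\<close> that starts within
  \<open>k\<close> of \<open>S\<close> lie within \<open>k + m\<close> of \<open>S\<close>.\<close>

lemma near_ball:
  assumes "near D m a b" "a \<in> ball D S k" "k + m \<le> n"
  shows "near (ball D S n) m a b"
  using assms
proof (induction m arbitrary: a k)
  case 0
  then have "a \<in> ball D S n" using ball_mono[of D D S S k n] by auto
  with 0 show ?case by simp
next
  case (Suc m)
  have a: "a \<in> ball D S n" using ball_mono[of D D S S k n] Suc.prems by auto
  show ?case
  proof (cases "a = b")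
    case True
    then show ?thesis using a by simp
  next
    case False
    with Suc.prems obtain z where z: "E a z" "near D m z b" by auto
    from Suc.prems(2) obtain s where s: "s \<in> S" "near D k s a" unfolding ball_def by auto
    have "near D (Suc 0) a z"
      using near_edge[OF z(1)] near_dom[OF z(2)] near_dom[OF s(2)] by blast
    from near_trans[OF s(2) this] have "z \<in> ball D S (Suc k)" using s(1) unfolding ball_def by auto
    from Suc.IH[OF z(2) this] Suc.prems have "near (ball D S n) m z b" by auto
    then show ?thesis using a z by auto
  qed
qed

lemma ball_ball:
  assumes "S \<subseteq> ball D S' k" "k + n \<le> m"
  shows "ball (ball D S' m) S n = ball D S n"
proof
  show "ball (ball D S' m) S n \<subseteq> ball D S n"
    using ball_mono[OF ball_subset[of D S' m]] by auto
  show "ball D S n \<subseteq> ball (ball D S' m) S n"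
  proof
    fix x assume "x \<in> ball D S n"
    then obtain s where s: "s \<in> S" "near D n s x" unfolding ball_def by auto
    then have "near (ball D S' m) n s x" using near_ball assms by blast
    then show "x \<in> ball (ball D S' m) S n" using s unfolding ball_def by blast
  qed
qed

section \<open>Ehrenfeucht-Fraisse games with single moves and with batch moves\<close>

definition piso :: "('u \<times> 'u) set \<Rightarrow> bool" where
  "piso Z \<longleftrightarrow> (\<forall>x y x' y'. (x, y) \<in> Z \<longrightarrow> (x', y') \<in> Z \<longrightarrow>
     (x = x' \<longleftrightarrow> y = y') \<and> (E x x' \<longleftrightarrow> E y y'))"

text \<open>A position is the set of pairs of corresponding vertices chosen so far.\<close>
primrec EF :: "nat \<Rightarrow> 'u set \<Rightarrow> 'u set \<Rightarrow> ('u \<times> 'u) set \<Rightarrow> bool" where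
  "EF 0 D D' Z \<longleftrightarrow> piso Z"
| "EF (Suc n) D D' Z \<longleftrightarrow> piso Z
     \<and> (\<forall>x\<in>D. \<exists>y\<in>D'. EF n D D' (insert (x, y) Z))
     \<and> (\<forall>y\<in>D'. \<exists>x\<in>D. EF n D D' (insert (x, y) Z))"

text \<open>A batch lies entirely on one side, so that a round becomes one block of equal
  quantifiers. The isomorphism is tested only at the end; as the empty batch is a legal move, it
  holds at every earlier stage too (\<open>BG_piso\<close>).\<close>

primrec BG :: "nat \<Rightarrow> nat \<Rightarrow> 'u set \<Rightarrow> 'u set \<Rightarrow> ('u \<times> 'u) set \<Rightarrow> bool" where
  "BG 0 s D D' Z \<longleftrightarrow> piso Z"
| "BG (Suc k) s D D' Z \<longleftrightarrow>
       (\<forall>X\<subseteq>D. finite X \<and> card X \<le> s \<longrightarrow>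
          (\<exists>f. f ` X \<subseteq> D' \<and> BG k s D D' (Z \<union> (\<lambda>x. (x, f x)) ` X)))
     \<and> (\<forall>Y\<subseteq>D'. finite Y \<and> card Y \<le> s \<longrightarrow>
          (\<exists>g. g ` Y \<subseteq> D \<and> BG k s D D' (Z \<union> (\<lambda>y. (g y, y)) ` Y)))"

lemma pisoD:
  assumes "piso Z" "(x, y) \<in> Z" "(x', y') \<in> Z"
  shows "x = x' \<longleftrightarrow> y = y'" and "E x x' \<longleftrightarrow> E y y'"
  using assms unfolding piso_def by metis+

lemma piso_subset: "piso Z \<Longrightarrow> Z' \<subseteq> Z \<Longrightarrow> piso Z'"
  unfolding piso_def by (intro allI impI) (simp add: subset_iff)

lemma piso_converse: "piso (Z\<inverse>) \<longleftrightarrow> piso Z"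
proof -
  have "piso Z \<Longrightarrow> piso (Z\<inverse>)" for Z
    unfolding piso_def converse_iff by (intro allI impI conjI) simp_all
  then show ?thesis using converse_converse[of Z] by (metis (full_types))
qed

lemma piso_comp:
  assumes "piso Z" "piso Z'"
  shows "piso (Z O Z')"
  unfolding piso_def
proof (intro allI impI)
  fix x z x' z' assume "(x, z) \<in> Z O Z'" "(x', z') \<in> Z O Z'"
  then obtain y y' where "(x, y) \<in> Z" "(y, z) \<in> Z'" "(x', y') \<in> Z" "(y', z') \<in> Z'" by auto
  then show "(x = x' \<longleftrightarrow> z = z') \<and> (E x x' \<longleftrightarrow> E z z')"
    using pisoD[OF assms(1)] pisoD[OF assms(2)] by metis
qed

lemma EF_piso: "EF n D D' Z \<Longrightarrow> piso Z"
  by (cases n) auto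

lemma EF_fwd:
  "EF (Suc n) D D' Z \<Longrightarrow> x \<in> D \<Longrightarrow> \<exists>y\<in>D'. EF n D D' (insert (x, y) Z)"
  by simp

lemma EF_bwd:
  "EF (Suc n) D D' Z \<Longrightarrow> y \<in> D' \<Longrightarrow> \<exists>x\<in>D. EF n D D' (insert (x, y) Z)"
  by simp

lemma EF_SucI:
  assumes "piso Z"
    and "\<And>x. x \<in> D \<Longrightarrow> \<exists>y\<in>D'. EF n D D' (insert (x, y) Z)"
    and "\<And>y. y \<in> D' \<Longrightarrow> \<exists>x\<in>D. EF n D D' (insert (x, y) Z)"
  shows "EF (Suc n) D D' Z"
  using assms by simp

lemma EF_step_transfer:
  assumes "EF (Suc n) D D' Z" "piso Z'"
    and "\<And>x y. x \<in> D \<Longrightarrow> y \<in> D' \<Longrightarrow> EF n D D' (insert (x, y) Z) \<Longrightarrow> EF m D D' (insert (x, y) Z')"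
  shows "EF (Suc m) D D' Z'"
proof (rule EF_SucI[OF assms(2)])
  fix x assume "x \<in> D"
  then show "\<exists>y\<in>D'. EF m D D' (insert (x, y) Z')"
    using EF_fwd[OF assms(1)] assms(3) by metis
next
  fix y assume "y \<in> D'"
  then show "\<exists>x\<in>D. EF m D D' (insert (x, y) Z')"
    using EF_bwd[OF assms(1)] assms(3) by metis
qed

lemma EF_subset: "EF n D D' Z \<Longrightarrow> Z' \<subseteq> Z \<Longrightarrow> EF n D D' Z'"
proof (induction n arbitrary: Z Z')
  case 0
  then show ?case using piso_subset[of Z Z'] by simp
next
  case (Suc n)
  show ?case
  proof (rule EF_step_transfer[OF Suc.prems(1)])
    show "piso Z'" using EF_piso piso_subset Suc.prems by metis
    fix x y assume "EF n D D' (insert (x, y) Z)"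
    then show "EF n D D' (insert (x, y) Z')"
      by (rule Suc.IH) (use Suc.prems(2) in blast)
  qed
qed

lemma EF_Suc: "EF (Suc n) D D' Z \<Longrightarrow> EF n D D' Z"
proof (induction n arbitrary: Z)
  case 0
  then show ?case by simp
next
  case (Suc n)
  show ?case
    by (rule EF_step_transfer[OF Suc.prems EF_piso[OF Suc.prems]]) (rule Suc.IH)
qed

lemma EF_le: "EF n D D' Z \<Longrightarrow> m \<le> n \<Longrightarrow> EF m D D' Z"
proof (induction n)
  case (Suc n)
  then show ?case using EF_Suc[of n D D' Z] by (cases "m = Suc n") auto
qed simp

lemma EF_converse: "EF n D D' Z \<Longrightarrow> EF n D' D (Z\<inverse>)"
proof (induction n arbitrary: Z)
  case 0
  then show ?case by (simp add: piso_converse)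
next
  case (Suc n)
  have "insert (y, x) (Z\<inverse>) = (insert (x, y) Z)\<inverse>" for x y by auto
  then have *: "EF n D' D (insert (y, x) (Z\<inverse>))" if "EF n D D' (insert (x, y) Z)" for x y
    using Suc.IH[OF that] by simp
  show ?case
  proof (rule EF_SucI)
    show "piso (Z\<inverse>)" using EF_piso[OF Suc.prems] by (simp add: piso_converse)
  next
    fix y assume "y \<in> D'"
    then show "\<exists>x\<in>D. EF n D' D (insert (y, x) (Z\<inverse>))" using EF_bwd[OF Suc.prems] * by metis
  next
    fix x assume "x \<in> D"
    then show "\<exists>y\<in>D'. EF n D' D (insert (y, x) (Z\<inverse>))" using EF_fwd[OF Suc.prems] * by metis
  qed
qed

lemma EF_comp: "EF n A B Z \<Longrightarrow> EF n B C Z' \<Longrightarrow> EF n A C (Z O Z')"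
proof (induction n arbitrary: Z Z')
  case 0
  then show ?case by (simp add: piso_comp)
next
  case (Suc n)
  have *: "EF n A C (insert (x, z) (Z O Z'))"
    if "EF n A B (insert (x, y) Z)" "EF n B C (insert (y, z) Z')" for x y z
    by (rule EF_subset[OF Suc.IH[OF that]]) auto
  show ?case
  proof (rule EF_SucI)
    show "piso (Z O Z')" using EF_piso Suc.prems piso_comp by metis
  next
    fix x assume "x \<in> A"
    then obtain y where y: "y \<in> B" "EF n A B (insert (x, y) Z)" using EF_fwd[OF Suc.prems(1)] by metis
    then obtain z where "z \<in> C" "EF n B C (insert (y, z) Z')" using EF_fwd[OF Suc.prems(2)] by metis
    then show "\<exists>z\<in>C. EF n A C (insert (x, z) (Z O Z'))" using *[OF y(2)] by metis
  next
    fix z assume "z \<in> C"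
    then obtain y where y: "y \<in> B" "EF n B C (insert (y, z) Z')" using EF_bwd[OF Suc.prems(2)] by metis
    then obtain x where "x \<in> A" "EF n A B (insert (x, y) Z)" using EF_bwd[OF Suc.prems(1)] by metis
    then show "\<exists>x\<in>A. EF n A C (insert (x, z) (Z O Z'))" using *[OF _ y(2)] by metis
  qed
qed

text \<open>A move in one part is answered by the strategy for that part, and the shared pairs
  \<open>P\<close> are known to both strategies. Chosen vertices from different parts are distinct
  and nonadjacent on both sides, so the merged position stays a partial isomorphism.\<close>

lemma EF_union:
  assumes "EF n D1 D1' Z1" "EF n D2 D2' Z2"
    and "Z1 \<subseteq> P \<union> D1 \<times> D1'" "Z2 \<subseteq> P \<union> D2 \<times> D2'" "P \<subseteq> Z1" "P \<subseteq> Z2"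
    and far: "\<And>x y. x \<in> D1 \<Longrightarrow> y \<in> D2 \<Longrightarrow> x \<noteq> y \<and> \<not> E x y"
      "\<And>x y. x \<in> D1' \<Longrightarrow> y \<in> D2' \<Longrightarrow> x \<noteq> y \<and> \<not> E x y"
  shows "EF n (D1 \<union> D2) (D1' \<union> D2') (Z1 \<union> Z2)"
  using assms(1-6)
proof (induction n arbitrary: Z1 Z2)
  case (0 Z1 Z2)
  have p: "piso Z1" "piso Z2" using 0 by simp_all
  have *: "(x = x' \<longleftrightarrow> y = y') \<and> (E x x' \<longleftrightarrow> E y y') \<and> (E x' x \<longleftrightarrow> E y' y)"
    if "(x, y) \<in> Z1" "(x', y') \<in> Z2" for x y x' y'
  proof (cases "(x, y) \<in> P \<or> (x', y') \<in> P")
    case True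
    then have "(x, y) \<in> Z2 \<or> (x', y') \<in> Z1" using 0 by blast
    then show ?thesis using that pisoD[OF p(1)] pisoD[OF p(2)] by metis
  next
    case False
    then have "x \<in> D1" "y \<in> D1'" "x' \<in> D2" "y' \<in> D2'" using that 0 by auto
    then show ?thesis using far E_sym by metis
  qed
  have "piso (Z1 \<union> Z2)"
    unfolding piso_def
  proof (intro allI impI)
    fix x y x' y' assume "(x, y) \<in> Z1 \<union> Z2" "(x', y') \<in> Z1 \<union> Z2"
    then show "(x = x' \<longleftrightarrow> y = y') \<and> (E x x' \<longleftrightarrow> E y y')"
      using pisoD[OF p(1)] pisoD[OF p(2)] * by (metis UnE)
  qed
  then show ?case by simp
next
  case (Suc n Z1 Z2)
  have 1: "EF n (D1 \<union> D2) (D1' \<union> D2') (insert (x, y) (Z1 \<union> Z2))"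
    if "EF n D1 D1' (insert (x, y) Z1)" "x \<in> D1" "y \<in> D1'" for x y
    using Suc.IH[OF that(1) EF_Suc[OF Suc.prems(2)]] that Suc.prems by auto
  have 2: "EF n (D1 \<union> D2) (D1' \<union> D2') (insert (x, y) (Z1 \<union> Z2))"
    if "EF n D2 D2' (insert (x, y) Z2)" "x \<in> D2" "y \<in> D2'" for x y
    using Suc.IH[OF EF_Suc[OF Suc.prems(1)] that(1)] that Suc.prems by auto
  show ?case
  proof (rule EF_SucI)
    have "EF n (D1 \<union> D2) (D1' \<union> D2') (Z1 \<union> Z2)"
      using Suc.IH[OF EF_Suc[OF Suc.prems(1)] EF_Suc[OF Suc.prems(2)] Suc.prems(3-6)] .
    then show "piso (Z1 \<union> Z2)" by (rule EF_piso)
  next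
    fix x assume "x \<in> D1 \<union> D2"
    then show "\<exists>y\<in>D1' \<union> D2'. EF n (D1 \<union> D2) (D1' \<union> D2') (insert (x, y) (Z1 \<union> Z2))"
      using EF_fwd[OF Suc.prems(1)] EF_fwd[OF Suc.prems(2)] 1 2 by (metis Un_iff)
  next
    fix y assume "y \<in> D1' \<union> D2'"
    then show "\<exists>x\<in>D1 \<union> D2. EF n (D1 \<union> D2) (D1' \<union> D2') (insert (x, y) (Z1 \<union> Z2))"
      using EF_bwd[OF Suc.prems(1)] EF_bwd[OF Suc.prems(2)] 1 2 by (metis Un_iff)
  qed
qed

text \<open>A vertex of a chosen pair is answered by its partner. This does not change the position,
  so enlarging the arenas by such vertices costs no round.\<close>

lemma EF_add_chosen:
  "EF n D D' Z \<Longrightarrow> F \<subseteq> Z \<Longrightarrow> EF n (D \<union> Domain F) (D' \<union> Range F) Z"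
proof (induction n arbitrary: Z)
  case 0
  then show ?case by simp
next
  case (Suc n)
  have *: "EF n (D \<union> Domain F) (D' \<union> Range F) (insert p Z)" if "EF n D D' (insert p Z)" for p
    using Suc.IH[OF that] Suc.prems by blast
  have F: "EF n (D \<union> Domain F) (D' \<union> Range F) (insert p Z)" if "p \<in> F" for p
    using *[of p] EF_Suc[OF Suc.prems(1)] Suc.prems(2) that by (simp add: insert_absorb subsetD)
  show ?case
  proof (rule EF_SucI)
    show "piso Z" using EF_piso[OF Suc.prems(1)] .
  next
    fix x assume "x \<in> D \<union> Domain F"
    then consider "x \<in> D" | y where "(x, y) \<in> F" by blast
    then show "\<exists>y\<in>D' \<union> Range F. EF n (D \<union> Domain F) (D' \<union> Range F) (insert (x, y) Z)"
      using EF_fwd[OF Suc.prems(1)] * F by cases (metis Un_iff, metis Un_iff RangeI)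
  next
    fix y assume "y \<in> D' \<union> Range F"
    then consider "y \<in> D'" | x where "(x, y) \<in> F" by blast
    then show "\<exists>x\<in>D \<union> Domain F. EF n (D \<union> Domain F) (D' \<union> Range F) (insert (x, y) Z)"
      using EF_bwd[OF Suc.prems(1)] * F by cases (metis Un_iff, metis Un_iff DomainI)
  qed
qed

text \<open>The vertices of the walk are picked one by one, one round per edge. Each answer lies in
  \<open>D'\<close> and is adjacent to the previous one; the last answer must be \<open>c'\<close>
  because \<open>c\<close> is already paired with it.\<close>

lemma EF_near:
  assumes "EF k D D' Z" "(a, b) \<in> Z" "(c, c') \<in> Z" "b \<in> D'" "near D k a c"
  shows "near D' k b c'"
  using assms
proof (induction k arbitrary: a b Z)
  case 0
  then show ?case using pisoD(1)[of Z a b c c'] by auto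
next
  case (Suc k)
  show ?case
  proof (cases "a = c")
    case True
    then show ?thesis using Suc.prems pisoD(1)[OF EF_piso, of _ D D' Z a b c c'] by auto
  next
    case False
    with Suc.prems obtain z where z: "E a z" "near D k z c" by auto
    then have "z \<in> D" using near_dom by blast
    with Suc.prems(1) obtain z' where z': "z' \<in> D'" "EF k D D' (insert (z, z') Z)" by auto
    have "near D' k z' c'" using Suc.IH[OF z'(2) _ _ z'(1) z(2)] Suc.prems by auto
    moreover have "E b z'"
      using pisoD(2)[OF EF_piso[OF z'(2)], of a b z z'] z Suc.prems(2) by auto
    ultimately show ?thesis using Suc.prems by auto
  qed
qed

lemma EF_near_iff:
  assumes "EF k D D' Z" "(a, b) \<in> Z" "(c, c') \<in> Z" "a \<in> D \<longleftrightarrow> b \<in> D'"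
  shows "near D k a c \<longleftrightarrow> near D' k b c'"
  using EF_near[OF assms(1-3)] EF_near[OF EF_converse[OF assms(1)], of b a c' c] assms near_dom
  by (metis converse_iff)

text \<open>An answer that leaves the ball would be refuted in the \<open>k\<close> rounds held in
  reserve, because distances up to \<open>k\<close> from the centres agree
  (\<open>EF_near_iff\<close>). A centre outside its arena has an empty ball; the last hypothesis
  makes this happen on both sides or on neither.\<close>

lemma EF_ball:
  assumes "EF (n + k) D D' Z" "S \<subseteq> Z" "\<And>a b. (a, b) \<in> S \<Longrightarrow> a \<in> D \<longleftrightarrow> b \<in> D'"
  shows "EF n (ball D (Domain S) k) (ball D' (Range S) k) Z"
  using assms(1,2)
proof (induction n arbitrary: Z)
  case 0
  then show ?case using EF_piso by auto
next
  case (Suc n)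
  have *: "x \<in> ball D (Domain S) k \<longleftrightarrow> y \<in> ball D' (Range S) k"
    if "EF (n + k) D D' (insert (x, y) Z)" for x y
  proof -
    have k: "EF k D D' (insert (x, y) Z)" using EF_le[OF that] by simp
    have "near D k a x \<longleftrightarrow> near D' k b y" if "(a, b) \<in> S" for a b
      using EF_near_iff[OF k, of a b x y] assms(3) Suc.prems that by blast
    then show ?thesis unfolding ball_def by blast
  qed
  have IH: "EF n (ball D (Domain S) k) (ball D' (Range S) k) (insert (x, y) Z)"
    if "EF (n + k) D D' (insert (x, y) Z)" for x y
    using Suc.IH[OF that] Suc.prems by blast
  show ?case
  proof (rule EF_SucI)
    show "piso Z" using EF_piso[OF Suc.prems(1)] .
  next
    fix x assume x: "x \<in> ball D (Domain S) k"
    then have "x \<in> D" using ball_subset by blast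
    then obtain y where "y \<in> D'" "EF (n + k) D D' (insert (x, y) Z)"
      using EF_fwd[of "n + k"] Suc.prems(1) by (metis add_Suc)
    then show "\<exists>y\<in>ball D' (Range S) k.
        EF n (ball D (Domain S) k) (ball D' (Range S) k) (insert (x, y) Z)"
      using *[of x y] IH[of x y] x by metis
  next
    fix y assume y: "y \<in> ball D' (Range S) k"
    then have "y \<in> D'" using ball_subset by blast
    then obtain x where "x \<in> D" "EF (n + k) D D' (insert (x, y) Z)"
      using EF_bwd[of "n + k"] Suc.prems(1) by (metis add_Suc)
    then show "\<exists>x\<in>ball D (Domain S) k.
        EF n (ball D (Domain S) k) (ball D' (Range S) k) (insert (x, y) Z)"
      using *[of x y] IH[of x y] y by metis
  qed
qed

lemma EF_answer_set:
  assumes "finite Y" "Y \<subseteq> D'" "EF (card Y + k) D D' Z"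
  shows "\<exists>g. g ` Y \<subseteq> D \<and> EF k D D' (Z \<union> (\<lambda>y. (g y, y)) ` Y)"
  using assms
proof (induction Y arbitrary: Z rule: finite_induct)
  case empty
  then show ?case by simp
next
  case (insert y Y)
  then obtain x where x: "x \<in> D" "EF (card Y + k) D D' (insert (x, y) Z)" by auto
  obtain g where g: "g ` Y \<subseteq> D" "EF k D D' (insert (x, y) Z \<union> (\<lambda>y. (g y, y)) ` Y)"
    using insert.IH[OF _ x(2)] insert.prems by auto
  have e: "(\<lambda>v. ((g(y := x)) v, v)) ` insert y Y = insert (x, y) ((\<lambda>y. (g y, y)) ` Y)"
    "(g(y := x)) ` insert y Y = insert x (g ` Y)"
    using insert.hyps by auto
  show ?case
    by (rule exI[of _ "g(y := x)"], unfold e) (use g x in auto)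
qed

section \<open>Basic properties of the batch game\<close>

lemma BG_move:
  assumes "BG (Suc k) s D D' Z" "X \<subseteq> D" "finite X" "card X \<le> s"
  shows "\<exists>f. f ` X \<subseteq> D' \<and> BG k s D D' (Z \<union> (\<lambda>x. (x, f x)) ` X)"
  using assms by simp

lemma BG_move':
  assumes "BG (Suc k) s D D' Z" "Y \<subseteq> D'" "finite Y" "card Y \<le> s"
  shows "\<exists>g. g ` Y \<subseteq> D \<and> BG k s D D' (Z \<union> (\<lambda>y. (g y, y)) ` Y)"
  using assms by simp

lemma BG_Suc: "BG (Suc k) s D D' Z \<Longrightarrow> BG k s D D' Z"
  using BG_move[of k s D D' Z "{}"] by simp

lemma BG_piso: "BG k s D D' Z \<Longrightarrow> piso Z"
  by (induction k) (use BG_Suc in \<open>simp_all del: BG.simps(2)\<close>)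

lemma BG_SucI:
  assumes "\<And>X. X \<subseteq> D \<Longrightarrow> finite X \<Longrightarrow> card X \<le> s \<Longrightarrow>
      \<exists>f. f ` X \<subseteq> D' \<and> BG k s D D' (Z \<union> (\<lambda>x. (x, f x)) ` X)"
    and "\<And>Y. Y \<subseteq> D' \<Longrightarrow> finite Y \<Longrightarrow> card Y \<le> s \<Longrightarrow>
      \<exists>g. g ` Y \<subseteq> D \<and> BG k s D D' (Z \<union> (\<lambda>y. (g y, y)) ` Y)"
  shows "BG (Suc k) s D D' Z"
  using assms by simp

declare BG.simps(2) [simp del] EF.simps(2) [simp del]

lemma BG_subset: "BG k s D D' Z \<Longrightarrow> Z' \<subseteq> Z \<Longrightarrow> BG k s D D' Z'"
proof (induction k arbitrary: Z Z')
  case 0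
  then show ?case using piso_subset[of Z Z'] by simp
next
  case (Suc k)
  have "Z' \<union> A \<subseteq> Z \<union> A" for A using Suc.prems by blast
  then have *: "BG k s D D' (Z' \<union> A)" if "BG k s D D' (Z \<union> A)" for A
    using Suc.IH that by metis
  show ?case
  proof (rule BG_SucI)
    fix X assume "X \<subseteq> D" "finite X" "card X \<le> s"
    from BG_move[OF Suc.prems(1) this]
    show "\<exists>f. f ` X \<subseteq> D' \<and> BG k s D D' (Z' \<union> (\<lambda>x. (x, f x)) ` X)" using * by metis
  next
    fix Y assume "Y \<subseteq> D'" "finite Y" "card Y \<le> s"
    from BG_move'[OF Suc.prems(1) this]
    show "\<exists>g. g ` Y \<subseteq> D \<and> BG k s D D' (Z' \<union> (\<lambda>y. (g y, y)) ` Y)" using * by metis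
  qed
qed

lemma BG_converse: "BG k s D D' Z \<Longrightarrow> BG k s D' D (Z\<inverse>)"
proof (induction k arbitrary: Z)
  case 0
  then show ?case by (simp add: piso_converse)
next
  case (Suc k)
  have e: "Z\<inverse> \<union> (\<lambda>y. (y, g y)) ` Y = (Z \<union> (\<lambda>y. (g y, y)) ` Y)\<inverse>"
    "Z\<inverse> \<union> (\<lambda>y. (g y, y)) ` Y = (Z \<union> (\<lambda>y. (y, g y)) ` Y)\<inverse>" for g :: "'u \<Rightarrow> 'u" and Y by auto
  show ?case
  proof (rule BG_SucI)
    fix X assume "X \<subseteq> D'" "finite X" "card X \<le> s"
    from BG_move'[OF Suc.prems this]
    show "\<exists>f. f ` X \<subseteq> D \<and> BG k s D' D (Z\<inverse> \<union> (\<lambda>x. (x, f x)) ` X)"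
      unfolding e(1) using Suc.IH by blast
  next
    fix Y assume "Y \<subseteq> D" "finite Y" "card Y \<le> s"
    from BG_move[OF Suc.prems this]
    show "\<exists>g. g ` Y \<subseteq> D' \<and> BG k s D' D (Z\<inverse> \<union> (\<lambda>y. (g y, y)) ` Y)"
      unfolding e(2) using Suc.IH by blast
  qed
qed

end


section \<open>Locality\<close>

context symmetric_graph begin

declare near.simps(2) [simp del]

text \<open>Only the pairs of \<open>A\<close> are centres of balls. The pairs of \<open>P\<close>
  act as constants: the local type records adjacency to them.\<close>

definition local_eq ::
  "nat \<Rightarrow> nat \<Rightarrow> 'u set \<Rightarrow> 'u set \<Rightarrow> ('u \<times> 'u) set \<Rightarrow> ('u \<times> 'u) set \<Rightarrow> bool" where
  "local_eq \<rho> n W W' P A \<longleftrightarrow> EF n (ball W (Domain A) \<rho>) (ball W' (Range A) \<rho>) (P \<union> A)"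

definition scattered :: "'u set \<Rightarrow> nat \<Rightarrow> 'u set \<Rightarrow> bool" where
  "scattered D n X \<longleftrightarrow> (\<forall>x\<in>X. \<forall>y\<in>X. x \<noteq> y \<longrightarrow> \<not> near D n x y)"

text \<open>This plays the role of the counting sentences in Gaifman normal form, but it moves a
  whole scattered family with mixed local types at once. The bound \<open>4 * \<rho> + 2\<close> is
  twice \<open>2 * \<rho> + 1\<close>, the distance beyond which two balls of radius \<rho> are
  disjoint and not adjacent.\<close>

definition scattered_transfer ::
  "'u set \<Rightarrow> 'u set \<Rightarrow> ('u \<times> 'u) set \<Rightarrow> nat \<Rightarrow> nat \<Rightarrow> nat \<Rightarrow> bool" where
  "scattered_transfer W W' P L \<rho> n \<longleftrightarrow>
     (\<forall>X\<subseteq>W. finite X \<and> card X \<le> L \<and> scattered W (4 * \<rho> + 2) X \<longrightarrow>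
        (\<exists>f. f ` X \<subseteq> W' \<and> inj_on f X \<and> scattered W' (4 * \<rho> + 2) (f ` X)
           \<and> (\<forall>x\<in>X. local_eq \<rho> n W W' P {(x, f x)})))"

lemma local_eq_converse:
  "local_eq \<rho> n W W' P A \<Longrightarrow> local_eq \<rho> n W' W (P\<inverse>) (A\<inverse>)"
  unfolding local_eq_def Domain_converse Range_converse converse_Un[symmetric]
  by (rule EF_converse)

lemma center_subset: "S \<subseteq> D \<Longrightarrow> S \<subseteq> ball D S n"
  using ball_center[of S D n] by blast

lemma EF_near_ball:
  assumes "EF k (ball W S R) (ball W' S' R) Z" "(a, b) \<in> Z" "(c, c') \<in> Z"
    and "b \<in> ball W' S' R" "a \<in> ball W S i" "i + m \<le> R" "m \<le> k" "near W m a c"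
  shows "near W' m b c'"
proof -
  have "near (ball W S R) m a c" using near_ball assms by blast
  from EF_near[OF EF_le[OF assms(1,7)] assms(2-4) this]
  show ?thesis using near_mono ball_subset by blast
qed

lemma EF_imp_local_eq:
  assumes "EF (n + \<rho>) (ball W S R) (ball W' S' R) Z" "P \<union> B \<subseteq> Z"
    and "Domain B \<subseteq> ball W S k" "Range B \<subseteq> ball W' S' k" "k + \<rho> \<le> R"
  shows "local_eq \<rho> n W W' P B"
proof -
  have *: "ball W S k \<subseteq> ball W S R" "ball W' S' k \<subseteq> ball W' S' R"
    using ball_mono assms(5) by simp_all
  have "EF n (ball (ball W S R) (Domain B) \<rho>) (ball (ball W' S' R) (Range B) \<rho>) Z"
    using assms * by (intro EF_ball) auto
  then show ?thesis
    unfolding local_eq_def ball_ball[OF assms(3,5)] ball_ball[OF assms(4,5)]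
    using EF_subset assms(2) by blast
qed

text \<open>Each member of \<open>Y\<close> is within \<open>k\<close> of some element of
  \<open>S\<close>. Two members sharing that element would be within \<open>2 * k\<close> of each
  other, so the choice is injective.\<close>

lemma scattered_finite_card:
  assumes "scattered W (2 * k) Y" "Y \<subseteq> ball W S k" "finite S"
  shows "finite Y \<and> card Y \<le> card S"
proof -
  have "\<forall>y\<in>Y. \<exists>s\<in>S. near W k s y" using assms(2) unfolding ball_def by blast
  then obtain h where h: "\<And>y. y \<in> Y \<Longrightarrow> h y \<in> S" "\<And>y. y \<in> Y \<Longrightarrow> near W k (h y) y" by metis
  have "inj_on h Y"
  proof (rule inj_onI)
    fix x y assume xy: "x \<in> Y" "y \<in> Y" "h x = h y"
    then have "near W k x (h x)" "near W k (h x) y" using h near_sym by metis+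
    from near_trans[OF this] have "near W (2 * k) x y" by (simp add: mult_2)
    then show "x = y" using assms(1) xy unfolding scattered_def by blast
  qed
  moreover have "h ` Y \<subseteq> S" using h by blast
  ultimately show ?thesis
    using assms(3) card_inj_on_le finite_imageD finite_subset by metis
qed

text \<open>
  If every vertex of \<open>W'\<close> with the local type of \<open>c\<close> were close to \<open>A\<close>, a largest scattered family
  of such vertices could be pulled back to \<open>W\<close> inside the balls around \<open>A\<close>; adding \<open>c\<close> to it and
  transferring the result would give a larger family.
\<close>
lemma far_answer:
  assumes A: "A \<subseteq> W \<times> W'" "finite A" "card A < L"
    and loc: "local_eq (7 * \<rho> + 3) (n + 7 * \<rho> + L + 4) W W' P A"
    and glob: "scattered_transfer W W' P L \<rho> n"
    and c: "c \<in> W" "c \<notin> ball W (Domain A) (6 * \<rho> + 3)"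
  shows "\<exists>c'\<in>W'. local_eq \<rho> n W W' P {(c, c')} \<and> c' \<notin> ball W' (Range A) (2 * \<rho> + 1)"
proof (rule ccontr)
  define T where "T = {y \<in> W'. local_eq \<rho> n W W' P {(c, y)}}"
  assume "\<not> ?thesis"
  then have T: "T \<subseteq> ball W' (Range A) (2 * \<rho> + 1)" unfolding T_def by blast
  define F where "F = {Y. Y \<subseteq> T \<and> scattered W' (4 * \<rho> + 2) Y}"
  have F: "finite Y \<and> card Y \<le> card A" if "Y \<in> F" for Y
  proof -
    have "card (Range A) \<le> card A" using card_image_le[OF A(2), of snd] by (simp add: Range_snd)
    moreover have "finite Y \<and> card Y \<le> card (Range A)"
      using that T A(2) unfolding F_def
      by (intro scattered_finite_card[of W' "2 * \<rho> + 1"]) (auto simp: finite_Range)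
    ultimately show ?thesis by simp
  qed
  have "{} \<in> F" unfolding F_def scattered_def by simp
  then obtain Y where Y: "Y \<in> F" and max: "\<And>Y'. Y' \<in> F \<Longrightarrow> card Y' \<le> card Y"
    using ex_has_greatest_nat[of "\<lambda>Y. Y \<in> F" "{}" card "Suc (card A)"] F le_imp_less_Suc by metis
  let ?D = "ball W (Domain A) (7 * \<rho> + 3)" and ?D' = "ball W' (Range A) (7 * \<rho> + 3)"
  let ?k = "n + 7 * \<rho> + 4"
  have fY: "finite Y" "card Y \<le> card A" using F[OF Y] by auto
  have YT: "Y \<subseteq> T" and Ysc: "scattered W' (4 * \<rho> + 2) Y" using Y unfolding F_def by auto
  have Yn: "Y \<subseteq> ball W' (Range A) (2 * \<rho> + 1)" using YT T by blast
  \<comment> \<open>Pulling back \<open>Y\<close> takes at most \<open>card A < L\<close> rounds.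
    The \<open>?k\<close> rounds that remain cover distance checks up to
    \<open>4 * \<rho> + 2\<close> and the \<open>n + \<rho>\<close> rounds needed for local
    types.\<close>
  have "card Y + ?k \<le> n + 7 * \<rho> + L + 4" using fY A by simp
  then have "EF (card Y + ?k) ?D ?D' (P \<union> A)" using EF_le loc unfolding local_eq_def by blast
  moreover have "Y \<subseteq> ?D'" using Yn ball_mono[of W' W' "Range A" "Range A" "2 * \<rho> + 1" "7 * \<rho> + 3"] by auto
  ultimately obtain g where g: "g ` Y \<subseteq> ?D" "EF ?k ?D ?D' (P \<union> A \<union> (\<lambda>y. (g y, y)) ` Y)" (is "EF _ _ _ ?Z")
    using EF_answer_set[OF fY(1), of ?D' ?k ?D "P \<union> A"] by blast
  have AD: "Domain A \<subseteq> ball W (Domain A) 0" "Range A \<subseteq> ball W' (Range A) 0"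
    using center_subset[of "Domain A" W] center_subset[of "Range A" W'] A(1) by blast+
  have AD': "Domain A \<subseteq> ?D" "Range A \<subseteq> ?D'"
    using center_subset[of "Domain A" W] center_subset[of "Range A" W'] A(1) by blast+
  have gn: "g y \<in> ball W (Domain A) (2 * \<rho> + 1)" if y: "y \<in> Y" for y
  proof -
    obtain a b where ab: "(a, b) \<in> A" "near W' (2 * \<rho> + 1) b y" using Yn y unfolding ball_def by blast
    have "near W (2 * \<rho> + 1) a (g y)"
      by (rule EF_near_ball[OF EF_converse[OF g(2)], of b a y "g y" 0]) (use ab y AD AD' in auto)
    then show ?thesis using ab unfolding ball_def by blast
  qed
  have gsc: "\<not> near W (4 * \<rho> + 2) (g x) (g y)" if xy: "x \<in> Y" "y \<in> Y" "x \<noteq> y" for x y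
  proof
    assume n: "near W (4 * \<rho> + 2) (g x) (g y)"
    have "near W' (4 * \<rho> + 2) x y"
      by (rule EF_near_ball[OF g(2) _ _ _ gn[OF xy(1)] _ _ n]) (use xy \<open>Y \<subseteq> ?D'\<close> in auto)
    then show False using Ysc xy unfolding scattered_def by blast
  qed
  have ginj: "inj_on g Y"
    using pisoD(1)[OF EF_piso[OF g(2)]] by (intro inj_onI) blast
  have gloc: "local_eq \<rho> n W W' P {(g y, y)}" if "y \<in> Y" for y
    by (rule EF_imp_local_eq[OF EF_le[OF g(2)], where k = "2 * \<rho> + 1"]) (use that gn Yn in auto)
  \<comment> \<open>The origin of \<open>6 * \<rho> + 3\<close>: the pulled-back family lies within
    \<open>2 * \<rho> + 1\<close> of \<open>A\<close>, and \<open>c\<close> must keep the scattering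
    distance \<open>4 * \<rho> + 2\<close> from it.\<close>
  have cfar: "\<not> near W (4 * \<rho> + 2) (g y) c" if "y \<in> Y" for y
  proof
    assume *: "near W (4 * \<rho> + 2) (g y) c"
    from gn[OF that] obtain a where "a \<in> Domain A" "near W (2 * \<rho> + 1) a (g y)" unfolding ball_def by blast
    moreover have "2 * \<rho> + 1 + (4 * \<rho> + 2) = 6 * \<rho> + 3" by simp
    ultimately have "a \<in> Domain A" "near W (6 * \<rho> + 3) a c"
      using near_trans[OF _ *, of "2 * \<rho> + 1" a] by metis+
    then have "c \<in> ball W (Domain A) (6 * \<rho> + 3)" unfolding ball_def by blast
    then show False using c by simp
  qed
  have cg: "c \<notin> g ` Y" using gn ball_mono[of W W "Domain A" "Domain A" "2 * \<rho> + 1" "6 * \<rho> + 3"] c by auto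
  let ?X = "insert c (g ` Y)"
  have "scattered W (4 * \<rho> + 2) ?X"
    unfolding scattered_def
  proof (intro ballI impI)
    fix x y assume xy: "x \<in> ?X" "y \<in> ?X" "x \<noteq> y"
    have "\<not> near W (4 * \<rho> + 2) c (g z)" if "z \<in> Y" for z using cfar[OF that] near_sym by blast
    then show "\<not> near W (4 * \<rho> + 2) x y"
      using xy cfar gsc by (metis imageE insertE)
  qed
  moreover have cX: "card ?X = Suc (card Y)" using cg ginj fY by (simp add: card_image)
  moreover have "finite ?X" "card ?X \<le> L" using fY A(3) cX by simp_all
  moreover have "?X \<subseteq> W" using c g(1) ball_subset by blast
  ultimately have "\<exists>f. f ` ?X \<subseteq> W' \<and> inj_on f ?X \<and> scattered W' (4 * \<rho> + 2) (f ` ?X)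
      \<and> (\<forall>x\<in>?X. local_eq \<rho> n W W' P {(x, f x)})"
    using glob unfolding scattered_transfer_def by blast
  then obtain f where f: "f ` ?X \<subseteq> W'" "inj_on f ?X" "scattered W' (4 * \<rho> + 2) (f ` ?X)"
    "\<And>x. x \<in> ?X \<Longrightarrow> local_eq \<rho> n W W' P {(x, f x)}"
    by blast
  have "f ` ?X \<subseteq> T"
  proof
    fix v assume "v \<in> f ` ?X"
    then consider "v = f c" | y where "y \<in> Y" "v = f (g y)" by blast
    then show "v \<in> T"
    proof cases
      case 1
      then show ?thesis using f unfolding T_def by auto
    next
      case 2
      \<comment> \<open>Local types are compared along \<open>c\<close>, \<open>y\<close>,
        \<open>g y\<close>, \<open>f (g y)\<close>; the first link holds because \<open>y\<close>
        belongs to \<open>T\<close>.\<close>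
      have "EF n (ball W {c} \<rho>) (ball W' {y} \<rho>) (P \<union> {(c, y)})"
        "EF n (ball W {g y} \<rho>) (ball W' {y} \<rho>) (P \<union> {(g y, y)})"
        "EF n (ball W {g y} \<rho>) (ball W' {f (g y)} \<rho>) (P \<union> {(g y, f (g y))})"
        using 2 YT gloc[OF 2(1)] f(4)[of "g y"] unfolding T_def local_eq_def by auto
      from EF_comp[OF EF_comp[OF this(1) EF_converse[OF this(2)]] this(3)]
      have "EF n (ball W {c} \<rho>) (ball W' {f (g y)} \<rho>) (P \<union> {(c, f (g y))})"
        by (rule EF_subset) auto
      then show ?thesis using 2 f(1) unfolding T_def local_eq_def by auto
    qed
  qed
  with f(3) have "f ` ?X \<in> F" unfolding F_def by blast
  from max[OF this] show False
    using card_image[OF f(2)] cX by simp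
qed

text \<open>A vertex near \<open>A\<close> is answered inside the large ball, where enough rounds
  are left to force the answer to be near as well; \<open>7 * \<rho> + 3\<close> leaves room for a
  ball of radius \<rho> around anything within \<open>6 * \<rho> + 3\<close>. A far vertex gets a
  far answer of the same local type, and the two independent local games are merged by
  \<open>EF_union\<close>.\<close>

lemma local_eq_step:
  assumes P: "P \<subseteq> (- W) \<times> (- W')"
    and A: "A \<subseteq> W \<times> W'" "finite A" "card A < L"
    and loc: "local_eq (7 * \<rho> + 3) (n + 7 * \<rho> + L + 4) W W' P A"
    and glob: "scattered_transfer W W' P L \<rho> n"
    and c: "c \<in> W"
  shows "\<exists>c'\<in>W'. local_eq \<rho> n W W' P (insert (c, c') A)"
proof (cases "c \<in> ball W (Domain A) (6 * \<rho> + 3)")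
  case True
  let ?D = "ball W (Domain A) (7 * \<rho> + 3)" and ?D' = "ball W' (Range A) (7 * \<rho> + 3)"
  have AD: "Domain A \<subseteq> ball W (Domain A) 0" "Range A \<subseteq> ball W' (Range A) 0"
    using center_subset[of "Domain A" W] center_subset[of "Range A" W'] A(1) by blast+
  have AD': "Range A \<subseteq> ?D'" "Domain A \<subseteq> ball W (Domain A) (6 * \<rho> + 3)"
    "Range A \<subseteq> ball W' (Range A) (6 * \<rho> + 3)"
    using center_subset[of "Domain A" W] center_subset[of "Range A" W'] A(1) by blast+
  have "c \<in> ?D" using True ball_mono[of W W "Domain A" "Domain A" "6 * \<rho> + 3" "7 * \<rho> + 3"] by auto
  moreover have "EF (Suc (n + 7 * \<rho> + 3)) ?D ?D' (P \<union> A)"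
    using loc EF_le[of "n + 7 * \<rho> + L + 4" _ _ _ "Suc (n + 7 * \<rho> + 3)"] unfolding local_eq_def by simp
  ultimately obtain c' where c': "c' \<in> ?D'" "EF (n + 7 * \<rho> + 3) ?D ?D' (insert (c, c') (P \<union> A))"
    using EF_fwd by metis
  have "c' \<in> ball W' (Range A) (6 * \<rho> + 3)"
  proof -
    obtain a b where ab: "(a, b) \<in> A" "near W (6 * \<rho> + 3) a c" using True unfolding ball_def by blast
    have "near W' (6 * \<rho> + 3) b c'"
      by (rule EF_near_ball[OF c'(2), of a b c c' 0]) (use ab AD AD' in auto)
    then show ?thesis using ab unfolding ball_def by blast
  qed
  then have "local_eq \<rho> n W W' P (insert (c, c') A)"
    using True AD' by (intro EF_imp_local_eq[OF EF_le[OF c'(2)], where k = "6 * \<rho> + 3"]) auto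
  then show ?thesis using c' ball_subset by blast
next
  case False
  from far_answer[OF A loc glob c False]
  obtain c' where c': "c' \<in> W'" "local_eq \<rho> n W W' P {(c, c')}" "c' \<notin> ball W' (Range A) (2 * \<rho> + 1)"
    by blast
  have AD: "Domain A \<subseteq> ball W (Domain A) 0" "Range A \<subseteq> ball W' (Range A) 0"
    using center_subset[of "Domain A" W] center_subset[of "Range A" W'] A(1) by blast+
  have "local_eq \<rho> n W W' P A"
    using AD loc unfolding local_eq_def[of "7 * \<rho> + 3"]
    by (intro EF_imp_local_eq[OF EF_le, where k = 0]) auto
  moreover have sep: "x \<noteq> y \<and> \<not> E x y"
    if V: "z \<in> V" "z \<notin> ball V S (2 * \<rho> + 1)" "x \<in> ball V S \<rho>" "y \<in> ball V {z} \<rho>" for x y z V S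
  proof -
    obtain s where s: "s \<in> S" "near V \<rho> s x" using V unfolding ball_def by blast
    have y: "near V \<rho> y z" using V near_sym unfolding ball_def by blast
    have *: False if xy: "near V (Suc 0) x y"
    proof -
      have "\<rho> + Suc 0 + \<rho> = 2 * \<rho> + 1" by simp
      with near_trans[OF near_trans[OF s(2) xy] y] have "near V (2 * \<rho> + 1) s z" by metis
      then show False using s(1) V unfolding ball_def by blast
    qed
    have "x \<in> V" "y \<in> V" using near_dom s y by blast+
    then show ?thesis using * near_refl[of x V "Suc 0"] near_edge by metis
  qed
  have "c \<notin> ball W (Domain A) (2 * \<rho> + 1)"
    using False ball_mono[of W W "Domain A" "Domain A" "2 * \<rho> + 1" "6 * \<rho> + 3"] by auto
  note sep1 = sep[OF c this] and sep2 = sep[OF c'(1,3)]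
  have "EF n (ball W (Domain A) \<rho> \<union> ball W {c} \<rho>) (ball W' (Range A) \<rho> \<union> ball W' {c'} \<rho>)
      ((P \<union> A) \<union> (P \<union> {(c, c')}))"
  proof (rule EF_union[where P = P])
    show "EF n (ball W (Domain A) \<rho>) (ball W' (Range A) \<rho>) (P \<union> A)"
      using calculation unfolding local_eq_def .
    show "EF n (ball W {c} \<rho>) (ball W' {c'} \<rho>) (P \<union> {(c, c')})"
      using c'(2) unfolding local_eq_def by simp
    show "P \<union> A \<subseteq> P \<union> ball W (Domain A) \<rho> \<times> ball W' (Range A) \<rho>"
      using center_subset[of "Domain A" W \<rho>] center_subset[of "Range A" W' \<rho>] A(1) by fastforce
    show "P \<union> {(c, c')} \<subseteq> P \<union> ball W {c} \<rho> \<times> ball W' {c'} \<rho>"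
      using c c' near_refl unfolding ball_def by auto
  qed (use sep1 sep2 in auto)
  moreover have "(P \<union> A) \<union> (P \<union> {(c, c')}) = P \<union> insert (c, c') A"
    "ball W (Domain A) \<rho> \<union> ball W {c} \<rho> = ball W (Domain (insert (c, c') A)) \<rho>"
    "ball W' (Range A) \<rho> \<union> ball W' {c'} \<rho> = ball W' (Range (insert (c, c') A)) \<rho>"
    unfolding ball_Un[symmetric] by (auto intro!: arg_cong[where f = "\<lambda>S. ball _ S _"])
  ultimately show ?thesis using c'(1) unfolding local_eq_def by auto
qed

end

text \<open>\<open>radius\<close> and \<open>rounds\<close> solve the recurrences of
  \<open>local_eq_step\<close> backwards from the end of the game, where a partial isomorphism is
  all that is required.\<close>

primrec radius :: "nat \<Rightarrow> nat" where
  "radius 0 = 0"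
| "radius (Suc q) = 7 * radius q + 3"

primrec rounds :: "nat \<Rightarrow> nat \<Rightarrow> nat" where
  "rounds L 0 = 0"
| "rounds L (Suc q) = rounds L q + 7 * radius q + L + 4"

context symmetric_graph begin

text \<open>Every move adds one centre and lowers the radius by one stage. As long as a move is
  left, \<open>card A + q \<le> L\<close> gives \<open>card A < L\<close>, so a transferable
  scattered family can outnumber the centres, which is what \<open>far_answer\<close> exploits. The
  two directions of transfer serve moves on the two sides.\<close>

theorem local_eq_imp_EF:
  assumes "P \<subseteq> (- W) \<times> (- W')"
    and "A \<subseteq> W \<times> W'" "finite A" "card A + q \<le> L"
    and "local_eq (radius q) (rounds L q) W W' P A"
    and "\<And>j. j < q \<Longrightarrow> scattered_transfer W W' P L (radius j) (rounds L j)"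
    and "\<And>j. j < q \<Longrightarrow> scattered_transfer W' W (P\<inverse>) L (radius j) (rounds L j)"
  shows "EF q W W' (P \<union> A)"
  using assms
proof (induction q arbitrary: A)
  case 0
  then show ?case using EF_piso unfolding local_eq_def by auto
next
  case (Suc q)
  have IH: "EF q W W' (insert (x, y) (P \<union> A))"
    if "x \<in> W" "y \<in> W'" "local_eq (radius q) (rounds L q) W W' P (insert (x, y) A)" for x y
  proof -
    have "card (insert (x, y) A) \<le> Suc (card A)" using card_insert_le_m1[of "Suc (card A)" A] by simp
    then have "EF q W W' (P \<union> insert (x, y) A)" using Suc.prems that by (intro Suc.IH) auto
    then show ?thesis by simp
  qed
  have "card A < L" using Suc.prems by simp
  show ?case
  proof (rule EF_SucI)
    show "piso (P \<union> A)" using Suc.prems EF_piso unfolding local_eq_def by blast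
  next
    fix x assume x: "x \<in> W"
    have "\<exists>y\<in>W'. local_eq (radius q) (rounds L q) W W' P (insert (x, y) A)"
      using Suc.prems \<open>card A < L\<close> x by (intro local_eq_step[where L = L]) auto
    then show "\<exists>y\<in>W'. EF q W W' (insert (x, y) (P \<union> A))" using IH x by blast
  next
    fix y assume y: "y \<in> W'"
    have *: "local_eq (radius (Suc q)) (rounds L (Suc q)) W' W (P\<inverse>) (A\<inverse>)"
      using Suc.prems local_eq_converse by blast
    have "\<exists>x\<in>W. local_eq (radius q) (rounds L q) W' W (P\<inverse>) (insert (y, x) (A\<inverse>))"
      using Suc.prems \<open>card A < L\<close> y * by (intro local_eq_step[where L = L]) auto
    then obtain x where x: "x \<in> W" "local_eq (radius q) (rounds L q) W' W (P\<inverse>) (insert (y, x) (A\<inverse>))" by blast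
    from local_eq_converse[OF x(2)]
    have "local_eq (radius q) (rounds L q) W W' P ((insert (y, x) (A\<inverse>))\<inverse>)" by simp
    moreover have "(insert (y, x) (A\<inverse>))\<inverse> = insert (x, y) A" by auto
    ultimately show "\<exists>x\<in>W. EF q W W' (insert (x, y) (P \<union> A))" using IH x y by auto
  qed
qed

end


section \<open>Ranks of vertices\<close>

context symmetric_graph begin

text \<open>
  \<open>rich m r i W v\<close> approximates that \<open>v\<close> is the root of a subdivided \<open>m\<close>-ary tree of depth \<open>i + 1\<close>
  in \<open>W\<close>: instead of many disjoint paths to vertices of smaller rank there are paths avoiding any given
  set of \<open>m\<close> vertices.
\<close>
primrec rich :: "nat \<Rightarrow> nat \<Rightarrow> nat \<Rightarrow> 'u set \<Rightarrow> 'u \<Rightarrow> bool" where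
  "rich m r 0 W v \<longleftrightarrow> v \<in> W"
| "rich m r (Suc i) W v \<longleftrightarrow> v \<in> W \<and>
     (\<forall>S. finite S \<and> card S \<le> m \<and> v \<notin> S \<longrightarrow>
        (\<exists>u. u \<noteq> v \<and> near (W - S) r v u \<and> rich m r i W u))"

lemma rich_dom: "rich m r i W v \<Longrightarrow> v \<in> W"
  by (cases i) auto

lemma rich_mono: "rich m r i W v \<Longrightarrow> W \<subseteq> W' \<Longrightarrow> rich m r i W' v"
proof (induction i arbitrary: v)
  case 0
  then show ?case by auto
next
  case (Suc i)
  have "near (W' - S) r v u" if "near (W - S) r v u" for S u
    using near_mono[OF that, of "W' - S" r] Suc.prems(2) by blast
  with Suc show ?case by simp (meson subsetD)
qed

lemma near_image:
  assumes "near F n x y" and "\<And>x y. x \<in> F \<Longrightarrow> y \<in> F \<Longrightarrow> E x y \<Longrightarrow> E (f x) (f y)"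
  shows "near (f ` F) n (f x) (f y)"
  using assms(1)
proof (induction n arbitrary: x)
  case 0
  then show ?case by auto
next
  case (Suc n)
  then have x: "x \<in> F" using near_dom by blast
  from Suc.prems consider "x = y" | z where "E x z" "near F n z y" by (auto simp: near.simps(2))
  then show ?case
  proof cases
    case 1
    then show ?thesis using x near_refl by auto
  next
    case 2
    then have "E (f x) (f z)" "near (f ` F) n (f z) (f y)" using Suc.IH assms(2) x near_dom by blast+
    then show ?thesis using x by (auto simp: near.simps(2))
  qed
qed

text \<open>Walks are mapped to walks, so preserving edges in one direction is enough. A blocking
  set of the image is pulled back; injectivity keeps the preimage as small and keeps
  \<open>u\<close> distinct from \<open>v\<close>.\<close>

lemma rich_image:
  assumes "rich m r i F v" "inj_on f F"
    and "\<And>x y. x \<in> F \<Longrightarrow> y \<in> F \<Longrightarrow> E x y \<Longrightarrow> E (f x) (f y)"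
  shows "rich m r i (f ` F) (f v)"
  using assms(1)
proof (induction i arbitrary: v)
  case 0
  then show ?case by simp
next
  case (Suc i)
  show ?case unfolding rich.simps
  proof (intro conjI allI impI)
    show "f v \<in> f ` F" using Suc.prems by simp
    fix S assume S: "finite S \<and> card S \<le> m \<and> f v \<notin> S"
    let ?S = "{x \<in> F. f x \<in> S}"
    have inj: "inj_on f ?S" using assms(2) by (rule inj_on_subset) auto
    have sub: "f ` ?S \<subseteq> S" by auto
    have "finite ?S" "card ?S \<le> m"
      using finite_imageD[OF finite_subset[OF sub] inj] card_inj_on_le[OF inj sub] S by auto
    then obtain u where u: "u \<noteq> v" "near (F - ?S) r v u" "rich m r i F u"
      using Suc.prems S unfolding rich.simps by blast
    have "near (f ` (F - ?S)) r (f v) (f u)" using near_image[OF u(2)] assms(3) by blast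
    then have "near (f ` F - S) r (f v) (f u)" by (rule near_mono) auto
    moreover have "f u \<noteq> f v"
      using u assms(2) Suc.prems rich_dom by (metis inj_on_eq_iff)
    ultimately show "\<exists>u. u \<noteq> f v \<and> near (f ` F - S) r (f v) u \<and> rich m r i (f ` F) u"
      using Suc.IH[OF u(3)] by blast
  qed
qed

end

text \<open>\<open>Suc r + wit m r i\<close> pays for one walk and one certificate of the next lower
  level. The search in \<open>rich_witness\<close> has depth \<open>m\<close> and branches over the
  at most \<open>r\<close> vertices of a walk other than \<open>v\<close>.\<close>

primrec wit :: "nat \<Rightarrow> nat \<Rightarrow> nat \<Rightarrow> nat" where
  "wit m r 0 = 1"
| "wit m r (Suc i) = (Suc r + wit m r i) * (r + 2) ^ m"

context symmetric_graph begin

text \<open>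
  Branching: a set that misses all paths found so far must contain a vertex of the path chosen first,
  and that vertex can be forbidden in the recursive search.
\<close>
lemma rich_witness:
  "rich m r i W v \<Longrightarrow> \<exists>F\<subseteq>W. finite F \<and> card F \<le> wit m r i \<and> rich m r i F v"
proof (induction i arbitrary: v)
  case 0
  then show ?case by (intro exI[of _ "{v}"]) auto
next
  case (Suc i)
  let ?c = "Suc r + wit m r i"
  \<comment> \<open>\<open>S\<close> holds the vertices already forbidden on the current branch,
    \<open>T\<close> stands for the rest of the blocking set, and \<open>k\<close> bounds how many
    more may be forbidden.\<close>
  have "\<exists>F\<subseteq>W. finite F \<and> v \<in> F \<and> card F \<le> ?c * (r + 2) ^ k \<and>
      (\<forall>T. finite T \<and> card T \<le> k \<and> v \<notin> T \<longrightarrow>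
        (\<exists>u. u \<noteq> v \<and> near (F - S - T) r v u \<and> rich m r i F u))"
    if "finite S" "card S + k \<le> m" "v \<notin> S" for k S
    using that
  proof (induction k arbitrary: S)
    case (0 S)
    then obtain u where u: "u \<noteq> v" "near (W - S) r v u" "rich m r i W u"
      using Suc.prems by auto
    from near_witness[OF u(2)] obtain Q where Q: "Q \<subseteq> W - S" "finite Q" "card Q \<le> Suc r" "near Q r v u"
      by blast
    from Suc.IH[OF u(3)] obtain F where F: "F \<subseteq> W" "finite F" "card F \<le> wit m r i" "rich m r i F u"
      by blast
    have "near (Q \<union> F - S - T) r v u" if "T = {}" for T
      by (rule near_mono[OF Q(4)]) (use Q(1) that in auto)
    moreover have "rich m r i (Q \<union> F) u" by (rule rich_mono[OF F(4)]) auto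
    moreover have "card (Q \<union> F) \<le> ?c" using card_Un_le[of Q F] Q F by linarith
    ultimately show ?case
      using Q F u(1) near_dom[OF Q(4)] by (intro exI[of _ "Q \<union> F"]) auto
  next
    case (Suc k S)
    from Suc.prems obtain u where u: "u \<noteq> v" "near (W - S) r v u" "rich m r i W u"
      using \<open>rich m r (Suc i) W v\<close> by auto
    from near_witness[OF u(2)] obtain Q where Q: "Q \<subseteq> W - S" "finite Q" "card Q \<le> Suc r" "near Q r v u"
      by blast
    from \<open>\<And>v. rich m r i W v \<Longrightarrow> _\<close>[OF u(3)] obtain F where
      F: "F \<subseteq> W" "finite F" "card F \<le> wit m r i" "rich m r i F u"
      by blast
    have "\<exists>F\<subseteq>W. finite F \<and> v \<in> F \<and> card F \<le> ?c * (r + 2) ^ k \<and>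
      (\<forall>T. finite T \<and> card T \<le> k \<and> v \<notin> T \<longrightarrow>
        (\<exists>u. u \<noteq> v \<and> near (F - insert p S - T) r v u \<and> rich m r i F u))" if "p \<noteq> v" for p
      using Suc.prems that by (intro Suc.IH) (auto simp: card_insert_if)
    then obtain G where G: "\<And>p. p \<noteq> v \<Longrightarrow> G p \<subseteq> W" "\<And>p. p \<noteq> v \<Longrightarrow> finite (G p)"
      "\<And>p. p \<noteq> v \<Longrightarrow> card (G p) \<le> ?c * (r + 2) ^ k"
      "\<And>p T. p \<noteq> v \<Longrightarrow> finite T \<Longrightarrow> card T \<le> k \<Longrightarrow> v \<notin> T \<Longrightarrow>
        \<exists>u. u \<noteq> v \<and> near (G p - insert p S - T) r v u \<and> rich m r i (G p) u"
      by metis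
    let ?F = "Q \<union> F \<union> (\<Union>p\<in>Q - {v}. G p)"
    have v: "v \<in> Q" using near_dom[OF Q(4)] by blast
    have "card (\<Union>p\<in>Q - {v}. G p) \<le> (\<Sum>p\<in>Q - {v}. card (G p))"
      using Q(2) by (intro card_UN_le) auto
    also have "\<dots> \<le> (\<Sum>p\<in>Q - {v}. ?c * (r + 2) ^ k)" using G(3) by (intro sum_mono) auto
    also have "\<dots> \<le> r * (?c * (r + 2) ^ k)"
      using Q v by simp
    finally have 1: "card (\<Union>p\<in>Q - {v}. G p) \<le> r * (?c * (r + 2) ^ k)" .
    have 2: "?c \<le> ?c * (r + 2) ^ k" using mult_le_mono2[of 1 "(r + 2) ^ k" ?c] by simp
    have "card ?F \<le> card Q + card F + card (\<Union>p\<in>Q - {v}. G p)"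
      using card_Un_le[of "Q \<union> F" "\<Union>p\<in>Q - {v}. G p"] card_Un_le[of Q F] by linarith
    also have "\<dots> \<le> ?c * (r + 2) ^ k + r * (?c * (r + 2) ^ k)" using 1 2 Q F by linarith
    also have "\<dots> \<le> ?c * (r + 2) ^ Suc k" by (simp add: algebra_simps)
    finally have card: "card ?F \<le> ?c * (r + 2) ^ Suc k" .
    have "\<exists>u. u \<noteq> v \<and> near (?F - S - T) r v u \<and> rich m r i ?F u"
      if T: "finite T" "card T \<le> Suc k" "v \<notin> T" for T
    proof (cases "T \<inter> Q = {}")
      case True
      then have "near (?F - S - T) r v u" by (intro near_mono[OF Q(4)]) (use Q in auto)
      moreover have "rich m r i ?F u" by (rule rich_mono[OF F(4)]) auto
      ultimately show ?thesis using u by blast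
    next
      case False
      \<comment> \<open>\<open>T\<close> hits the first walk in \<open>p\<close>. This vertex moves
        from \<open>T\<close> to the forbidden set, and \<open>G p\<close> copes with what is left
        of \<open>T\<close>.\<close>
      then obtain p where p: "p \<in> T" "p \<in> Q" "p \<noteq> v" using T by blast
      have "card (T - {p}) \<le> k" using T p by simp
      then obtain u' where u': "u' \<noteq> v" "near (G p - insert p S - (T - {p})) r v u'" "rich m r i (G p) u'"
        using G(4)[of p "T - {p}"] T p(3) by blast
      have "near (?F - S - T) r v u'" by (rule near_mono[OF u'(2)]) (use p in auto)
      moreover have "rich m r i ?F u'" by (rule rich_mono[OF u'(3)]) (use p in auto)
      ultimately show ?thesis using u' by blast
    qed
    moreover have "?F \<subseteq> W" "finite ?F" using Q F G by auto
    ultimately show ?case using card v by (intro exI[of _ ?F]) auto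
  qed
  from this[of "{}" m] obtain F where F: "F \<subseteq> W" "finite F" "v \<in> F" "card F \<le> ?c * (r + 2) ^ m"
    "\<And>T. finite T \<Longrightarrow> card T \<le> m \<Longrightarrow> v \<notin> T \<Longrightarrow>
        \<exists>u. u \<noteq> v \<and> near (F - T) r v u \<and> rich m r i F u"
    by auto
  then show ?case by (intro exI[of _ F]) auto
qed

text \<open>As \<open>v\<close> is not rich of level \<open>Suc i\<close>, a cut of at most
  \<open>m\<close> vertices separates it, for walks of length up to \<open>r\<close>, from every
  other vertex of level \<open>i\<close>. A walk to such a vertex meets the cut and has fewer than
  its original number of steps left, so the count is at most
  \<open>1 + m * Suc m ^ j\<close>.\<close>

lemma card_rich_near:
  assumes no: "\<And>v. \<not> rich m r (Suc i) W v" and "v \<in> W" "j \<le> r"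
  shows "finite {u. near W j v u \<and> rich m r i W u} \<and> card {u. near W j v u \<and> rich m r i W u} \<le> Suc m ^ j"
  using assms(2,3)
proof (induction j arbitrary: v)
  case 0
  have "{u. near W 0 v u \<and> rich m r i W u} \<subseteq> {v}" by auto
  from card_mono[OF _ this] finite_subset[OF this] show ?case by simp
next
  case (Suc j)
  let ?R = "\<lambda>j v. {u. near W j v u \<and> rich m r i W u}"
  from no[of v] Suc.prems(1) obtain S where S: "finite S" "card S \<le> m" "v \<notin> S"
    "\<And>u. u \<noteq> v \<Longrightarrow> near (W - S) r v u \<Longrightarrow> \<not> rich m r i W u" by auto
  have "?R (Suc j) v \<subseteq> insert v (\<Union>s\<in>S \<inter> W. ?R j s)"
  proof
    fix u assume u: "u \<in> ?R (Suc j) v"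
    then have "near (W - S) (Suc j) v u \<or> (\<exists>s\<in>S. \<exists>k<Suc j. near W k s u)"
      using near_avoid_or_hit S(3) by blast
    then show "u \<in> insert v (\<Union>s\<in>S \<inter> W. ?R j s)"
    proof
      assume "near (W - S) (Suc j) v u"
      then have "near (W - S) r v u" using Suc.prems near_mono by blast
      then show ?thesis using S(4) u by blast
    next
      assume "\<exists>s\<in>S. \<exists>k<Suc j. near W k s u"
      then obtain s k where s: "s \<in> S" "k \<le> j" "near W k s u" using less_Suc_eq_le by blast
      then have "near W j s u" "s \<in> W" using near_mono near_dom by blast+
      then show ?thesis using s u by blast
    qed
  qed
  moreover have fin: "finite (insert v (\<Union>s\<in>S \<inter> W. ?R j s))" using Suc S by auto
  ultimately have "finite (?R (Suc j) v)" "card (?R (Suc j) v) \<le> card (insert v (\<Union>s\<in>S \<inter> W. ?R j s))"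
    using finite_subset card_mono by blast+
  moreover have "card (insert v (\<Union>s\<in>S \<inter> W. ?R j s)) \<le> Suc (card (\<Union>s\<in>S \<inter> W. ?R j s))"
    by (rule card_insert_le_m1) auto
  moreover have "card (\<Union>s\<in>S \<inter> W. ?R j s) \<le> m * Suc m ^ j"
  proof -
    have "card (\<Union>s\<in>S \<inter> W. ?R j s) \<le> (\<Sum>s\<in>S \<inter> W. card (?R j s))"
      using S by (intro card_UN_le) auto
    also have "\<dots> \<le> (\<Sum>s\<in>S \<inter> W. Suc m ^ j)" using Suc by (intro sum_mono) auto
    also have "\<dots> \<le> m * Suc m ^ j" using S card_mono[of S "S \<inter> W"] by simp
    finally show ?thesis .
  qed
  moreover have "Suc (m * Suc m ^ j) \<le> Suc m ^ Suc j" by simp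
  ultimately show ?case by linarith
qed

text \<open>Instead of \<open>X\<close> alone, whole walks from \<open>A\<close> to its members are
  picked, at most \<open>Suc \<rho>\<close> vertices for each. Their images are walks from the
  partners, which puts the answers into the ball. Answers avoid \<open>Range F\<close> because the
  pairs of \<open>F\<close> belong to the position.\<close>

lemma restricted_answer:
  assumes BG: "BG (Suc k) s W W' Z" and A: "A \<subseteq> Z" "A \<subseteq> W \<times> W'" and F: "F \<subseteq> Z"
    and X: "X \<subseteq> ball W (Domain A) \<rho> - Domain F" "finite X" "card X * Suc \<rho> \<le> s"
  shows "\<exists>f. f ` X \<subseteq> ball W' (Range A) \<rho> - Range F \<and> BG k s W W' (Z \<union> (\<lambda>x. (x, f x)) ` X)"
proof -
  have "\<exists>a b Q. (a, b) \<in> A \<and> Q \<subseteq> W \<and> finite Q \<and> card Q \<le> Suc \<rho> \<and> near Q \<rho> a x" if "x \<in> X" for x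
    using X(1) that near_witness unfolding ball_def by blast
  then obtain a b Q where Q: "\<And>x. x \<in> X \<Longrightarrow> (a x, b x) \<in> A" "\<And>x. x \<in> X \<Longrightarrow> Q x \<subseteq> W"
    "\<And>x. x \<in> X \<Longrightarrow> finite (Q x)" "\<And>x. x \<in> X \<Longrightarrow> card (Q x) \<le> Suc \<rho>"
    "\<And>x. x \<in> X \<Longrightarrow> near (Q x) \<rho> (a x) x" by metis
  let ?Y = "\<Union>x\<in>X. Q x"
  have "card ?Y \<le> (\<Sum>x\<in>X. card (Q x))" using X(2) by (rule card_UN_le)
  also have "\<dots> \<le> (\<Sum>x\<in>X. Suc \<rho>)" using Q(4) by (intro sum_mono) auto
  also have "\<dots> \<le> s" using X(3) by simp
  finally have "card ?Y \<le> s" .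
  moreover have "?Y \<subseteq> W" "finite ?Y" using Q X(2) by auto
  ultimately obtain f where f: "f ` ?Y \<subseteq> W'" "BG k s W W' (Z \<union> (\<lambda>x. (x, f x)) ` ?Y)" (is "BG _ _ _ _ ?Z")
    using BG_move[OF BG, of ?Y] by metis
  note iso = pisoD[OF BG_piso[OF f(2)]]
  have XY: "x \<in> Q x" "a x \<in> Q x" if "x \<in> X" for x using near_dom[OF Q(5)[OF that]] by auto
  have "f x \<in> ball W' (Range A) \<rho> - Range F" if x: "x \<in> X" for x
  proof -
    have "near (f ` Q x) \<rho> (f (a x)) (f x)"
    proof (rule near_image[OF Q(5)[OF x]])
      fix y z assume "y \<in> Q x" "z \<in> Q x" "E y z"
      then show "E (f y) (f z)" using iso(2)[of y "f y" z "f z"] x by blast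
    qed
    then have "near W' \<rho> (f (a x)) (f x)" by (rule near_mono) (use f(1) x in auto)
    moreover have "f (a x) = b x" using iso(1)[of "a x" "f (a x)" "a x" "b x"] XY[OF x] Q(1)[OF x] A(1) x by blast
    ultimately have "f x \<in> ball W' (Range A) \<rho>" using Q(1)[OF x] unfolding ball_def by auto
    moreover have "f x \<notin> Range F"
    proof
      assume "f x \<in> Range F"
      then obtain y where "(y, f x) \<in> F" by blast
      moreover have "(x, f x) \<in> ?Z" using XY x by blast
      ultimately have "x \<in> Domain F" using iso(1)[of x "f x" y "f x"] F by blast
      then show False using X(1) x by blast
    qed
    ultimately show ?thesis by blast
  qed
  moreover have "BG k s W W' (Z \<union> (\<lambda>x. (x, f x)) ` X)"
    by (rule BG_subset[OF f(2)]) (use XY in blast)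
  ultimately show ?thesis by blast
qed

lemma BG_restrict:
  assumes "BG k s W W' Z" "A \<subseteq> Z" "A \<subseteq> W \<times> W'" "F \<subseteq> Z" "s' * Suc \<rho> \<le> s"
  shows "BG k s' (ball W (Domain A) \<rho> - Domain F) (ball W' (Range A) \<rho> - Range F) Z"
  using assms(1,2,4)
proof (induction k arbitrary: Z)
  case 0
  then show ?case by simp
next
  case (Suc k)
  have le: "card X * Suc \<rho> \<le> s" if "card X \<le> s'" for X :: "'u set"
    using mult_le_mono1[OF that] assms(5) le_trans by blast
  show ?case
  proof (rule BG_SucI)
    fix X assume "X \<subseteq> ball W (Domain A) \<rho> - Domain F" "finite X" "card X \<le> s'"
    with restricted_answer[OF Suc.prems(1,2) assms(3) Suc.prems(3)] le obtain f where
      "f ` X \<subseteq> ball W' (Range A) \<rho> - Range F" "BG k s W W' (Z \<union> (\<lambda>x. (x, f x)) ` X)" by metis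
    then show "\<exists>f. f ` X \<subseteq> ball W' (Range A) \<rho> - Range F
        \<and> BG k s' (ball W (Domain A) \<rho> - Domain F) (ball W' (Range A) \<rho> - Range F)
            (Z \<union> (\<lambda>x. (x, f x)) ` X)"
      using Suc.IH[of "Z \<union> (\<lambda>x. (x, f x)) ` X"] Suc.prems by blast
  next
    fix Y assume Y: "Y \<subseteq> ball W' (Range A) \<rho> - Range F" "finite Y" "card Y \<le> s'"
    have "\<exists>g. g ` Y \<subseteq> ball W (Range (A\<inverse>)) \<rho> - Range (F\<inverse>) \<and> BG k s W' W (Z\<inverse> \<union> (\<lambda>y. (y, g y)) ` Y)"
      using Suc.prems assms(3) Y le by (intro restricted_answer[OF BG_converse[OF Suc.prems(1)]]) auto
    then obtain g where g: "g ` Y \<subseteq> ball W (Domain A) \<rho> - Domain F" "BG k s W' W (Z\<inverse> \<union> (\<lambda>y. (y, g y)) ` Y)"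
      by auto
    have e: "(Z\<inverse> \<union> (\<lambda>y. (y, g y)) ` Y)\<inverse> = Z \<union> (\<lambda>y. (g y, y)) ` Y" by auto
    from BG_converse[OF g(2)] have "BG k s W W' (Z \<union> (\<lambda>y. (g y, y)) ` Y)" unfolding e .
    then show "\<exists>g. g ` Y \<subseteq> ball W (Domain A) \<rho> - Domain F
        \<and> BG k s' (ball W (Domain A) \<rho> - Domain F) (ball W' (Range A) \<rho> - Range F)
            (Z \<union> (\<lambda>y. (g y, y)) ` Y)"
      using g(1) Suc.IH[of "Z \<union> (\<lambda>y. (g y, y)) ` Y"] Suc.prems by blast
  qed
qed

end


section \<open>Collapse of rounds\<close>

context symmetric_graph begin

text \<open>The arenas are arbitrary because the induction applies this to balls from which vertices
  were removed. \<open>l\<close> counts the pairs inside the arenas only; removed vertices join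
  \<open>P\<close>, whose size is free.\<close>

definition collapses :: "nat \<Rightarrow> nat \<Rightarrow> nat \<Rightarrow> nat \<Rightarrow> nat \<Rightarrow> nat \<Rightarrow> nat \<Rightarrow> bool" where
  "collapses m r i l k s q \<longleftrightarrow>
     (\<forall>W W' P A. (\<forall>v. \<not> rich m r i W v) \<and> (\<forall>v. \<not> rich m r i W' v)
        \<and> P \<subseteq> (- W) \<times> (- W') \<and> A \<subseteq> W \<times> W' \<and> finite A \<and> card A \<le> l
        \<and> BG k s W W' (P \<union> A) \<longrightarrow> EF q W W' (P \<union> A))"

text \<open>One batch picks a walk to \<open>w'\<close> together with a certificate of its richness.
  The answer keeps edges and is injective, so it contains a rich vertex near \<open>a\<close> that
  can be paired with \<open>w'\<close>.\<close>

lemma rich_answer: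
  assumes BG: "BG (Suc k) s W W' Z" and s: "wit m r i + Suc \<rho> \<le> s"
    and b: "(a, b) \<in> Z" "near W' \<rho> b w'" and w': "rich m r i W' w'"
  shows "\<exists>w. near W \<rho> a w \<and> rich m r i W w \<and> piso (insert (w, w') Z)"
proof -
  from near_witness[OF b(2)] obtain Q where Q: "Q \<subseteq> W'" "finite Q" "card Q \<le> Suc \<rho>" "near Q \<rho> b w'"
    by blast
  from rich_witness[OF w'] obtain F where F: "F \<subseteq> W'" "finite F" "card F \<le> wit m r i" "rich m r i F w'"
    by blast
  let ?Y = "Q \<union> F"
  have "card ?Y \<le> s" using card_Un_le[of Q F] Q F s by linarith
  then obtain g where g: "g ` ?Y \<subseteq> W" "BG k s W W' (Z \<union> (\<lambda>y. (g y, y)) ` ?Y)" (is "BG _ _ _ _ ?Z")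
    using BG_move'[OF BG, of ?Y] Q F by auto
  note iso = pisoD[OF BG_piso[OF g(2)]]
  have mem: "(g y, y) \<in> ?Z" if "y \<in> ?Y" for y using that by blast
  have hom: "E (g x) (g y)" if "x \<in> ?Y" "y \<in> ?Y" "E x y" for x y
    using iso(2)[OF mem[OF that(1)] mem[OF that(2)]] that(3) by simp
  have "near (g ` Q) \<rho> (g b) (g w')" using near_image[OF Q(4), of g] hom by blast
  moreover have "g b = a" using iso(1)[OF mem[of b] , of a b] near_dom[OF Q(4)] b(1) by blast
  ultimately have "near W \<rho> a (g w')" using near_mono[of "g ` Q" \<rho> a "g w'" W \<rho>] g(1) by auto
  moreover have "inj_on g F" using iso(1) mem by (intro inj_onI) blast
  then have "rich m r i (g ` F) (g w')" using rich_image[OF F(4), of g] hom by blast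
  then have "rich m r i W (g w')" by (rule rich_mono) (use g(1) in auto)
  moreover have "piso (insert (g w', w') Z)"
    by (rule piso_subset[OF BG_piso[OF g(2)]]) (use near_dom[OF Q(4)] in blast)
  ultimately show ?thesis by blast
qed

text \<open>
  The first round names the vertices of highest rank near \<open>A\<close>, the second one is only needed to see that the answer
  names all of them on the other side; removing them lowers the rank of both balls.
\<close>
lemma collapses_imp_local_eq:
  assumes IH: "collapses m r i l k s' n"
    and no: "\<And>v. \<not> rich m r (Suc i) W v"
    and P: "P \<subseteq> (- W) \<times> (- W')"
    and A: "A \<subseteq> W \<times> W'" "finite A" "card A \<le> l"
    and BG: "BG (Suc (Suc k)) s W W' (P \<union> A)"
    and \<rho>: "\<rho> \<le> r"
    and s: "l * Suc m ^ r * Suc r \<le> s" "wit m r i + Suc r \<le> s" "s' * Suc r \<le> s"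
  shows "local_eq \<rho> n W W' P A"
proof -
  let ?B = "ball W (Domain A) \<rho>" and ?B' = "ball W' (Range A) \<rho>"
  define X where "X = {u \<in> ?B. rich m r i W u}"
  have "X \<subseteq> (\<Union>a\<in>Domain A. {u. near W \<rho> a u \<and> rich m r i W u})" (is "_ \<subseteq> ?U")
    unfolding X_def ball_def by blast
  moreover have cr: "finite {u. near W \<rho> a u \<and> rich m r i W u}"
    "card {u. near W \<rho> a u \<and> rich m r i W u} \<le> Suc m ^ r" if "a \<in> Domain A" for a
    using card_rich_near[OF no, of a \<rho>] that A(1) \<rho> power_increasing[OF \<rho>, of "Suc m"] by auto
  then have fU: "finite ?U" using A(2) by (auto simp: finite_Domain)
  ultimately have X: "finite X" "card X \<le> card ?U" using finite_subset card_mono by blast+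
  have "card (Domain A) \<le> card A" using card_image_le[OF A(2), of fst] by (simp add: Domain_fst)
  have "card ?U \<le> (\<Sum>a\<in>Domain A. card {u. near W \<rho> a u \<and> rich m r i W u})"
    using A(2) by (intro card_UN_le) (simp add: finite_Domain)
  also have "\<dots> \<le> (\<Sum>a\<in>Domain A. Suc m ^ r)" using cr by (intro sum_mono) blast
  also have "\<dots> \<le> l * Suc m ^ r"
    using \<open>card (Domain A) \<le> card A\<close> A(3) le_trans[of _ "card A" l] by simp
  finally have "card X * Suc \<rho> \<le> (l * Suc m ^ r) * Suc r"
    using X(2) \<rho> by (intro mult_le_mono) auto
  with s(1) have cX: "card X * Suc \<rho> \<le> s" by linarith
  have AZ: "A \<subseteq> P \<union> A" by blast
  have "\<exists>f. f ` X \<subseteq> ?B' - Range ({} :: ('u \<times> 'u) set) \<and> BG (Suc k) s W W' (P \<union> A \<union> (\<lambda>x. (x, f x)) ` X)"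
    by (rule restricted_answer[OF BG AZ A(1) empty_subsetI _ X(1) cX]) (auto simp: X_def)
  then obtain f where f: "f ` X \<subseteq> ?B'" "BG (Suc k) s W W' (P \<union> A \<union> (\<lambda>x. (x, f x)) ` X)" by auto
  define F where "F = (\<lambda>x. (x, f x)) ` X"
  define Z where "Z = P \<union> A \<union> F"
  have BGZ: "BG (Suc k) s W W' Z" using f(2) unfolding Z_def F_def .
  note iso = pisoD[OF BG_piso[OF BGZ]]
  have F: "Domain F = X" "Range F = f ` X" unfolding F_def by auto
  \<comment> \<open>Picking a rich \<open>w\<close> near \<open>Range A\<close> with its certificate
    forces an answer that is rich and near \<open>Domain A\<close>, hence in \<open>X\<close>. But
    the partner of that answer is already fixed by \<open>F\<close>, so it is
    \<open>w\<close>.\<close>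
  have X': "w \<in> f ` X" if w: "w \<in> ?B'" "rich m r i W' w" for w
  proof -
    obtain a b where ab: "(a, b) \<in> A" "near W' \<rho> b w" using w(1) unfolding ball_def by blast
    have "\<exists>v. near W \<rho> a v \<and> rich m r i W v \<and> piso (insert (v, w) Z)"
      using rich_answer[OF BGZ _ _ ab(2) w(2)] ab(1) s(2) \<rho> unfolding Z_def by auto
    then obtain v where v: "near W \<rho> a v" "rich m r i W v" "piso (insert (v, w) Z)" by blast
    then have "v \<in> X" using ab unfolding X_def ball_def by blast
    then have "(v, f v) \<in> insert (v, w) Z" unfolding Z_def F_def by blast
    then have "w = f v" using pisoD(1)[OF v(3), of v w v "f v"] by blast
    then show ?thesis using \<open>v \<in> X\<close> by blast
  qed
  let ?V = "?B - Domain F" and ?V' = "?B' - Range F"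
  have "s' * Suc \<rho> \<le> s" using \<rho> s(3) le_trans[OF mult_le_mono2[of "Suc \<rho>" "Suc r" s']] by simp
  then have BGV: "BG k s' ?V ?V' Z"
    using A(1) unfolding Z_def
    by (intro BG_restrict[OF BG_Suc[OF BGZ[unfolded Z_def]]]) auto
  have noV: "\<not> rich m r i ?V v" for v
  proof
    assume *: "rich m r i ?V v"
    then have "v \<in> ?V" by (rule rich_dom)
    moreover have "rich m r i W v" by (rule rich_mono[OF *]) (use ball_subset in blast)
    ultimately show False unfolding F X_def by blast
  qed
  have noV': "\<not> rich m r i ?V' v" for v
  proof
    assume *: "rich m r i ?V' v"
    then have "v \<in> ?V'" by (rule rich_dom)
    moreover have "rich m r i W' v" by (rule rich_mono[OF *]) (use ball_subset in blast)
    ultimately show False using X' unfolding F by blast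
  qed
  have side: "a \<in> Domain F \<longleftrightarrow> b \<in> Range F" if "(a, b) \<in> A" for a b
  proof -
    have "(a, b) \<in> Z" using that unfolding Z_def by blast
    then show ?thesis using iso(1)[of a b] unfolding Z_def by blast
  qed
  \<comment> \<open>Centres that were themselves removed have left the arenas and count as
    parameters from here on; by \<open>side\<close> this affects both members of a pair or
    neither.\<close>
  let ?A = "{(a, b) \<in> A. a \<notin> Domain F}"
  let ?P = "P \<union> F \<union> (A - ?A)"
  have ZP: "?P \<union> ?A = Z" unfolding Z_def by blast
  have AV: "Domain A \<subseteq> ?B" "Range A \<subseteq> ?B'"
    using center_subset[of "Domain A" W] center_subset[of "Range A" W'] A(1) by blast+
  have PV: "?P \<subseteq> (- ?V) \<times> (- ?V')"
  proof
    fix p assume p: "p \<in> ?P"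
    obtain a b where ab: "p = (a, b)" by (cases p)
    consider "(a, b) \<in> P" | "(a, b) \<in> F" | "(a, b) \<in> A" "a \<in> Domain F" using p ab by blast
    then show "p \<in> (- ?V) \<times> (- ?V')"
    proof cases
      case 1
      then have "a \<notin> W" "b \<notin> W'" using P by auto
      then show ?thesis using ball_subset ab by blast
    next
      case 2
      then show ?thesis using ab by blast
    next
      case 3
      then show ?thesis using side[of a b] ab by blast
    qed
  qed
  have AV': "?A \<subseteq> ?V \<times> ?V'" using AV side by auto
  have sub: "?A \<subseteq> A" by auto
  have A': "finite ?A" "card ?A \<le> l"
    using finite_subset[OF sub A(2)] le_trans[OF card_mono[OF A(2) sub] A(3)] by simp_all
  have "EF n ?V ?V' (?P \<union> ?A)"
    using IH[unfolded collapses_def, rule_format, of ?V ?V' ?P ?A] noV noV' PV AV' A' BGV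
    unfolding ZP by simp
  \<comment> \<open>The removed vertices belong to pairs of \<open>Z\<close>, so they return to the
    arenas for free.\<close>
  then have "EF n (?V \<union> Domain F) (?V' \<union> Range F) Z"
    unfolding ZP by (rule EF_add_chosen) (auto simp: Z_def)
  moreover have "?V \<union> Domain F = ?B" "?V' \<union> Range F = ?B'" using f(1) unfolding F X_def by auto
  ultimately have "EF n ?B ?B' Z" by simp
  then show ?thesis unfolding local_eq_def by (rule EF_subset) (auto simp: Z_def)
qed

end

text \<open>Free of \<open>m\<close>, as the choice of \<open>r\<close> demands.
  \<open>Suc (l + q)\<close> is the bound \<open>L\<close> of the locality argument; it is positive
  because the members of a scattered family are single centres. The recursive call asks for the
  rounds that local types need.\<close>

primrec needed_radius :: "nat \<Rightarrow> nat \<Rightarrow> nat \<Rightarrow> nat" where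
  "needed_radius 0 q l = 0"
| "needed_radius (Suc i) q l =
     radius q + needed_radius i (rounds (Suc (l + q)) q) (Suc (l + q))"

text \<open>The summands pay for naming the rich vertices near the centres with walks to them, for a
  walk with a certificate of richness, and for the batches of the smaller arena, each of whose
  vertices is picked with a walk.\<close>

primrec needed_batch :: "nat \<Rightarrow> nat \<Rightarrow> nat \<Rightarrow> nat \<Rightarrow> nat \<Rightarrow> nat" where
  "needed_batch m r 0 q l = 0"
| "needed_batch m r (Suc i) q l =
     Suc (l + q) * Suc m ^ r * Suc r + (wit m r i + Suc r) +
     needed_batch m r i (rounds (Suc (l + q)) q) (Suc (l + q)) * Suc r"

lemma rounds_mono: "j \<le> q \<Longrightarrow> rounds L j \<le> rounds L q"
  by (rule lift_Suc_mono_le[of "rounds L"]) auto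

lemma radius_less: "j < q \<Longrightarrow> 7 * radius j + 3 \<le> radius q"
  using lift_Suc_mono_le[of radius "Suc j" q] by simp

context symmetric_graph begin

lemma BG_mono_batch: "BG k s W W' Z \<Longrightarrow> s' \<le> s \<Longrightarrow> BG k s' W W' Z"
proof (induction k arbitrary: Z)
  case 0
  then show ?case by simp
next
  case (Suc k)
  show ?case
  proof (rule BG_SucI)
    fix X assume X: "X \<subseteq> W" "finite X" "card X \<le> s'"
    then show "\<exists>f. f ` X \<subseteq> W' \<and> BG k s' W W' (Z \<union> (\<lambda>x. (x, f x)) ` X)"
      using BG_move[OF Suc.prems(1), of X] Suc by (meson le_trans)
  next
    fix Y assume Y: "Y \<subseteq> W'" "finite Y" "card Y \<le> s'"
    then show "\<exists>g. g ` Y \<subseteq> W \<and> BG k s' W W' (Z \<union> (\<lambda>y. (g y, y)) ` Y)"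
      using BG_move'[OF Suc.prems(1), of Y] Suc by (meson le_trans)
  qed
qed

text \<open>One round picks the family. The answer is scattered since a short walk between two
  answers could be picked in the next round and would give a short walk in \<open>W\<close>. The
  rounds left yield the local type of each member separately.\<close>

lemma scattered_transferI:
  assumes coll: "collapses m r i L k s' N"
    and no: "\<And>v. \<not> rich m r (Suc i) W v"
    and P: "P \<subseteq> (- W) \<times> (- W')"
    and BG: "BG (Suc (Suc (Suc k))) s W W' (P \<union> A)"
    and \<rho>: "7 * \<rho> + 3 \<le> r" and n: "n \<le> N" and L: "1 \<le> L" "L \<le> s"
    and s: "L * Suc m ^ r * Suc r \<le> s" "wit m r i + Suc r \<le> s" "s' * Suc r \<le> s"
  shows "scattered_transfer W W' P L \<rho> n"
  unfolding scattered_transfer_def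
proof (intro allI impI)
  fix X assume X: "X \<subseteq> W" "finite X \<and> card X \<le> L \<and> scattered W (4 * \<rho> + 2) X"
  then obtain f where f: "f ` X \<subseteq> W'" "BG (Suc (Suc k)) s W W' (P \<union> A \<union> (\<lambda>x. (x, f x)) ` X)"
    (is "BG _ _ _ _ ?Z")
    using BG_move[OF BG, of X] L by (meson le_trans)
  note iso = pisoD[OF BG_piso[OF f(2)]]
  have mem: "(x, f x) \<in> ?Z" if "x \<in> X" for x using that by blast
  have "inj_on f X" using iso(1) mem by (intro inj_onI) blast
  moreover have "scattered W' (4 * \<rho> + 2) (f ` X)"
    unfolding scattered_def
  proof (intro ballI impI notI)
    fix u v assume uv: "u \<in> f ` X" "v \<in> f ` X" "u \<noteq> v" "near W' (4 * \<rho> + 2) u v"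
    then obtain x y where xy: "x \<in> X" "y \<in> X" "u = f x" "v = f y" by blast
    \<comment> \<open>Level 0 of \<open>rich_answer\<close> transports a mere walk, because level 0
      only means membership in the arena.\<close>
    have "wit m r 0 + Suc (4 * \<rho> + 2) \<le> s" using \<rho> s(2) by simp
    from rich_answer[OF f(2) this mem[OF xy(1)], of v] uv(4) xy(3,4) near_dom[OF uv(4)]
    obtain w where w: "near W (4 * \<rho> + 2) x w" "piso (insert (w, v) ?Z)" by auto
    have "w = y" using pisoD(1)[OF w(2), of w v y v] mem[OF xy(2)] xy(4) by auto
    moreover have "\<not> near W (4 * \<rho> + 2) x y" using X(2) xy uv(3) unfolding scattered_def by metis
    ultimately show False using w(1) by simp
  qed
  moreover have "local_eq \<rho> n W W' P {(x, f x)}" if x: "x \<in> X" for x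
  proof -
    have "BG (Suc (Suc k)) s W W' (P \<union> {(x, f x)})" by (rule BG_subset[OF f(2)]) (use x in blast)
    then have "local_eq \<rho> N W W' P {(x, f x)}"
      using x X(1) f(1) \<rho> L(1) s by (intro collapses_imp_local_eq[OF coll no P]) auto
    then show ?thesis using EF_le n unfolding local_eq_def by blast
  qed
  ultimately show "\<exists>f. f ` X \<subseteq> W' \<and> inj_on f X \<and> scattered W' (4 * \<rho> + 2) (f ` X)
      \<and> (\<forall>x\<in>X. local_eq \<rho> n W W' P {(x, f x)})"
    using f(1) by blast
qed

text \<open>At level 0 the arenas are empty, so there is nothing to play and no base cost. Each
  further level turns the goal of \<open>q\<close> rounds into that of \<open>rounds L q\<close>
  rounds one level below; hence \<open>q\<close> and \<open>l\<close> vary in the induction while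
  \<open>m\<close> and \<open>r\<close> stay fixed.\<close>

theorem collapses_needed:
  assumes "needed_radius i q l \<le> r"
  shows "collapses m r i l (3 * i) (needed_batch m r i q l) q"
  using assms
proof (induction i arbitrary: q l)
  case 0
  have "EF n {} {} Z" if "piso Z" for n Z
    using that by (induction n) (auto simp: EF.simps(2))
  moreover have "V = {}" if "\<forall>v. \<not> rich m r 0 V v" for V using that by auto
  ultimately show ?case unfolding collapses_def by (metis BG.simps(1) mult_0_right)
next
  case (Suc i)
  let ?L = "Suc (l + q)"
  let ?N = "rounds ?L q" and ?s = "needed_batch m r (Suc i) q l"
  let ?s' = "needed_batch m r i ?N ?L"
  have IH: "collapses m r i ?L (3 * i) ?s' ?N" using Suc by simp
  have le3: "x \<le> x + y + z" "y \<le> x + y + z" "z \<le> x + y + z" for x y z :: nat by simp_all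
  have s: "?L * Suc m ^ r * Suc r \<le> ?s" "wit m r i + Suc r \<le> ?s" "?s' * Suc r \<le> ?s"
    unfolding needed_batch.simps by (rule le3)+
  have "1 \<le> Suc m ^ r * Suc r"
    by (metis One_nat_def Suc_leI nat_0_less_mult_iff zero_less_Suc zero_less_power)
  then have "?L \<le> ?L * Suc m ^ r * Suc r" by (metis mult.assoc mult.right_neutral mult_le_mono2)
  with s(1) have L: "?L \<le> ?s" by (rule le_trans[rotated])
  have \<rho>: "radius q \<le> r" using Suc.prems by simp
  show ?case unfolding collapses_def
  proof (intro allI impI, elim conjE)
    fix W W' P A
    assume no: "\<forall>v. \<not> rich m r (Suc i) W v" "\<forall>v. \<not> rich m r (Suc i) W' v"
      and P: "P \<subseteq> (- W) \<times> (- W')" and A: "A \<subseteq> W \<times> W'" "finite A" "card A \<le> l"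
      and BG: "BG (3 * Suc i) ?s W W' (P \<union> A)"
    have BG3: "BG (Suc (Suc (Suc (3 * i)))) ?s W W' (P \<union> A)" using BG by (simp only: mult_Suc_right numeral_3_eq_3 add_Suc add_0)
    have "(P \<union> A)\<inverse> = P\<inverse> \<union> A\<inverse>" by blast
    then have BG3': "BG (Suc (Suc (Suc (3 * i)))) ?s W' W (P\<inverse> \<union> A\<inverse>)" using BG_converse[OF BG3] by simp
    show "EF q W W' (P \<union> A)"
    proof (rule local_eq_imp_EF[where L = ?L])
      show "local_eq (radius q) (rounds ?L q) W W' P A"
        using no P A BG_Suc[OF BG3] \<rho> s by (intro collapses_imp_local_eq[OF IH]) auto
    next
      fix j assume "j < q"
      then have j: "7 * radius j + 3 \<le> r" "rounds ?L j \<le> rounds ?L q"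
        using radius_less[of j q] rounds_mono[of j q] \<rho> by (auto simp del: radius.simps rounds.simps)
      show "scattered_transfer W W' P ?L (radius j) (rounds ?L j)"
        by (rule scattered_transferI[OF IH _ P BG3 j _ L s]) (use no in auto)
      show "scattered_transfer W' W (P\<inverse>) ?L (radius j) (rounds ?L j)"
        by (rule scattered_transferI[OF IH _ _ BG3' j _ L s]) (use no P in auto)
    qed (use P A in auto)
  qed
qed

end


section \<open>Embedding trees\<close>

lemma vwalk_arcs_subset_iff_successively:
  "set (vwalk_arcs p) \<subseteq> R \<longleftrightarrow> successively (\<lambda>x y. (x, y) \<in> R) p"
  by (induction p rule: vwalk_arcs.induct) auto

lemma vpath_iff:
  "vpath p (with_proj T) \<longleftrightarrow>
     p \<noteq> [] \<and> distinct p \<and> set p \<subseteq> pverts T \<and> successively (\<lambda>x y. (x, y) \<in> parcs T) p"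
  unfolding vpath_def vwalk_def by (auto simp: vwalk_arcs_subset_iff_successively)

lemma pair_graph_arcsD:
  assumes "pair_graph T" "(u, v) \<in> parcs T"
  shows "(v, u) \<in> parcs T \<and> u \<in> pverts T \<and> v \<in> pverts T \<and> u \<noteq> v"
proof -
  interpret pair_graph T by (rule assms(1))
  show ?thesis using assms(2) arcs_symmetric in_arcsD1 in_arcsD2 pair_no_loops by fastforce
qed

lemma pair_graph_symD: "pair_graph T \<Longrightarrow> (u, v) \<in> parcs T \<Longrightarrow> (v, u) \<in> parcs T"
  using pair_graph_arcsD by fast

lemma pair_graph_vertsD:
  "pair_graph T \<Longrightarrow> (u, v) \<in> parcs T \<Longrightarrow> u \<in> pverts T \<and> v \<in> pverts T \<and> u \<noteq> v"
  using pair_graph_arcsD by fast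

lemma pair_graph_finite: "pair_graph T \<Longrightarrow> finite (pverts T)"
  by (simp add: pair_fin_digraph.pair_finite_verts pair_graph_def pair_digraph_def)

text \<open>\<open>depth_from\<close> looks at root-to-leaf paths only. Among the paths with the
  same start that are at least as long as \<open>p\<close>, a longest one ends in a leaf, since
  otherwise it could be extended.\<close>

lemma length_vpath_le_depth:
  assumes "pair_graph T" "vpath p (with_proj T)"
  shows "length p \<le> depth_from T (hd p)"
proof -
  let ?Q = "{q. vpath q (with_proj T)}"
  have "?Q \<subseteq> {q. set q \<subseteq> pverts T \<and> distinct q}" unfolding vpath_iff by auto
  then have fin: "finite ?Q"
    using finite_subset finite_subset_distinct[OF pair_graph_finite[OF assms(1)]] by blast
  let ?S = "{q. vpath q (with_proj T) \<and> hd q = hd p \<and> length p \<le> length q}"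
  have "finite ?S" by (rule finite_subset[OF _ fin]) auto
  then have fS: "finite (length ` ?S)" by (rule finite_imageI)
  have "p \<in> ?S" using assms by simp
  then have "Max (length ` ?S) \<in> length ` ?S" by (intro Max_in[OF fS]) blast
  then obtain q where q: "q \<in> ?S" "length q = Max (length ` ?S)" by force
  have max: "length q' \<le> length q" if "q' \<in> ?S" for q'
    unfolding q(2) using that by (intro Max_ge[OF fS]) blast
  have "root_leaf_path T (hd p) q"
    unfolding root_leaf_path_def
  proof (intro conjI allI impI)
    fix w assume w: "(last q, w) \<in> parcs T"
    show "w \<in> set q"
    proof (rule ccontr)
      assume "w \<notin> set q"
      then have "q @ [w] \<in> ?S"
        using q w pair_graph_vertsD[OF assms(1) w] unfolding vpath_iff
        by (auto simp: successively_append_iff)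
      from max[OF this] show False by simp
    qed
  qed (use q in auto)
  moreover have "finite {q. root_leaf_path T (hd p) q}"
    by (rule finite_subset[OF _ fin]) (auto simp: root_leaf_path_def)
  ultimately have "length q \<le> depth_from T (hd p)" unfolding depth_from_def by (intro Max_ge) auto
  then show ?thesis using q by simp
qed

lemma connected_exit_arc:
  assumes T: "pair_graph T" "Digraph_Component.connected (with_proj T)"
    and X: "X \<subseteq> pverts T" "X \<noteq> pverts T" "z \<in> X"
  shows "\<exists>p t. (p, t) \<in> parcs T \<and> p \<in> X \<and> t \<notin> X"
proof (rule ccontr)
  assume "\<not> ?thesis"
  then have no: "t \<in> X" if "(p, t) \<in> parcs T" "p \<in> X" for p t using that by blast
  obtain w where w: "w \<in> pverts T" "w \<notin> X" using X by blast
  have "z \<rightarrow>\<^sup>*\<^bsub>with_proj (mk_symmetric (with_proj T))\<^esub> w"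
    using T(2) X w unfolding Digraph_Component.connected_def strongly_connected_def by auto
  then have "(z, w) \<in> (parcs (mk_symmetric (with_proj T)))\<^sup>*"
    using reachable_rtranclI by fastforce
  then have "w \<in> X"
  proof induction
    case (step y x)
    then have "(y, x) \<in> parcs T" using pair_graph_symD[OF T(1)] by (auto simp: parcs_mk_symmetric)
    then show ?case using no step by blast
  qed (use X in simp)
  then show False using w by simp
qed

context symmetric_graph begin

lemma near_imp_path:
  "near D n x y \<Longrightarrow> \<exists>p. p \<noteq> [] \<and> hd p = x \<and> last p = y \<and> distinct p \<and> set p \<subseteq> D
     \<and> length p \<le> Suc n \<and> successively E p"
proof (induction n arbitrary: x)
  case 0
  then show ?case by (intro exI[of _ "[x]"]) auto
next
  case (Suc n)
  show ?case
  proof (cases "x = y")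
    case True
    then show ?thesis using near_dom[OF Suc.prems] by (intro exI[of _ "[x]"]) auto
  next
    case False
    with Suc.prems obtain z where z: "E x z" "near D n z y" "x \<in> D" by (auto simp: near.simps(2))
    from Suc.IH[OF z(2)] obtain p where p: "p \<noteq> []" "hd p = z" "last p = y" "distinct p"
      "set p \<subseteq> D" "length p \<le> Suc n" "successively E p" by blast
    show ?thesis
    proof (cases "x \<in> set p")
      case False
      then show ?thesis using p z by (intro exI[of _ "x # p"]) (auto simp: successively_Cons)
    next
      case True
      then obtain as bs where "p = as @ x # bs" by (meson split_list)
      then show ?thesis using p by (intro exI[of _ "x # bs"]) (auto simp: successively_append_iff)
    qed
  qed
qed

lemma path_imp_near:
  "p \<noteq> [] \<Longrightarrow> successively E p \<Longrightarrow> set p \<subseteq> D \<Longrightarrow> near D (length p) (hd p) (last p)"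
proof (induction p rule: induct_list012)
  case (3 x y p)
  then have "near D (length (y # p)) y (last (y # p))" by simp
  then show ?case using 3 by (auto simp: near.simps(2))
qed (auto simp: near.simps(2))

end

text \<open>Two neighbours of \<open>t\<close> in \<open>X\<close> would be joined inside
  \<open>X\<close>, by a walk through \<open>z\<close> shortened to a path; \<open>t\<close> would
  close it to a cycle.\<close>

lemma tree_unique_neighbour:
  assumes T: "undirected_tree T"
    and X: "\<And>x. x \<in> X \<Longrightarrow> \<exists>p. vpath p (with_proj T) \<and> hd p = z \<and> last p = x \<and> set p \<subseteq> X"
    and xy: "x \<in> X" "y \<in> X" "(x, t) \<in> parcs T" "(y, t) \<in> parcs T" "t \<notin> X"
  shows "x = y"
proof (rule ccontr)
  assume "x \<noteq> y"
  have G: "pair_graph T" using T unfolding undirected_tree_def by simp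
  interpret t: symmetric_graph "\<lambda>x y. (x, y) \<in> parcs T"
    by unfold_locales (rule pair_graph_symD[OF G])
  obtain p q where "vpath p (with_proj T)" "hd p = z" "last p = x" "set p \<subseteq> X"
    "vpath q (with_proj T)" "hd q = z" "last q = y" "set q \<subseteq> X" using X xy by metis
  then have "t.near X (length p) z x" "t.near X (length q) z y"
    using t.path_imp_near[of p X] t.path_imp_near[of q X] unfolding vpath_iff by auto
  from t.near_trans[OF t.near_sym[OF this(1)] this(2)]
  obtain c where c: "c \<noteq> []" "hd c = x" "last c = y" "distinct c" "set c \<subseteq> X"
    "successively (\<lambda>x y. (x, y) \<in> parcs T) c" using t.near_imp_path by blast
  have "set c \<subseteq> pverts T"
  proof -
    have "X \<subseteq> pverts T" using X unfolding vpath_iff by (metis last_in_set subsetD subsetI)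
    then show ?thesis using c by blast
  qed
  moreover have "t \<in> pverts T" using pair_graph_vertsD[OF G xy(3)] by simp
  ultimately have "vpath (c @ [t]) (with_proj T)"
    using c xy unfolding vpath_iff by (auto simp: successively_append_iff)
  moreover have "3 \<le> length (c @ [t])"
    using c \<open>x \<noteq> y\<close> by (cases c; cases "tl c") auto
  moreover have "(last (c @ [t]), hd (c @ [t])) \<in> parcs T"
    using c pair_graph_symD[OF G xy(3)] by simp
  ultimately show False using T unfolding undirected_tree_def has_cycle_def by blast
qed


section \<open>Greedy embedding of a subdivided tree\<close>

context symmetric_graph begin

text \<open>The embedded part grows vertex by vertex and stays connected. All vertices used so far,
  except the image of the parent, form a cut of at most \<open>m\<close> vertices; richness of that
  image supplies a walk avoiding them whose end is rich of one level less.\<close>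

lemma tree_embedding:
  fixes T :: "'b pair_pre_digraph"
  assumes T: "undirected_tree T" and z: "z \<in> pverts T" "depth_from T z = Suc d"
    and m: "card (pverts T) * Suc r \<le> m" and root: "rich m r d W v0"
  shows "\<exists>(\<iota> :: 'b \<Rightarrow> 'u) I. inj_on \<iota> (pverts T) \<and> \<iota> ` pverts T \<subseteq> W
    \<and> (\<forall>(u, v)\<in>parcs T. distinct (I (u, v)) \<and> length (I (u, v)) \<le> r \<and> set (I (u, v)) \<subseteq> W
         \<and> set (I (u, v)) \<inter> \<iota> ` pverts T = {} \<and> I (v, u) = rev (I (u, v))
         \<and> successively E (\<iota> u # I (u, v) @ [\<iota> v]))
    \<and> (\<forall>(u, v)\<in>parcs T. \<forall>(u', v')\<in>parcs T.
         {u, v} \<noteq> {u', v'} \<longrightarrow> set (I (u, v)) \<inter> set (I (u', v')) = {})"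
proof -
  have G: "pair_graph T" and conn: "Digraph_Component.connected (with_proj T)"
    using T unfolding undirected_tree_def by auto
  note arcsD = pair_graph_arcsD[OF G]
  have fin: "finite (pverts T)" using pair_graph_finite[OF G] .
  define arcs where "arcs X = {(u, v) \<in> parcs T. u \<in> X \<and> v \<in> X}" for X
  \<comment> \<open>Each embedded vertex accounts for itself and for at most \<open>r\<close> inner
    vertices of the path to its parent; hence the bound \<open>card X * Suc r\<close> in
    \<open>good\<close>.\<close>
  define used where "used X \<iota> I = \<iota> ` X \<union> (\<Union>e\<in>arcs X. set (I e))" for X and \<iota> :: "'b \<Rightarrow> 'u" and I
  define reaches where "reaches X \<delta> \<longleftrightarrow>
    (\<forall>x\<in>X. \<exists>p. vpath p (with_proj T) \<and> hd p = z \<and> last p = x \<and> set p \<subseteq> X \<and> length p = \<delta> x)"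
    for X and \<delta> :: "'b \<Rightarrow> nat"
  define ok where "ok X \<iota> I \<longleftrightarrow> (\<forall>(u, v)\<in>arcs X. distinct (I (u, v)) \<and> length (I (u, v)) \<le> r \<and> set (I (u, v)) \<subseteq> W
         \<and> set (I (u, v)) \<inter> \<iota> ` X = {} \<and> I (v, u) = rev (I (u, v))
         \<and> successively E (\<iota> u # I (u, v) @ [\<iota> v]))
    \<and> (\<forall>(u, v)\<in>arcs X. \<forall>(u', v')\<in>arcs X. {u, v} \<noteq> {u', v'} \<longrightarrow> set (I (u, v)) \<inter> set (I (u', v')) = {})"
    for X and \<iota> :: "'b \<Rightarrow> 'u" and I
  \<comment> \<open>\<open>\<delta>\<close> counts vertices, so the root has \<delta>-value 1 and
    level \<open>d\<close>, and a vertex at full depth \<open>Suc d\<close> merely has to lie in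
    \<open>W\<close>.\<close>
  define good where "good X \<iota> I \<delta> \<longleftrightarrow> z \<in> X \<and> X \<subseteq> pverts T \<and> inj_on \<iota> X \<and> reaches X \<delta> \<and> ok X \<iota> I
    \<and> (\<forall>x\<in>X. rich m r (Suc d - \<delta> x) W (\<iota> x)) \<and> finite (used X \<iota> I) \<and> card (used X \<iota> I) \<le> card X * Suc r"
    for X \<iota> I \<delta>
  have start: "good {z} (\<lambda>_. v0) (\<lambda>_. []) (\<lambda>_. 1)"
  proof -
    have "arcs {z} = {}" unfolding arcs_def using arcsD by blast
    moreover have "vpath [z] (with_proj T)" using z unfolding vpath_iff by simp
    then have "\<exists>p. vpath p (with_proj T) \<and> hd p = z \<and> last p = z \<and> set p \<subseteq> {z} \<and> length p = 1"
      by (intro exI[of _ "[z]"]) simp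
    ultimately show ?thesis using z root unfolding good_def reaches_def ok_def used_def by simp
  qed
  have step: "\<exists>t \<iota>' I' \<delta>'. t \<notin> X \<and> t \<in> pverts T \<and> good (insert t X) \<iota>' I' \<delta>'"
    if g: "good X \<iota> I \<delta>" and X: "X \<noteq> pverts T" for X \<iota> I \<delta>
  proof -
    have zX: "z \<in> X" "X \<subseteq> pverts T" and inj: "inj_on \<iota> X" and re: "reaches X \<delta>" and ok: "ok X \<iota> I"
      and ri: "\<And>x. x \<in> X \<Longrightarrow> rich m r (Suc d - \<delta> x) W (\<iota> x)"
      and fu: "finite (used X \<iota> I)" "card (used X \<iota> I) \<le> card X * Suc r"
      using g unfolding good_def by auto
    have finX: "finite X" using zX fin finite_subset by blast
    from connected_exit_arc[OF G conn zX(2) X zX(1)]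
    obtain p t where pt: "(p, t) \<in> parcs T" "p \<in> X" "t \<notin> X" by blast
    \<comment> \<open>By acyclicity no further edge leads from \<open>t\<close> back into
      \<open>X\<close>, so a single new path suffices.\<close>
    have unique: "x = p" if "x \<in> X" "(x, t) \<in> parcs T" for x
    proof (rule tree_unique_neighbour[OF T, of X z x p t])
      fix x assume "x \<in> X"
      then show "\<exists>p. vpath p (with_proj T) \<and> hd p = z \<and> last p = x \<and> set p \<subseteq> X"
        using re unfolding reaches_def by blast
    qed (use pt that in auto)
    have tp: "(t, p) \<in> parcs T" "t \<in> pverts T" "t \<noteq> p" using arcsD[OF pt(1)] by auto
    have arcs: "arcs (insert t X) = arcs X \<union> {(p, t), (t, p)}"
      using unique arcsD pt tp unfolding arcs_def by blast
    obtain q where q: "vpath q (with_proj T)" "hd q = z" "last q = p" "set q \<subseteq> X" "length q = \<delta> p"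
      using re pt(2) unfolding reaches_def by blast
    then have q': "vpath (q @ [t]) (with_proj T)" "hd (q @ [t]) = z"
      using pt tp unfolding vpath_iff by (auto simp: successively_append_iff)
    \<comment> \<open>The path to \<open>p\<close> can be continued by \<open>t\<close>, so
      \<open>p\<close> is not at full depth and its level is a successor.\<close>
    from length_vpath_le_depth[OF G q'(1)] have "\<delta> p \<le> d" using q q' z by simp
    then have dp: "Suc d - \<delta> p = Suc (d - \<delta> p)" by simp
    let ?S = "used X \<iota> I - {\<iota> p}"
    have "card X \<le> card (pverts T)" using zX fin card_mono by blast
    then have "card X * Suc r \<le> m" using m le_trans mult_le_mono1 by blast
    moreover have "card ?S \<le> card (used X \<iota> I)" using fu by (simp add: card_Diff1_le)
    ultimately have "finite ?S \<and> card ?S \<le> m \<and> \<iota> p \<notin> ?S" using fu by auto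
    then obtain u where u: "u \<noteq> \<iota> p" "near (W - ?S) r (\<iota> p) u" "rich m r (d - \<delta> p) W u"
      using ri[OF pt(2)] unfolding dp rich.simps by blast
    from near_imp_path[OF u(2)] obtain L where L: "L \<noteq> []" "hd L = \<iota> p" "last L = u" "distinct L"
      "set L \<subseteq> W - ?S" "length L \<le> Suc r" "successively E L" by blast
    then obtain M where M: "L = \<iota> p # M @ [u]"
      using u(1) by (cases L; cases "tl L" rule: rev_cases) auto
    have Mu: "distinct M" "length M \<le> r" "set M \<subseteq> W" "u \<in> W" "u \<notin> set M" "u \<notin> used X \<iota> I"
      "set M \<inter> used X \<iota> I = {}" "successively E (\<iota> p # M @ [u])"
      using L unfolding M by auto
    have "successively E (rev (\<iota> p # M @ [u]))"
      unfolding successively_rev using Mu(8) by (rule successively_mono) (auto intro: E_sym)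
    then have rM: "successively E (u # rev M @ [\<iota> p])" by simp
    let ?\<iota> = "\<iota>(t := u)" and ?I = "I((p, t) := M, (t, p) := rev M)" and ?\<delta> = "\<delta>(t := Suc (\<delta> p))"
    have im: "?\<iota> ` insert t X = insert u (\<iota> ` X)" using pt(3) by auto
    have old: "(p, t) \<notin> arcs X" "(t, p) \<notin> arcs X" using pt unfolding arcs_def by auto
    have Iold: "?I e = I e" if e: "e \<in> arcs X" for e
    proof -
      have "e \<noteq> (p, t)" "e \<noteq> (t, p)" using old e by blast+
      then show ?thesis by simp
    qed
    have \<iota>old: "?\<iota> x = \<iota> x" if x: "x \<in> X" for x
    proof -
      have "x \<noteq> t" using pt(3) x by blast
      then show ?thesis by simp
    qed
    have Inew: "?I (p, t) = M" "?I (t, p) = rev M" using tp by auto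
    have usedI: "\<iota> ` X \<subseteq> used X \<iota> I" "\<And>e. e \<in> arcs X \<Longrightarrow> set (I e) \<subseteq> used X \<iota> I"
      unfolding used_def by auto
    have used: "used (insert t X) ?\<iota> ?I = insert u (used X \<iota> I) \<union> set M"
    proof -
      have "(\<Union>e\<in>arcs (insert t X). set (?I e)) = (\<Union>e\<in>arcs X. set (I e)) \<union> set M"
        unfolding arcs UN_Un using Iold Inew by simp
      then show ?thesis unfolding used_def im by blast
    qed
    have "inj_on ?\<iota> (insert t X)"
      using inj pt(3) Mu(6) usedI by (auto simp: inj_on_def)
    moreover have "reaches (insert t X) ?\<delta>"
      unfolding reaches_def
    proof
      fix x assume "x \<in> insert t X"
      then consider "x = t" | "x \<in> X" "x \<noteq> t" using pt by blast
      then show "\<exists>p. vpath p (with_proj T) \<and> hd p = z \<and> last p = x \<and> set p \<subseteq> insert t X \<and> length p = ?\<delta> x"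
      proof cases
        case 1
        then show ?thesis using q q' by (intro exI[of _ "q @ [t]"]) auto
      next
        case 2
        then obtain p where "vpath p (with_proj T)" "hd p = z" "last p = x" "set p \<subseteq> X" "length p = \<delta> x"
          using re unfolding reaches_def by blast
        then show ?thesis using 2 by (intro exI[of _ p]) auto
      qed
    qed
    moreover have "ok (insert t X) ?\<iota> ?I"
    proof -
      have "distinct (?I (x, y)) \<and> length (?I (x, y)) \<le> r \<and> set (?I (x, y)) \<subseteq> W
         \<and> set (?I (x, y)) \<inter> ?\<iota> ` insert t X = {} \<and> ?I (y, x) = rev (?I (x, y))
         \<and> successively E (?\<iota> x # ?I (x, y) @ [?\<iota> y])" if xy: "(x, y) \<in> arcs (insert t X)" for x y
      proof -
        consider "(x, y) \<in> arcs X" | "x = p" "y = t" | "x = t" "y = p" using xy unfolding arcs by auto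
        then show ?thesis
        proof cases
          case 1
          then have 2: "(y, x) \<in> arcs X" "x \<in> X" "y \<in> X" using arcsD unfolding arcs_def by auto
          have "u \<notin> set (I (x, y))" using usedI(2)[OF 1] Mu(6) by blast
          have "distinct (I (x, y)) \<and> length (I (x, y)) \<le> r \<and> set (I (x, y)) \<subseteq> W
            \<and> set (I (x, y)) \<inter> \<iota> ` X = {} \<and> I (y, x) = rev (I (x, y))
            \<and> successively E (\<iota> x # I (x, y) @ [\<iota> y])"
            using ok 1 unfolding ok_def by blast
          with \<open>u \<notin> set (I (x, y))\<close> show ?thesis
            unfolding im Iold[OF 1] Iold[OF 2(1)] \<iota>old[OF 2(2)] \<iota>old[OF 2(3)] by blast
        next
          case 2
          then show ?thesis unfolding 2 im Inew using Mu usedI(1) tp \<iota>old[OF pt(2)] by auto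
        next
          case 3
          then show ?thesis unfolding 3 im Inew using Mu usedI(1) tp rM \<iota>old[OF pt(2)] by auto
        qed
      qed
      moreover have "set (?I (x, y)) \<inter> set (?I (x', y')) = {}"
        if xy: "(x, y) \<in> arcs (insert t X)" "(x', y') \<in> arcs (insert t X)" "{x, y} \<noteq> {x', y'}" for x y x' y'
      proof -
        have new: "set (?I e) = set M" if "e \<in> {(p, t), (t, p)}" for e using that Inew by auto
        have cross: "set (?I e) \<inter> set (?I e') = {}" if "e \<in> arcs X" "e' \<in> {(p, t), (t, p)}" for e e'
          using usedI(2)[OF that(1)] Mu(7) unfolding new[OF that(2)] Iold[OF that(1)] by blast
        consider "(x, y) \<in> arcs X" "(x', y') \<in> arcs X" | "(x, y) \<in> arcs X" "(x', y') \<in> {(p, t), (t, p)}"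
          | "(x, y) \<in> {(p, t), (t, p)}" "(x', y') \<in> arcs X"
          | "(x, y) \<in> {(p, t), (t, p)}" "(x', y') \<in> {(p, t), (t, p)}"
          using xy(1,2) unfolding arcs by blast
        then show ?thesis
        proof cases
          case 1
          have "\<forall>(u, v)\<in>arcs X. \<forall>(u', v')\<in>arcs X.
              {u, v} \<noteq> {u', v'} \<longrightarrow> set (I (u, v)) \<inter> set (I (u', v')) = {}"
            using ok unfolding ok_def by (rule conjunct2)
          from bspec[OF bspec[OF this 1(1), unfolded prod.case] 1(2), unfolded prod.case]
          show ?thesis unfolding Iold[OF 1(1)] Iold[OF 1(2)] using xy(3) by (rule mp)
        next
          case 2
          then show ?thesis by (rule cross)
        next
          case 3
          show ?thesis using cross[OF 3(2,1)] by (simp only: Int_commute)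
        next
          case 4
          then have "{x, y} = {p, t}" "{x', y'} = {p, t}" by auto
          then show ?thesis using xy(3) by simp
        qed
      qed
      ultimately show ?thesis unfolding ok_def by blast
    qed
    moreover have "rich m r (Suc d - ?\<delta> x) W (?\<iota> x)" if "x \<in> insert t X" for x
      using that u(3) ri pt(3) by auto
    moreover have "finite (used (insert t X) ?\<iota> ?I)" using fu unfolding used by simp
    moreover have "card (used (insert t X) ?\<iota> ?I) \<le> card (insert t X) * Suc r"
    proof -
      have "card (set M) \<le> r" using Mu(2) card_length le_trans by blast
      moreover have "card (insert u (used X \<iota> I)) \<le> Suc (card (used X \<iota> I))"
        by (rule card_insert_le_m1) auto
      ultimately have "card (used (insert t X) ?\<iota> ?I) \<le> Suc (card X * Suc r) + r"
        unfolding used using card_Un_le[of "insert u (used X \<iota> I)" "set M"] fu(2) by linarith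
      then show ?thesis using finX pt(3) by simp
    qed
    ultimately have "good (insert t X) ?\<iota> ?I ?\<delta>" using zX tp unfolding good_def by blast
    then show ?thesis using pt(3) tp(2) by blast
  qed
  have grow: "\<exists>X \<iota> I \<delta>. good X \<iota> I \<delta> \<and> card X = Suc n" if "Suc n \<le> card (pverts T)" for n
    using that
  proof (induction n)
    case 0
    then show ?case using start by (metis One_nat_def card.empty card_insert_disjoint empty_iff finite.emptyI)
  next
    case (Suc n)
    then obtain X \<iota> I \<delta> where X: "good X \<iota> I \<delta>" "card X = Suc n" by auto
    then have "X \<noteq> pverts T" using Suc.prems by auto
    from step[OF X(1) this] obtain t \<iota>' I' \<delta>' where t: "t \<notin> X" "good (insert t X) \<iota>' I' \<delta>'" by blast
    have "finite X" using X(2) card.infinite by force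
    then have "card (insert t X) = Suc (Suc n)" using t(1) X(2) by simp
    then show ?case using t(2) by blast
  qed
  have "card (pverts T) \<noteq> 0" using z(1) fin by auto
  then obtain n where n: "card (pverts T) = Suc n" using not0_implies_Suc by blast
  obtain X \<iota> I \<delta> where X: "good X \<iota> I \<delta>" "card X = card (pverts T)"
    using grow[of n] unfolding n by blast
  then have XV: "X = pverts T" using fin unfolding good_def by (simp add: card_subset_eq)
  have arcs: "arcs (pverts T) = parcs T" unfolding arcs_def using arcsD by auto
  have "inj_on \<iota> (pverts T)" "ok (pverts T) \<iota> I" and ri: "\<forall>x\<in>pverts T. rich m r (Suc d - \<delta> x) W (\<iota> x)"
    using X(1) unfolding XV good_def by auto
  moreover have "\<iota> ` pverts T \<subseteq> W" using ri rich_dom by blast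
  ultimately show ?thesis unfolding ok_def arcs by (intro exI[of _ \<iota>] exI[of _ I]) blast
qed

end


section \<open>Elementary bounds\<close>

lemma le_tower: "b \<le> tower a b"
  by (induction a) (auto intro: le_trans less_imp_le[OF less_exp])

lemma tower_mono: "b \<le> c \<Longrightarrow> tower a b \<le> tower a c"
  by (induction a) auto

lemma tower_tower: "tower a (tower c b) = tower (a + c) b"
  by (induction a) auto

lemma tower_mono_height: "a \<le> c \<Longrightarrow> tower a b \<le> tower c b"
  using le_tower[of "tower a b" "c - a"] by (simp add: tower_tower)

lemma elementary_le: "elementary g \<Longrightarrow> (\<And>n. f n \<le> g n) \<Longrightarrow> elementary f"
  unfolding elementary_def using le_trans by blast

lemma elementary_id: "elementary (\<lambda>n. n)"
  unfolding elementary_def by (intro exI[of _ 0]) simp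

lemma elementary_const: "elementary (\<lambda>_. c)"
proof -
  have "c \<le> tower c 0"
    by (induction c) (auto intro: less_imp_le[OF le_less_trans, OF _ less_exp] Suc_leI le_less_trans[OF _ less_exp])
  then have "c \<le> tower c n" for n using tower_mono[of 0 n c] by simp
  then show ?thesis unfolding elementary_def by blast
qed

lemma elementary_comp:
  assumes "elementary f" "elementary g"
  shows "elementary (\<lambda>n. f (g n))"
proof -
  obtain h h' where "\<And>n. f n \<le> tower h n" "\<And>n. g n \<le> tower h' n"
    using assms unfolding elementary_def by blast
  then have "f (g n) \<le> tower (h + h') n" for n
    unfolding tower_tower[symmetric] using tower_mono le_trans by blast
  then show ?thesis unfolding elementary_def by blast
qed

lemma elementary_max: "elementary f \<Longrightarrow> elementary g \<Longrightarrow> elementary (\<lambda>n. max (f n) (g n))"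
  unfolding elementary_def
proof (elim exE)
  fix h h' assume "\<forall>n. f n \<le> tower h n" "\<forall>n. g n \<le> tower h' n"
  then have "\<forall>n. max (f n) (g n) \<le> tower (max h h') n"
    using tower_mono_height[of h "max h h'"] tower_mono_height[of h' "max h h'"]
    by (auto intro: le_trans)
  then show "\<exists>h. \<forall>n. max (f n) (g n) \<le> tower h n" by blast
qed

lemma elementary_binary:
  assumes "\<And>x y. b x y \<le> tower k (max x y)" "elementary f" "elementary g"
  shows "elementary (\<lambda>n. b (f n) (g n))"
proof (rule elementary_le[of "\<lambda>n. tower k (max (f n) (g n))"])
  have "elementary (tower k)" unfolding elementary_def by blast
  then show "elementary (\<lambda>n. tower k (max (f n) (g n)))"
    using elementary_comp[of "tower k"] elementary_max assms(2,3) by blast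
qed (rule assms(1))

lemma double_le_power: "2 * z \<le> 2 ^ z" for z :: nat
proof (induction z)
  case (Suc z)
  then show ?case using less_exp[of z] by (cases z) auto
qed simp

lemma square_le_tower: "z * z \<le> tower 2 z"
proof -
  have "z * z \<le> 2 ^ z * 2 ^ z" by (intro mult_le_mono less_imp_le[OF less_exp])
  also have "\<dots> = 2 ^ (2 * z)" by (simp add: power_add mult_2)
  also have "\<dots> \<le> 2 ^ (2 ^ z)" by (rule power_increasing[OF double_le_power]) simp
  finally show ?thesis by (simp add: numeral_2_eq_2)
qed

lemma elementary_add: "elementary f \<Longrightarrow> elementary g \<Longrightarrow> elementary (\<lambda>n. f n + g n)"
proof (rule elementary_binary[of "(+)" 1])
  fix x y :: nat
  have "x + y \<le> 2 * max x y" by simp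
  also have "\<dots> \<le> 2 ^ max x y" by (rule double_le_power)
  finally show "x + y \<le> tower 1 (max x y)" by simp
qed

lemma elementary_mult: "elementary f \<Longrightarrow> elementary g \<Longrightarrow> elementary (\<lambda>n. f n * g n)"
proof (rule elementary_binary[of times 2])
  fix x y :: nat
  have "x * y \<le> max x y * max x y" by (intro mult_le_mono) auto
  also have "\<dots> \<le> tower 2 (max x y)" by (rule square_le_tower)
  finally show "x * y \<le> tower 2 (max x y)" .
qed

lemma elementary_power: "elementary f \<Longrightarrow> elementary g \<Longrightarrow> elementary (\<lambda>n. f n ^ g n)"
proof (rule elementary_binary[of "(^)" 3])
  fix x y :: nat
  let ?z = "max x y"
  have "x ^ y \<le> (2 ^ ?z) ^ y"
    by (rule power_mono) (use le_less_trans[OF max.cobounded1 less_exp] in \<open>auto intro: less_imp_le\<close>)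
  also have "\<dots> \<le> (2 ^ ?z) ^ ?z" by (rule power_increasing) auto
  also have "\<dots> = 2 ^ (?z * ?z)" by (simp add: power_mult)
  also have "\<dots> \<le> 2 ^ tower 2 ?z" by (rule power_increasing[OF square_le_tower]) simp
  finally show "x ^ y \<le> tower 3 ?z" by (simp add: numeral_3_eq_3 numeral_2_eq_2)
qed

lemma elementary_Suc: "elementary f \<Longrightarrow> elementary (\<lambda>n. Suc (f n))"
  using elementary_add[OF _ elementary_const[of 1]] by simp

lemmas elementary_intros = elementary_id elementary_const elementary_add elementary_mult
  elementary_power elementary_Suc

section \<open>Growth of the constants of the game argument\<close>

lemma radius_le: "radius q \<le> 7 ^ q"
proof -
  have "2 * radius q + 1 = 7 ^ q" by (induction q) auto
  then show ?thesis by linarith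
qed

lemma rounds_le: "rounds L q \<le> q * (7 * 7 ^ q + L + 4)"
proof (induction q)
  case (Suc q)
  have "rounds L (Suc q) \<le> q * (7 * 7 ^ q + L + 4) + (7 * 7 ^ q + L + 4)"
    using Suc radius_le[of q] by simp
  also have "\<dots> = Suc q * (7 * 7 ^ q + L + 4)" by simp
  also have "\<dots> \<le> Suc q * (7 * 7 ^ Suc q + L + 4)" by (intro mult_le_mono2) simp
  finally show ?case .
qed simp

lemma elementary_radius: "elementary q \<Longrightarrow> elementary (\<lambda>n. radius (q n))"
  by (rule elementary_le[OF _ radius_le]) (intro elementary_intros)

lemma elementary_rounds: "elementary L \<Longrightarrow> elementary q \<Longrightarrow> elementary (\<lambda>n. rounds (L n) (q n))"
  by (rule elementary_le[OF _ rounds_le]) (intro elementary_intros)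

lemma elementary_wit: "elementary m \<Longrightarrow> elementary r \<Longrightarrow> elementary (\<lambda>n. wit (m n) (r n) i)"
proof (induction i)
  case 0
  then show ?case unfolding wit.simps by (intro elementary_intros)
next
  case (Suc i)
  then show ?case unfolding wit.simps by (intro elementary_intros Suc.IH) auto
qed

text \<open>The recursion runs over the constant \<open>i\<close>, so it composes a fixed number of
  elementary functions; the tower height depends on \<open>i\<close> but not on
  \<open>n\<close>.\<close>

lemma elementary_needed_radius:
  "elementary q \<Longrightarrow> elementary l \<Longrightarrow> elementary (\<lambda>n. needed_radius i (q n) (l n))"
proof (induction i arbitrary: q l)
  case 0
  show ?case unfolding needed_radius.simps by (intro elementary_intros)
next
  case (Suc i)
  then have L: "elementary (\<lambda>n. Suc (l n + q n))" by (intro elementary_intros)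
  show ?case unfolding needed_radius.simps
    by (intro elementary_add elementary_radius Suc.IH elementary_rounds L Suc.prems)
qed

lemma elementary_needed_batch:
  assumes "elementary m" "elementary r"
  shows "elementary q \<Longrightarrow> elementary l \<Longrightarrow> elementary (\<lambda>n. needed_batch (m n) (r n) i (q n) (l n))"
proof (induction i arbitrary: q l)
  case 0
  show ?case unfolding needed_batch.simps by (intro elementary_intros)
next
  case (Suc i)
  then have L: "elementary (\<lambda>n. Suc (l n + q n))" by (intro elementary_intros)
  then have "elementary (\<lambda>n. needed_batch (m n) (r n) i (rounds (Suc (l n + q n)) (q n)) (Suc (l n + q n)))"
    by (intro Suc.IH elementary_rounds Suc.prems)
  with L show ?case unfolding needed_batch.simps
    by (intro elementary_intros elementary_wit assms Suc.prems)
qed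


section \<open>Formulas describing games\<close>

text \<open>A closed formula that is true even in the empty graph costs a quantifier. It is kept out
  of nonempty lists, where it could add a quantifier block.\<close>

fun conj_list :: "fo list \<Rightarrow> fo" where
  "conj_list [] = All 0 (Eq 0 0)"
| "conj_list [\<phi>] = \<phi>"
| "conj_list (\<phi> # \<psi> # \<Phi>) = Conj \<phi> (conj_list (\<psi> # \<Phi>))"

fun disj_list :: "fo list \<Rightarrow> fo" where
  "disj_list [] = Ex 0 (Neg (Eq 0 0))"
| "disj_list [\<phi>] = \<phi>"
| "disj_list (\<phi> # \<psi> # \<Phi>) = Disj \<phi> (disj_list (\<psi> # \<Phi>))"

text \<open>The complete types over \<Delta>: every valuation satisfies one of them
  (\<open>ex_signing\<close>), and it decides all formulas of \<Delta>
  (\<open>signing_determines\<close>).\<close>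

definition signings :: "fo list \<Rightarrow> fo list" where
  "signings \<Delta> = map conj_list (product_lists (map (\<lambda>\<delta>. [\<delta>, Neg \<delta>]) \<Delta>))"

text \<open>The sum bounds every entry of \<open>vs\<close>, so the interval above it avoids them
  all.\<close>

definition fresh :: "nat \<Rightarrow> nat list \<Rightarrow> nat list" where
  "fresh s vs = [Suc (sum_list vs)..<Suc (sum_list vs) + s]"

text \<open>
  Hintikka formulas for the batch game with \<open>k\<close> rounds and batches of size \<open>s\<close>.
\<close>
primrec features :: "nat \<Rightarrow> nat \<Rightarrow> nat list \<Rightarrow> fo list" where
  "features 0 s vs = concat (map (\<lambda>x. concat (map (\<lambda>y. [Eq x y, Edge x y]) vs)) vs)"
| "features (Suc k) s vs = map (foldr Ex (fresh s vs)) (signings (features k s (vs @ fresh s vs)))"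

lemma sat_conj_list [simp]: "sat G a (conj_list \<Phi>) \<longleftrightarrow> (\<forall>\<phi>\<in>set \<Phi>. sat G a \<phi>)"
  by (induction \<Phi> rule: conj_list.induct) auto

lemma sat_disj_list [simp]: "sat G a (disj_list \<Phi>) \<longleftrightarrow> (\<exists>\<phi>\<in>set \<Phi>. sat G a \<phi>)"
  by (induction \<Phi> rule: disj_list.induct) auto

lemma fv_conj_list: "fv (conj_list \<Phi>) = (\<Union>\<phi>\<in>set \<Phi>. fv \<phi>)"
  by (induction \<Phi> rule: conj_list.induct) auto

lemma fv_disj_list: "fv (disj_list \<Phi>) = (\<Union>\<phi>\<in>set \<Phi>. fv \<phi>)"
  by (induction \<Phi> rule: disj_list.induct) auto

lemma fv_foldr_Ex: "fv (foldr Ex ys \<phi>) = fv \<phi> - set ys"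
  by (induction ys) auto

lemma signings_iff:
  "\<theta> \<in> set (signings \<Delta>) \<longleftrightarrow>
     (\<exists>xs. \<theta> = conj_list xs \<and> list_all2 (\<lambda>x \<delta>. x = \<delta> \<or> x = Neg \<delta>) xs \<Delta>)"
  unfolding signings_def by (auto simp: product_lists_set list_all2_map2)

lemma ex_signing: "\<exists>\<theta>\<in>set (signings \<Delta>). sat G a \<theta>"
proof -
  let ?xs = "map (\<lambda>\<delta>. if sat G a \<delta> then \<delta> else Neg \<delta>) \<Delta>"
  have "conj_list ?xs \<in> set (signings \<Delta>)"
    unfolding signings_iff by (intro exI[of _ ?xs]) (simp add: list_all2_map1 list_all2_same)
  moreover have "sat G a (conj_list ?xs)" by auto
  ultimately show ?thesis by blast
qed

lemma signing_determines:
  assumes "\<theta> \<in> set (signings \<Delta>)" "sat G a \<theta>" "sat H b \<theta>" "\<delta> \<in> set \<Delta>"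
  shows "sat G a \<delta> \<longleftrightarrow> sat H b \<delta>"
proof -
  obtain xs where xs: "\<theta> = conj_list xs" "list_all2 (\<lambda>x \<delta>. x = \<delta> \<or> x = Neg \<delta>) xs \<Delta>"
    using assms(1) unfolding signings_iff by blast
  obtain i where i: "i < length \<Delta>" "\<delta> = \<Delta> ! i" using assms(4) by (metis in_set_conv_nth)
  then have "xs ! i = \<delta> \<or> xs ! i = Neg \<delta>" "xs ! i \<in> set xs"
    using xs(2) by (auto simp: list_all2_conv_all_nth)
  then show ?thesis using assms(2,3) unfolding xs(1) by auto
qed

lemma fv_signings: "\<theta> \<in> set (signings \<Delta>) \<Longrightarrow> fv \<theta> \<subseteq> (\<Union>\<delta>\<in>set \<Delta>. fv \<delta>)"
proof -
  assume "\<theta> \<in> set (signings \<Delta>)"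
  then obtain xs where xs: "\<theta> = conj_list xs" "list_all2 (\<lambda>x \<delta>. x = \<delta> \<or> x = Neg \<delta>) xs \<Delta>"
    unfolding signings_iff by blast
  from xs(2) have "\<forall>x\<in>set xs. \<exists>\<delta>\<in>set \<Delta>. fv x = fv \<delta>"
    by (induction rule: list_all2_induct) auto
  then show ?thesis unfolding xs(1) fv_conj_list by blast
qed

lemma fv_features: "\<delta> \<in> set (features k s vs) \<Longrightarrow> fv \<delta> \<subseteq> set vs"
proof (induction k arbitrary: vs \<delta>)
  case 0
  then show ?case by auto
next
  case (Suc k)
  then obtain \<theta> where \<theta>: "\<theta> \<in> set (signings (features k s (vs @ fresh s vs)))" "\<delta> = foldr Ex (fresh s vs) \<theta>"
    by auto
  have "fv \<theta> \<subseteq> set (vs @ fresh s vs)" using fv_signings[OF \<theta>(1)] Suc.IH by blast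
  then show ?case unfolding \<theta>(2) fv_foldr_Ex by auto
qed

lemma sat_foldr_Ex:
  "sat G a (foldr Ex ys \<phi>) \<longleftrightarrow>
     (\<exists>a'. (\<forall>x. x \<notin> set ys \<longrightarrow> a' x = a x) \<and> a' ` set ys \<subseteq> pverts G \<and> sat G a' \<phi>)"
proof (induction ys arbitrary: a)
  case Nil
  have "(\<exists>a'. (\<forall>x. a' x = a x) \<and> sat G a' \<phi>) \<longleftrightarrow> sat G a \<phi>" by (metis ext)
  then show ?case by simp
next
  case (Cons y ys)
  show ?case
  proof
    assume "sat G a (foldr Ex (y # ys) \<phi>)"
    then obtain v where v: "v \<in> pverts G" "sat G (a(y := v)) (foldr Ex ys \<phi>)" by auto
    then obtain a' where a': "\<forall>x. x \<notin> set ys \<longrightarrow> a' x = (a(y := v)) x" "a' ` set ys \<subseteq> pverts G" "sat G a' \<phi>"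
      using Cons.IH by blast
    then have "a' y \<in> pverts G" using v(1) by (cases "y \<in> set ys") auto
    then show "\<exists>a'. (\<forall>x. x \<notin> set (y # ys) \<longrightarrow> a' x = a x) \<and> a' ` set (y # ys) \<subseteq> pverts G \<and> sat G a' \<phi>"
      using a' by (intro exI[of _ a']) auto
  next
    assume "\<exists>a'. (\<forall>x. x \<notin> set (y # ys) \<longrightarrow> a' x = a x) \<and> a' ` set (y # ys) \<subseteq> pverts G \<and> sat G a' \<phi>"
    then obtain a' where a': "\<forall>x. x \<notin> set (y # ys) \<longrightarrow> a' x = a x" "a' ` set (y # ys) \<subseteq> pverts G" "sat G a' \<phi>"
      by blast
    then have "sat G (a(y := a' y)) (foldr Ex ys \<phi>)"
      unfolding Cons.IH by (intro exI[of _ a']) auto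
    then show "sat G a (foldr Ex (y # ys) \<phi>)" using a'(2) by auto
  qed
qed

lemma fresh_disjoint: "set vs \<inter> set (fresh s vs) = {}"
  unfolding fresh_def using member_le_sum_list[of _ vs] by fastforce

lemma length_fresh [simp]: "length (fresh s vs) = s"
  unfolding fresh_def by simp

text \<open>
  The disjoint union of all graphs, so that both sides of a game share one adjacency relation.
\<close>
definition adj :: "'a pair_pre_digraph \<times> 'a \<Rightarrow> 'a pair_pre_digraph \<times> 'a \<Rightarrow> bool" where
  "adj p q \<longleftrightarrow> fst p = fst q \<and> pair_graph (fst p) \<and> (snd p, snd q) \<in> parcs (fst p)"

interpretation all_graphs: symmetric_graph adj
  by unfold_locales (auto simp: adj_def dest: pair_graph_symD)

text \<open>The vertices of \<open>X\<close> become values of the fresh variables. The complete type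
  of the extended valuation, behind its existential block, is a feature; hence it holds on the other
  side and supplies the answer.\<close>

lemma features_answer:
  assumes feat: "\<forall>\<delta>\<in>set (features (Suc k) s vs). sat G a \<delta> \<longleftrightarrow> sat H b \<delta>"
    and ab: "a ` set vs \<subseteq> pverts G" "b ` set vs \<subseteq> pverts H"
    and X: "X \<subseteq> pverts G" "finite X" "card X \<le> s" "pverts G \<noteq> {}"
  shows "\<exists>a' b'. (\<forall>\<delta>\<in>set (features k s (vs @ fresh s vs)). sat G a' \<delta> \<longleftrightarrow> sat H b' \<delta>)
    \<and> (\<forall>v\<in>set vs. a' v = a v \<and> b' v = b v)
    \<and> a' ` set (vs @ fresh s vs) \<subseteq> pverts G \<and> b' ` set (vs @ fresh s vs) \<subseteq> pverts H
    \<and> X \<subseteq> a' ` set (fresh s vs)"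
proof -
  let ?ys = "fresh s vs"
  obtain g where g: "X \<subseteq> g ` set ?ys" "g ` set ?ys \<subseteq> pverts G"
  proof -
    have d: "distinct ?ys" unfolding fresh_def by simp
    then have "card X \<le> card (set ?ys)" using X(3) by (simp add: distinct_card)
    then obtain h where h: "h ` X \<subseteq> set ?ys" "inj_on h X" using card_le_inj[OF X(2)] by blast
    obtain x0 where x0: "x0 \<in> pverts G" using X(4) by blast
    \<comment> \<open>A batch may have fewer than \<open>s\<close> vertices. Surplus variables get
      the value \<open>x0\<close>, so the graph must be nonempty.\<close>
    let ?g = "\<lambda>y. if y \<in> h ` X then inv_into X h y else x0"
    have "X \<subseteq> ?g ` set ?ys"
    proof
      fix x assume "x \<in> X"
      then have "x = ?g (h x)" "h x \<in> set ?ys" using h by auto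
      then show "x \<in> ?g ` set ?ys" by (rule image_eqI)
    qed
    moreover have "?g y \<in> pverts G" for y using x0 X(1) inv_into_into[of y h X] by auto
    then have "?g ` set ?ys \<subseteq> pverts G" by (rule image_subsetI)
    ultimately show ?thesis by (rule that)
  qed
  define a' where "a' = (\<lambda>x. if x \<in> set ?ys then g x else a x)"
  obtain \<theta> where \<theta>: "\<theta> \<in> set (signings (features k s (vs @ ?ys)))" "sat G a' \<theta>"
    using ex_signing by blast
  have "sat G a (foldr Ex ?ys \<theta>)"
    unfolding sat_foldr_Ex using g(2) \<theta>(2) by (intro exI[of _ a']) (auto simp: a'_def)
  moreover have "foldr Ex ?ys \<theta> \<in> set (features (Suc k) s vs)" using \<theta>(1) by simp
  ultimately have "sat H b (foldr Ex ?ys \<theta>)" using feat by blast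
  then obtain b' where b': "\<forall>x. x \<notin> set ?ys \<longrightarrow> b' x = b x" "b' ` set ?ys \<subseteq> pverts H" "sat H b' \<theta>"
    unfolding sat_foldr_Ex by blast
  have old: "\<forall>v\<in>set vs. a' v = a v \<and> b' v = b v"
    using fresh_disjoint[of vs s] b'(1) unfolding a'_def by auto
  have "X \<subseteq> a' ` set ?ys" "a' ` set ?ys \<subseteq> pverts G" using g unfolding a'_def by auto
  moreover have "a' ` set vs = a ` set vs" "b' ` set vs = b ` set vs" using old by (auto intro: image_cong)
  moreover have "\<forall>\<delta>\<in>set (features k s (vs @ ?ys)). sat G a' \<delta> \<longleftrightarrow> sat H b' \<delta>"
    using signing_determines[OF \<theta> b'(3)] by blast
  ultimately show ?thesis using old ab b'(2) by (intro exI[of _ a'] exI[of _ b']) (simp add: image_Un)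
qed

section \<open>From agreement on features to games on two graphs\<close>

abbreviation vertices :: "'a pair_pre_digraph \<Rightarrow> ('a pair_pre_digraph \<times> 'a) set" where
  "vertices G \<equiv> Pair G ` pverts G"

definition position where
  "position G a H b V = (\<lambda>v. ((G, a v), (H, b v))) ` V"

lemma position_converse: "(position G a H b V)\<inverse> = position H b G a V"
  unfolding position_def by auto

text \<open>The induction hypothesis of \<open>features_imp_BG\<close> is an assumption here so that
  batches on either side are handled by one argument with the graphs exchanged.\<close>

lemma features_answer_game:
  assumes IH: "\<And>a b vs. (\<forall>\<delta>\<in>set (features k s vs). sat G a \<delta> \<longleftrightarrow> sat H b \<delta>) \<Longrightarrow>
      a ` set vs \<subseteq> pverts G \<Longrightarrow> b ` set vs \<subseteq> pverts H \<Longrightarrow>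
      all_graphs.BG k s (vertices G) (vertices H) (position G a H b (set vs))"
    and feat: "\<forall>\<delta>\<in>set (features (Suc k) s vs). sat G a \<delta> \<longleftrightarrow> sat H b \<delta>"
    and ab: "a ` set vs \<subseteq> pverts G" "b ` set vs \<subseteq> pverts H"
    and X: "X \<subseteq> vertices G" "finite X" "card X \<le> s" "pverts G \<noteq> {}"
  shows "\<exists>f. f ` X \<subseteq> vertices H \<and>
    all_graphs.BG k s (vertices G) (vertices H) (position G a H b (set vs) \<union> (\<lambda>x. (x, f x)) ` X)"
proof -
  have SX: "snd ` X \<subseteq> pverts G" "finite (snd ` X)" using X by auto
  have cX: "card (snd ` X) \<le> s" using card_image_le[OF X(2), of snd] X(3) by simp
  obtain a' b' where a'b': "\<forall>\<delta>\<in>set (features k s (vs @ fresh s vs)). sat G a' \<delta> \<longleftrightarrow> sat H b' \<delta>"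
    "\<forall>v\<in>set vs. a' v = a v \<and> b' v = b v" "a' ` set (vs @ fresh s vs) \<subseteq> pverts G"
    "b' ` set (vs @ fresh s vs) \<subseteq> pverts H" "snd ` X \<subseteq> a' ` set (fresh s vs)"
    using features_answer[where k = k, OF feat ab SX cX X(4)] by (elim exE conjE)
  have BG: "all_graphs.BG k s (vertices G) (vertices H) (position G a' H b' (set (vs @ fresh s vs)))"
    by (rule IH) (use a'b'(1,3,4) in auto)
  have "\<exists>y. y \<in> set (fresh s vs) \<and> x = (G, a' y)" if "x \<in> X" for x
  proof -
    have "snd x \<in> a' ` set (fresh s vs)" using a'b'(5) that by blast
    moreover have "fst x = G" using X(1) that by auto
    ultimately show ?thesis by (metis imageE prod.collapse)
  qed
  then obtain y where y: "\<And>x. x \<in> X \<Longrightarrow> y x \<in> set (fresh s vs)" "\<And>x. x \<in> X \<Longrightarrow> x = (G, a' (y x))"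
    by metis
  let ?f = "\<lambda>x. (H, b' (y x))"
  have "position G a H b (set vs) = position G a' H b' (set vs)"
    unfolding position_def using a'b'(2) by (intro image_cong) auto
  then have "position G a H b (set vs) \<subseteq> position G a' H b' (set (vs @ fresh s vs))"
    unfolding position_def by auto
  moreover have "(x, ?f x) \<in> position G a' H b' (set (vs @ fresh s vs))" if "x \<in> X" for x
  proof -
    have "(x, ?f x) = ((G, a' (y x)), (H, b' (y x)))" using y(2)[OF that] by simp
    then show ?thesis unfolding position_def using y(1)[OF that] by auto
  qed
  ultimately have "all_graphs.BG k s (vertices G) (vertices H) (position G a H b (set vs) \<union> (\<lambda>x. (x, ?f x)) ` X)"
    by (intro all_graphs.BG_subset[OF BG]) blast
  moreover have "b' (y x) \<in> pverts H" if "x \<in> X" for x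
    using subsetD[OF a'b'(4) imageI, of "y x"] y(1)[OF that] by simp
  then have "?f ` X \<subseteq> vertices H" by blast
  ultimately show ?thesis by blast
qed

theorem features_imp_BG:
  assumes G: "pair_graph G" "pair_graph H" and s: "0 < s"
  shows "(\<forall>\<delta>\<in>set (features k s vs). sat G a \<delta> \<longleftrightarrow> sat H b \<delta>) \<Longrightarrow>
    a ` set vs \<subseteq> pverts G \<Longrightarrow> b ` set vs \<subseteq> pverts H \<Longrightarrow>
    all_graphs.BG k s (vertices G) (vertices H) (position G a H b (set vs))"
  using G
proof (induction k arbitrary: G H a b vs)
  case (0 G H a b vs)
  have "a x = a y \<longleftrightarrow> b x = b y" "(a x, a y) \<in> parcs G \<longleftrightarrow> (b x, b y) \<in> parcs H"
    if "x \<in> set vs" "y \<in> set vs" for x y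
    using bspec[OF 0(1), of "Eq x y"] bspec[OF 0(1), of "Edge x y"] that by auto
  then have "all_graphs.piso (position G a H b (set vs))"
    unfolding all_graphs.piso_def position_def adj_def using 0 by auto
  then show ?case by simp
next
  case (Suc k G H a b vs)
  \<comment> \<open>As \<open>0 < s\<close>, every feature of positive level begins with an
    existential quantifier. An empty graph satisfies none of them, a nonempty one at least
    one.\<close>
  have ne: "pverts H = {}" if "pverts G = {}" "(\<forall>\<delta>\<in>set (features (Suc k) s vs). sat G a \<delta> \<longleftrightarrow> sat H b \<delta>)"
    "b ` set vs \<subseteq> pverts H" for G H :: "'a pair_pre_digraph" and a b
  proof (rule ccontr)
    assume "pverts H \<noteq> {}"
    then obtain w where w: "w \<in> pverts H" by blast
    let ?b = "\<lambda>x. if x \<in> set (fresh s vs) then w else b x"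
    obtain \<theta> where \<theta>: "\<theta> \<in> set (signings (features k s (vs @ fresh s vs)))" "sat H ?b \<theta>"
      using ex_signing by blast
    have "sat H b (foldr Ex (fresh s vs) \<theta>)"
      unfolding sat_foldr_Ex using w \<theta>(2) by (intro exI[of _ ?b]) auto
    then have "sat G a (foldr Ex (fresh s vs) \<theta>)" using that(2) \<theta>(1) by simp
    moreover have "fresh s vs \<noteq> []" using s length_fresh[of s vs] by (metis less_numeral_extra(3) list.size(3))
    ultimately show False using that(1) unfolding sat_foldr_Ex by auto
  qed
  show ?case
  proof (cases "pverts G = {} \<or> pverts H = {}")
    case True
    then have E: "pverts G = {}" "pverts H = {}" "vs = []"
      using ne[of G a H b] ne[of H b G a] Suc.prems(1,2,3) by auto
    have "all_graphs.BG k s {} {} {}" for k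
      by (induction k) (auto simp: all_graphs.piso_def all_graphs.BG.simps(2))
    then show ?thesis unfolding E position_def by simp
  next
    case False
    show ?thesis
    proof (rule all_graphs.BG_SucI)
      fix X assume X: "X \<subseteq> vertices G" "finite X" "card X \<le> s"
      show "\<exists>f. f ` X \<subseteq> vertices H \<and> all_graphs.BG k s (vertices G) (vertices H)
          (position G a H b (set vs) \<union> (\<lambda>x. (x, f x)) ` X)"
        using False Suc.prems X by (intro features_answer_game[OF Suc.IH]) auto
    next
      fix Y assume Y: "Y \<subseteq> vertices H" "finite Y" "card Y \<le> s"
      have "\<exists>g. g ` Y \<subseteq> vertices G \<and> all_graphs.BG k s (vertices H) (vertices G)
          (position H b G a (set vs) \<union> (\<lambda>x. (x, g x)) ` Y)"
        using False Suc.prems Y by (intro features_answer_game[OF Suc.IH]) auto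
      then obtain g where g: "g ` Y \<subseteq> vertices G" "all_graphs.BG k s (vertices H) (vertices G)
          (position H b G a (set vs) \<union> (\<lambda>x. (x, g x)) ` Y)" by blast
      have "(position H b G a (set vs) \<union> (\<lambda>x. (x, g x)) ` Y)\<inverse> = position G a H b (set vs) \<union> (\<lambda>y. (g y, y)) ` Y"
        unfolding converse_Un position_converse by auto
      with all_graphs.BG_converse[OF g(2)] g(1)
      show "\<exists>g. g ` Y \<subseteq> vertices G \<and> all_graphs.BG k s (vertices G) (vertices H)
          (position G a H b (set vs) \<union> (\<lambda>y. (g y, y)) ` Y)" by auto
    qed
  qed
qed

lemma position_upd:
  assumes "position G a H b (V - {x}) \<subseteq> Z"
  shows "position G (a(x := v)) H (b(x := w)) V \<subseteq> insert ((G, v), (H, w)) Z"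
proof
  fix p assume "p \<in> position G (a(x := v)) H (b(x := w)) V"
  then obtain y where y: "y \<in> V" "p = ((G, (a(x := v)) y), (H, (b(x := w)) y))"
    unfolding position_def by blast
  show "p \<in> insert ((G, v), (H, w)) Z"
  proof (cases "y = x")
    case False
    then have "p \<in> position G a H b (V - {x})" using y unfolding position_def by auto
    then show ?thesis using assms by blast
  qed (use y in simp)
qed

text \<open>\<open>Z\<close> may exceed the current values: when a variable is bound again, its old
  pair stays in the position. The size serves as a crude bound on the quantifier rank.\<close>

lemma EF_imp_sat_iff:
  assumes "pair_graph G" "pair_graph H"
  shows "all_graphs.EF n (vertices G) (vertices H) Z \<Longrightarrow> position G a H b (fv \<phi>) \<subseteq> Z \<Longrightarrow>
    fo_size \<phi> \<le> n \<Longrightarrow> sat G a \<phi> \<longleftrightarrow> sat H b \<phi>"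
proof (induction \<phi> arbitrary: n Z a b)
  case (Eq x y)
  then have "((G, a x), (H, b x)) \<in> Z" "((G, a y), (H, b y)) \<in> Z" unfolding position_def by auto
  from all_graphs.pisoD(1)[OF all_graphs.EF_piso[OF Eq(1)] this] show ?case by simp
next
  case (Edge x y)
  then have "((G, a x), (H, b x)) \<in> Z" "((G, a y), (H, b y)) \<in> Z" unfolding position_def by auto
  from all_graphs.pisoD(2)[OF all_graphs.EF_piso[OF Edge(1)] this] show ?case
    using assms by (simp add: adj_def)
next
  case (Neg \<phi>)
  then show ?case by simp
next
  case (Conj \<phi> \<psi>)
  have "position G a H b (fv \<phi>) \<subseteq> Z" "position G a H b (fv \<psi>) \<subseteq> Z" "fo_size \<phi> \<le> n" "fo_size \<psi> \<le> n"
    using Conj.prems unfolding position_def by auto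
  then show ?case using Conj.IH Conj.prems(1) by simp
next
  case (Disj \<phi> \<psi>)
  have "position G a H b (fv \<phi>) \<subseteq> Z" "position G a H b (fv \<psi>) \<subseteq> Z" "fo_size \<phi> \<le> n" "fo_size \<psi> \<le> n"
    using Disj.prems unfolding position_def by auto
  then show ?case using Disj.IH Disj.prems(1) by simp
next
  case (Ex x \<phi>)
  obtain k where k: "n = Suc k" "fo_size \<phi> \<le> k" using Ex.prems(3) by (cases n) auto
  have *: "sat G (a(x := v)) \<phi> \<longleftrightarrow> sat H (b(x := w)) \<phi>"
    if "all_graphs.EF k (vertices G) (vertices H) (insert ((G, v), (H, w)) Z)" for v w
    using Ex.prems(2) by (intro Ex.IH[OF that position_upd k(2)]) simp
  have "\<exists>w\<in>pverts H. sat G (a(x := v)) \<phi> \<longleftrightarrow> sat H (b(x := w)) \<phi>" if "v \<in> pverts G" for v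
    using all_graphs.EF_fwd[OF Ex.prems(1)[unfolded k(1)], of "(G, v)"] * that by auto
  moreover have "\<exists>v\<in>pverts G. sat G (a(x := v)) \<phi> \<longleftrightarrow> sat H (b(x := w)) \<phi>" if "w \<in> pverts H" for w
    using all_graphs.EF_bwd[OF Ex.prems(1)[unfolded k(1)], of "(H, w)"] * that by auto
  ultimately show ?case unfolding sat.simps by metis
next
  case (All x \<phi>)
  obtain k where k: "n = Suc k" "fo_size \<phi> \<le> k" using All.prems(3) by (cases n) auto
  have *: "sat G (a(x := v)) \<phi> \<longleftrightarrow> sat H (b(x := w)) \<phi>"
    if "all_graphs.EF k (vertices G) (vertices H) (insert ((G, v), (H, w)) Z)" for v w
    using All.prems(2) by (intro All.IH[OF that position_upd k(2)]) simp
  have "\<exists>w\<in>pverts H. sat G (a(x := v)) \<phi> \<longleftrightarrow> sat H (b(x := w)) \<phi>" if "v \<in> pverts G" for v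
    using all_graphs.EF_fwd[OF All.prems(1)[unfolded k(1)], of "(G, v)"] * that by auto
  moreover have "\<exists>v\<in>pverts G. sat G (a(x := v)) \<phi> \<longleftrightarrow> sat H (b(x := w)) \<phi>" if "w \<in> pverts H" for w
    using all_graphs.EF_bwd[OF All.prems(1)[unfolded k(1)], of "(H, w)"] * that by auto
  ultimately show ?case unfolding sat.simps by metis
qed


section \<open>Alternation rank and size\<close>

lemma alternations_short [simp]: "alternations [] = 0" "alternations [q] = 0"
  unfolding alternations_def by auto

lemma alternations_Cons [simp]:
  "alternations (q # q' # w) = (if q = q' then 0 else 1) + alternations (q' # w)"
proof -
  let ?S = "{i. Suc i < length (q' # w) \<and> (q' # w) ! i \<noteq> (q' # w) ! Suc i}"
  have "{i. Suc i < length (q # q' # w) \<and> (q # q' # w) ! i \<noteq> (q # q' # w) ! Suc i}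
      = (if q = q' then {} else {0}) \<union> Suc ` ?S" (is "?L = ?R")
  proof (rule set_eqI)
    fix i show "i \<in> ?L \<longleftrightarrow> i \<in> ?R" by (cases i) auto
  qed
  moreover have "finite ?S" by (rule finite_subset[of _ "{..<length (q' # w)}"]) auto
  ultimately show ?thesis unfolding alternations_def
    by (subst card_Un_disjoint[symmetric] | simp add: card_image)+
qed

text \<open>This means at most \<open>k\<close> quantifier blocks per branch: a nonempty word has
  one block more than alternations, the empty word has none. Including the negation makes the notion
  closed under \<open>Neg\<close>, as signings require.\<close>

definition low :: "nat \<Rightarrow> fo \<Rightarrow> bool" where
  "low k \<phi> \<longleftrightarrow> (\<forall>w\<in>branches (nnf \<phi>) \<union> branches (nnf (Neg \<phi>)). w = [] \<or> alternations w < k)"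

lemma low_mono: "low k \<phi> \<Longrightarrow> k \<le> k' \<Longrightarrow> low k' \<phi>"
  unfolding low_def using less_le_trans by blast

lemma low_Neg: "low k \<phi> \<Longrightarrow> low k (Neg \<phi>)"
  unfolding low_def by auto

lemma low_Conj: "low k \<phi> \<Longrightarrow> low k \<psi> \<Longrightarrow> low k (Conj \<phi> \<psi>)"
  unfolding low_def by auto

lemma low_Disj: "low k \<phi> \<Longrightarrow> low k \<psi> \<Longrightarrow> low k (Disj \<phi> \<psi>)"
  unfolding low_def by auto

lemma low_trivial: "0 < k \<Longrightarrow> low k (All 0 (Eq 0 0))" "0 < k \<Longrightarrow> low k (Ex 0 (Neg (Eq 0 0)))"
  unfolding low_def by auto

lemma low_conj_list: "\<Phi> \<noteq> [] \<or> 0 < k \<Longrightarrow> \<forall>\<phi>\<in>set \<Phi>. low k \<phi> \<Longrightarrow> low k (conj_list \<Phi>)"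
  by (induction \<Phi> rule: conj_list.induct) (simp_all add: low_trivial low_Conj)

lemma low_disj_list: "0 < k \<Longrightarrow> \<forall>\<phi>\<in>set \<Phi>. low k \<phi> \<Longrightarrow> low k (disj_list \<Phi>)"
  by (induction \<Phi> rule: disj_list.induct) (simp_all add: low_trivial low_Disj)

lemma alternations_replicate: "alternations (replicate n q @ w) \<le> Suc (alternations w)"
  "alternations (replicate n q) = 0"
proof -
  have "alternations (q # w) \<le> Suc (alternations w)" by (cases w) auto
  then show "alternations (replicate n q @ w) \<le> Suc (alternations w)"
    by (induction n rule: induct_nat_012) simp_all
  show "alternations (replicate n q) = 0"
    by (induction n rule: induct_nat_012) auto
qed

lemma branches_nnf_foldr_Ex:
  "branches (nnf (foldr Ex ys \<phi>)) = (\<lambda>w. replicate (length ys) Exists @ w) ` branches (nnf \<phi>)"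
  "branches (nnf (Neg (foldr Ex ys \<phi>))) = (\<lambda>w. replicate (length ys) Forall @ w) ` branches (nnf (Neg \<phi>))"
  by (induction ys) (auto simp: image_image)

text \<open>A prefix of equal quantifiers adds at most one block however long it is, so the batch
  size does not affect the alternation rank.\<close>

lemma low_foldr_Ex:
  assumes "low k \<phi>"
  shows "low (Suc k) (foldr Ex ys \<phi>)"
proof -
  have *: "alternations (replicate (length ys) q @ w) < Suc k" if "w = [] \<or> alternations w < k" for w q
    using that alternations_replicate(1)[of "length ys" q w] alternations_replicate(2)[of "length ys" q]
    by auto
  show ?thesis
    unfolding low_def branches_nnf_foldr_Ex
  proof (intro ballI disjI2)
    fix v assume "v \<in> (\<lambda>w. replicate (length ys) Exists @ w) ` branches (nnf \<phi>)
      \<union> (\<lambda>w. replicate (length ys) Forall @ w) ` branches (nnf (Neg \<phi>))"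
    then show "alternations v < Suc k" using assms * unfolding low_def by auto
  qed
qed

lemma low_signings:
  assumes "\<theta> \<in> set (signings \<Delta>)" "\<forall>\<delta>\<in>set \<Delta>. low k \<delta>" "\<Delta> \<noteq> [] \<or> 0 < k"
  shows "low k \<theta>"
proof -
  obtain xs where xs: "\<theta> = conj_list xs" "list_all2 (\<lambda>x \<delta>. x = \<delta> \<or> x = Neg \<delta>) xs \<Delta>"
    using assms(1) unfolding signings_iff by blast
  have "\<forall>x\<in>set xs. low k x" using xs(2) assms(2)
    by (induction rule: list_all2_induct) (auto intro: low_Neg)
  moreover have "xs \<noteq> [] \<or> 0 < k" using xs(2) assms(3) by auto
  ultimately show ?thesis unfolding xs(1) by (intro low_conj_list)
qed

text \<open>This keeps the trivial formula of \<open>conj_list\<close> out of the signings in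
  \<open>low_features\<close>; at level 0 it would already cost a block.\<close>

lemma features_ne: "vs \<noteq> [] \<Longrightarrow> features k s vs \<noteq> []"
proof (cases k)
  case 0
  assume "vs \<noteq> []"
  then show ?thesis using 0 by (cases vs) auto
next
  case (Suc k')
  have "signings \<Delta> \<noteq> []" for \<Delta> using ex_signing[of \<Delta>] by fastforce
  then show ?thesis using Suc by simp
qed

lemma low_features:
  assumes "0 < s"
  shows "\<delta> \<in> set (features k s vs) \<Longrightarrow> low k \<delta>"
proof (induction k arbitrary: vs \<delta>)
  case 0
  then show ?case by (auto simp: low_def)
next
  case (Suc k)
  then obtain \<theta> where \<theta>: "\<theta> \<in> set (signings (features k s (vs @ fresh s vs)))" "\<delta> = foldr Ex (fresh s vs) \<theta>"
    by auto
  have "fresh s vs \<noteq> []" using assms length_fresh[of s vs] by fastforce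
  then have "features k s (vs @ fresh s vs) \<noteq> []" by (intro features_ne) simp
  then have "low k \<theta>" using low_signings[OF \<theta>(1)] Suc.IH by blast
  then show ?case unfolding \<theta>(2) by (rule low_foldr_Ex)
qed

lemma finite_branches: "finite (branches \<phi>) \<and> branches \<phi> \<noteq> {}"
  by (induction \<phi>) auto

lemma alternation_rank_le:
  assumes "low k \<phi>"
  shows "alternation_rank \<phi> \<le> k - 1"
proof -
  have "alternations w \<le> k - 1" if "w \<in> branches (nnf \<phi>)" for w
  proof -
    have "w = [] \<or> alternations w < k" using assms that unfolding low_def by (simp del: nnf.simps)
    then show ?thesis by auto
  qed
  then show ?thesis unfolding alternation_rank_def
    using finite_branches[of "nnf \<phi>"] by (intro Max.boundedI) auto
qed

section \<open>Number and size of the features\<close>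

primrec feature_count :: "nat \<Rightarrow> nat \<Rightarrow> nat \<Rightarrow> nat" where
  "feature_count 0 s l = 2 * (l * l)"
| "feature_count (Suc k) s l = 2 ^ feature_count k s (l + s)"

primrec feature_size :: "nat \<Rightarrow> nat \<Rightarrow> nat \<Rightarrow> nat" where
  "feature_size 0 s l = 1"
| "feature_size (Suc k) s l = s + (feature_count k s (l + s) * (feature_size k s (l + s) + 2) + 2)"

lemma size_conj_list: "\<forall>\<phi>\<in>set \<Phi>. fo_size \<phi> \<le> c \<Longrightarrow> fo_size (conj_list \<Phi>) \<le> length \<Phi> * Suc c + 2"
  by (induction \<Phi> rule: conj_list.induct) auto

lemma size_disj_list: "\<forall>\<phi>\<in>set \<Phi>. fo_size \<phi> \<le> c \<Longrightarrow> fo_size (disj_list \<Phi>) \<le> length \<Phi> * Suc c + 3"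
  by (induction \<Phi> rule: disj_list.induct) auto

lemma size_foldr_Ex: "fo_size (foldr Ex ys \<phi>) = length ys + fo_size \<phi>"
  by (induction ys) auto

lemma length_signings: "length (signings \<Delta>) = 2 ^ length \<Delta>"
proof -
  have "length (product_lists (map (\<lambda>\<delta>. [\<delta>, Neg \<delta>]) \<Delta>)) = 2 ^ length \<Delta>"
    by (induction \<Delta>) (auto simp: length_concat)
  then show ?thesis unfolding signings_def by simp
qed

lemma length_features: "length (features k s vs) = feature_count k s (length vs)"
proof (induction k arbitrary: vs)
  case 0
  have "length (concat (map (\<lambda>y. [Eq x y, Edge x y]) ws)) = 2 * length ws" for x ws
    by (induction ws) auto
  then have "length (concat (map (\<lambda>x. concat (map (\<lambda>y. [Eq x y, Edge x y]) ws)) us)) = 2 * (length us * length ws)" for us ws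
    by (induction us) (auto simp: algebra_simps)
  then show ?case by simp
next
  case (Suc k)
  then show ?case by (simp add: length_signings)
qed

lemma size_signings:
  assumes "\<theta> \<in> set (signings \<Delta>)" "\<forall>\<delta>\<in>set \<Delta>. fo_size \<delta> \<le> c"
  shows "fo_size \<theta> \<le> length \<Delta> * (c + 2) + 2"
proof -
  obtain xs where xs: "\<theta> = conj_list xs" "list_all2 (\<lambda>x \<delta>. x = \<delta> \<or> x = Neg \<delta>) xs \<Delta>"
    using assms(1) unfolding signings_iff by blast
  have "\<forall>x\<in>set xs. fo_size x \<le> Suc c" using xs(2) assms(2)
    by (induction rule: list_all2_induct) auto
  from size_conj_list[OF this] show ?thesis
    using list_all2_lengthD[OF xs(2)] unfolding xs(1) by simp
qed

lemma size_features: "\<delta> \<in> set (features k s vs) \<Longrightarrow> fo_size \<delta> \<le> feature_size k s (length vs)"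
proof (induction k arbitrary: vs \<delta>)
  case 0
  then show ?case by auto
next
  case (Suc k)
  then obtain \<theta> where \<theta>: "\<theta> \<in> set (signings (features k s (vs @ fresh s vs)))" "\<delta> = foldr Ex (fresh s vs) \<theta>"
    by auto
  have "\<forall>\<delta>\<in>set (features k s (vs @ fresh s vs)). fo_size \<delta> \<le> feature_size k s (length vs + s)"
    using Suc.IH[of _ "vs @ fresh s vs"] by simp
  from size_signings[OF \<theta>(1) this] show ?case
    unfolding \<theta>(2) size_foldr_Ex length_features by simp
qed

definition formula_bound :: "nat \<Rightarrow> nat \<Rightarrow> nat \<Rightarrow> nat" where
  "formula_bound k s l =
     2 ^ feature_count k s l * Suc (feature_count k s l * (feature_size k s l + 2) + 2) + 3"

text \<open>Each round adds one exponential, and the number \<open>k\<close> of rounds is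
  constant.\<close>

lemma elementary_feature_count:
  "elementary s \<Longrightarrow> elementary l \<Longrightarrow> elementary (\<lambda>n. feature_count k (s n) (l n))"
proof (induction k arbitrary: l)
  case 0
  then show ?case unfolding feature_count.simps by (intro elementary_intros)
next
  case (Suc k)
  show ?case unfolding feature_count.simps by (intro elementary_intros Suc.IH Suc.prems)
qed

lemma elementary_feature_size:
  "elementary s \<Longrightarrow> elementary l \<Longrightarrow> elementary (\<lambda>n. feature_size k (s n) (l n))"
proof (induction k arbitrary: l)
  case 0
  show ?case unfolding feature_size.simps by (intro elementary_intros)
next
  case (Suc k)
  show ?case unfolding feature_size.simps
    by (intro elementary_intros elementary_feature_count Suc.IH Suc.prems)
qed

lemma elementary_formula_bound:
  "elementary s \<Longrightarrow> elementary l \<Longrightarrow> elementary (\<lambda>n. formula_bound k (s n) (l n))"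
  unfolding formula_bound_def
  by (intro elementary_intros elementary_feature_count elementary_feature_size)

lemma feature_bounds_mono:
  assumes "l \<le> l'"
  shows "feature_count k s l \<le> feature_count k s l' \<and> feature_size k s l \<le> feature_size k s l'"
  using assms
proof (induction k arbitrary: l l')
  case 0
  then show ?case by (auto intro: mult_le_mono)
next
  case (Suc k)
  have "l + s \<le> l' + s" using Suc.prems by simp
  from Suc.IH[OF this] show ?case by (auto intro!: mult_le_mono add_le_mono)
qed

lemma formula_bound_mono: "l \<le> l' \<Longrightarrow> formula_bound k s l \<le> formula_bound k s l'"
  unfolding formula_bound_def using feature_bounds_mono[of l l' k s]
  by (intro add_le_mono mult_le_mono power_increasing Suc_le_mono[THEN iffD2]) auto

text \<open>The factor 2 comes from the atoms, which have size 1 and up to two variables.\<close>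

lemma fv_le_size: "finite (fv \<phi>) \<and> card (fv \<phi>) \<le> 2 * fo_size \<phi>"
proof (induction \<phi>)
  case (Conj \<phi> \<psi>)
  then show ?case using card_Un_le[of "fv \<phi>" "fv \<psi>"] by auto
next
  case (Disj \<phi> \<psi>)
  then show ?case using card_Un_le[of "fv \<phi>" "fv \<psi>"] by auto
next
  case (Ex x \<phi>)
  then show ?case using card_Diff1_le[of "fv \<phi>" x] by simp
next
  case (All x \<phi>)
  then show ?case using card_Diff1_le[of "fv \<phi>" x] by simp
qed (auto simp: card_insert_if)

text \<open>The formula is the disjunction of the complete types that occur together with \<phi>
  somewhere in \<open>C\<close>; there are finitely many even if \<open>C\<close> is infinite. A
  graph in \<open>C\<close> satisfying such a type agrees on all features with one where \<phi>
  holds, and the game carries \<phi> over.\<close>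

lemma game_imp_equivalent_formula:
  assumes C: "\<And>G. G \<in> C \<Longrightarrow> pair_graph G" and s: "0 < s"
    and game: "\<And>G H a b. G \<in> C \<Longrightarrow> H \<in> C \<Longrightarrow> a ` fv \<phi> \<subseteq> pverts G \<Longrightarrow> b ` fv \<phi> \<subseteq> pverts H \<Longrightarrow>
      all_graphs.BG k s (vertices G) (vertices H) (position G a H b (fv \<phi>)) \<Longrightarrow>
      all_graphs.EF (fo_size \<phi>) (vertices G) (vertices H) (position G a H b (fv \<phi>))"
    and xs: "fv \<phi> \<subseteq> set xs"
  shows "\<exists>\<psi>. fv \<psi> \<subseteq> set xs \<and> equivalent_on C xs \<phi> \<psi> \<and> alternation_rank \<psi> \<le> k - 1
    \<and> fo_size \<psi> \<le> formula_bound k s (card (fv \<phi>))"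
proof -
  define vs where "vs = sorted_list_of_set (fv \<phi>)"
  have vs: "set vs = fv \<phi>" "length vs = card (fv \<phi>)" using fv_le_size[of \<phi>] unfolding vs_def by auto
  define \<Theta> where "\<Theta> = filter (\<lambda>\<theta>. \<exists>H\<in>C. \<exists>b. b ` fv \<phi> \<subseteq> pverts H \<and> sat H b \<phi> \<and> sat H b \<theta>)
    (signings (features k s vs))"
  let ?\<psi> = "disj_list \<Theta>"
  have "fv \<theta> \<subseteq> fv \<phi>" if "\<theta> \<in> set \<Theta>" for \<theta>
    using that fv_signings[of \<theta> "features k s vs"] fv_features[of _ k s vs] vs(1) unfolding \<Theta>_def by auto
  then have "fv ?\<psi> \<subseteq> set xs" using xs unfolding fv_disj_list by blast
  moreover have "equivalent_on C xs \<phi> ?\<psi>"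
    unfolding equivalent_on_def
  proof (intro ballI allI impI)
    fix G a assume G: "G \<in> C" "a ` set xs \<subseteq> pverts G"
    then have a: "a ` fv \<phi> \<subseteq> pverts G" using xs by blast
    show "sat G a \<phi> \<longleftrightarrow> sat G a ?\<psi>"
    proof
      assume "sat G a \<phi>"
      moreover obtain \<theta> where "\<theta> \<in> set (signings (features k s vs))" "sat G a \<theta>" using ex_signing by blast
      ultimately show "sat G a ?\<psi>" using G(1) a unfolding \<Theta>_def by auto
    next
      assume "sat G a ?\<psi>"
      then obtain \<theta> H b where H: "\<theta> \<in> set (signings (features k s vs))" "sat G a \<theta>" "H \<in> C"
        "b ` fv \<phi> \<subseteq> pverts H" "sat H b \<phi>" "sat H b \<theta>" unfolding \<Theta>_def by auto
      have "all_graphs.BG k s (vertices G) (vertices H) (position G a H b (set vs))"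
        using signing_determines[OF H(1,2,6)] a H(4) vs(1)
        by (intro features_imp_BG[OF C[OF G(1)] C[OF H(3)] s]) auto
      then have "all_graphs.EF (fo_size \<phi>) (vertices G) (vertices H) (position G a H b (fv \<phi>))"
        using game[OF G(1) H(3) a H(4)] vs(1) by simp
      from EF_imp_sat_iff[OF C[OF G(1)] C[OF H(3)] this order_refl order_refl]
      show "sat G a \<phi>" using H(5) by simp
    qed
  qed
  moreover have "alternation_rank ?\<psi> \<le> k - 1"
  proof -
    \<comment> \<open>An empty disjunction is a trivial formula with one block. Allowing for it
      still gives the bound \<open>k - 1\<close>, also for \<open>k = 0\<close>.\<close>
    have "low (max k 1) \<theta>" if "\<theta> \<in> set \<Theta>" for \<theta>
    proof (rule low_signings)
      show "\<theta> \<in> set (signings (features k s vs))" using that unfolding \<Theta>_def by simp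
      show "\<forall>\<delta>\<in>set (features k s vs). low (max k 1) \<delta>"
        by (auto intro: low_mono[OF low_features[OF s]])
    qed auto
    then have "low (max k 1) ?\<psi>" by (intro low_disj_list) auto
    from alternation_rank_le[OF this] show ?thesis by simp
  qed
  moreover have "fo_size ?\<psi> \<le> formula_bound k s (card (fv \<phi>))"
  proof -
    let ?c = "feature_count k s (length vs) * (feature_size k s (length vs) + 2) + 2"
    have "fo_size \<theta> \<le> ?c" if "\<theta> \<in> set \<Theta>" for \<theta>
      using size_signings[of \<theta> "features k s vs" "feature_size k s (length vs)"] size_features that
      unfolding \<Theta>_def length_features by auto
    then have size: "fo_size ?\<psi> \<le> length \<Theta> * Suc ?c + 3" by (intro size_disj_list) auto
    have "length \<Theta> \<le> length (signings (features k s vs))" unfolding \<Theta>_def by (rule length_filter_le)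
    then have "length \<Theta> \<le> 2 ^ feature_count k s (length vs)"
      by (simp only: length_signings length_features)
    from le_trans[OF size add_le_mono1[OF mult_le_mono1[OF this]]]
    show ?thesis unfolding formula_bound_def vs(2) .
  qed
  ultimately show ?thesis by blast
qed

text \<open>\<open>tree_embedding\<close> works in the disjoint union of all graphs but stays inside
  \<open>vertices G\<close>, where \<open>snd\<close> is injective; projecting yields a subdivision
  of \<open>T\<close> in \<open>G\<close>.\<close>

lemma excluded_tree_imp_not_rich:
  assumes G: "pair_graph G" and T: "T \<in> trees_of_depth (Suc d)" "\<not> shallow_topological_minor r T G"
    and m: "card (pverts T) * Suc r \<le> m"
  shows "\<not> all_graphs.rich m r d (vertices G) v"
proof
  assume rich: "all_graphs.rich m r d (vertices G) v"
  obtain z where tree: "undirected_tree T" "z \<in> pverts T" "depth_from T z = Suc d"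
    using T(1) unfolding trees_of_depth_def by blast
  from all_graphs.tree_embedding[OF tree m rich] obtain \<iota> I where
    inj: "inj_on \<iota> (pverts T)" and im: "\<iota> ` pverts T \<subseteq> vertices G" and
    paths: "\<forall>(u, v)\<in>parcs T. distinct (I (u, v)) \<and> length (I (u, v)) \<le> r
         \<and> set (I (u, v)) \<subseteq> vertices G
         \<and> set (I (u, v)) \<inter> \<iota> ` pverts T = {} \<and> I (v, u) = rev (I (u, v))
         \<and> successively adj (\<iota> u # I (u, v) @ [\<iota> v])" and
    disjoint: "\<forall>(u, v)\<in>parcs T. \<forall>(u', v')\<in>parcs T.
         {u, v} \<noteq> {u', v'} \<longrightarrow> set (I (u, v)) \<inter> set (I (u', v')) = {}"
    by (elim exE conjE)
  have path: "distinct (I (u, v)) \<and> length (I (u, v)) \<le> r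
         \<and> set (I (u, v)) \<subseteq> vertices G
         \<and> set (I (u, v)) \<inter> \<iota> ` pverts T = {} \<and> I (v, u) = rev (I (u, v))
         \<and> successively adj (\<iota> u # I (u, v) @ [\<iota> v])" if "(u, v) \<in> parcs T" for u v
    using bspec[OF paths that, unfolded prod.case] .
  have dis: "set (I (u, v)) \<inter> set (I (u', v')) = {}"
    if "(u, v) \<in> parcs T" "(u', v') \<in> parcs T" "{u, v} \<noteq> {u', v'}" for u v u' v'
    using bspec[OF bspec[OF disjoint that(1), unfolded prod.case] that(2), unfolded prod.case] that(3)
    by (rule mp)
  have snd_inj: "inj_on snd (vertices G)" by (rule inj_onI) auto
  define j where "j = snd \<circ> \<iota>"
  define J where "J = (\<lambda>e. map snd (I e))"
  define K where "K = \<lparr>pverts = j ` pverts T \<union> (\<Union>e\<in>parcs T. set (J e)),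
    parcs = (\<Union>(u, v)\<in>parcs T. set (vwalk_arcs (j u # J (u, v) @ [j v])))\<rparr>"
  have pT: "pair_graph T" using tree unfolding undirected_tree_def by simp
  have disj_snd: "snd ` A \<inter> snd ` B = {}" if "A \<subseteq> vertices G" "B \<subseteq> vertices G" "A \<inter> B = {}" for A B
    using that snd_inj by (metis image_empty inj_on_image_Int)
  have "shallow_subdivision r T K"
    unfolding shallow_subdivision_def
  proof (intro exI[of _ j] exI[of _ J] conjI)
    show "inj_on j (pverts T)" unfolding j_def using inj im snd_inj by (intro comp_inj_on) (auto intro: inj_on_subset)
    show "\<forall>(u, v)\<in>parcs T. distinct (J (u, v)) \<and> length (J (u, v)) \<le> r
        \<and> set (J (u, v)) \<inter> j ` pverts T = {} \<and> J (v, u) = rev (J (u, v))"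
    proof (clarify)
      fix u v assume uv: "(u, v) \<in> parcs T"
      have p: "distinct (I (u, v))" "length (I (u, v)) \<le> r" "set (I (u, v)) \<subseteq> vertices G"
        "set (I (u, v)) \<inter> \<iota> ` pverts T = {}" "I (v, u) = rev (I (u, v))" using path[OF uv] by simp_all
      have "distinct (J (u, v))" unfolding J_def using p snd_inj by (simp add: distinct_map inj_on_subset)
      moreover have "set (J (u, v)) \<inter> j ` pverts T = {}"
        using disj_snd[of "set (I (u, v))" "\<iota> ` pverts T"] p im unfolding J_def j_def by (simp add: image_comp)
      ultimately show "distinct (J (u, v)) \<and> length (J (u, v)) \<le> r
        \<and> set (J (u, v)) \<inter> j ` pverts T = {} \<and> J (v, u) = rev (J (u, v))"
        using p unfolding J_def by (simp add: rev_map)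
    qed
    show "\<forall>(u, v)\<in>parcs T. \<forall>(u', v')\<in>parcs T. {u, v} \<noteq> {u', v'} \<longrightarrow> set (J (u, v)) \<inter> set (J (u', v')) = {}"
    proof (clarify)
      fix u v u' v' assume *: "(u, v) \<in> parcs T" "(u', v') \<in> parcs T" "{u, v} \<noteq> {u', v'}"
      show "set (J (u, v)) \<inter> set (J (u', v')) = {}"
        using disj_snd[OF _ _ dis[OF *]] path[OF *(1)] path[OF *(2)] unfolding J_def by simp
    qed
  qed (simp_all add: K_def)
  moreover have "subgraph (with_proj K) (with_proj G)"
  proof -
    have arc: "x \<in> pverts K \<and> y \<in> pverts K \<and> (x, y) \<in> parcs G" if xy: "(x, y) \<in> parcs K" for x y
    proof -
      obtain u v where uv: "(u, v) \<in> parcs T" "(x, y) \<in> set (vwalk_arcs (j u # J (u, v) @ [j v]))"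
        using xy unfolding K_def pair_pre_digraph.select_convs by blast
      have ends: "x \<in> set p \<and> y \<in> set p" if "(x, y) \<in> set (vwalk_arcs p)" for p :: "'a list"
        using that by (induction p rule: vwalk_arcs.induct) auto
      have "j u # J (u, v) @ [j v] = map snd (\<iota> u # I (u, v) @ [\<iota> v])" unfolding j_def J_def by simp
      moreover have "successively (\<lambda>x y. (x, y) \<in> parcs G) (map snd (\<iota> u # I (u, v) @ [\<iota> v]))"
      proof -
        have sub: "set (\<iota> u # I (u, v) @ [\<iota> v]) \<subseteq> vertices G"
          using path[OF uv(1)] im pair_graph_vertsD[OF pT uv(1)] by auto
        have "successively adj (\<iota> u # I (u, v) @ [\<iota> v])" using path[OF uv(1)] by simp
        then show ?thesis unfolding successively_map
        proof (rule successively_mono)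
          fix x y assume x: "x \<in> set (\<iota> u # I (u, v) @ [\<iota> v])" and xy: "adj x y"
          from subsetD[OF sub x] have "fst x = G" by auto
          then show "(snd x, snd y) \<in> parcs G" using xy unfolding adj_def by blast
        qed
      qed
      ultimately have "set (vwalk_arcs (j u # J (u, v) @ [j v])) \<subseteq> parcs G"
        unfolding vwalk_arcs_subset_iff_successively by simp
      then have "(x, y) \<in> parcs G" using uv(2) by (rule subsetD)
      moreover have "set (j u # J (u, v) @ [j v]) \<subseteq> pverts K"
        using uv(1) pair_graph_vertsD[OF pT uv(1)] unfolding K_def by auto
      ultimately show ?thesis using ends[OF uv(2)] by blast
    qed
    interpret g: pair_graph G by (rule G)
    have "wf_digraph (with_proj K)" by unfold_locales (use arc in auto)
    moreover have "wf_digraph (with_proj G)" by unfold_locales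
    moreover have "pverts K \<subseteq> pverts G"
    proof -
      have "j ` pverts T \<subseteq> pverts G" using im unfolding j_def by auto
      moreover have "set (J e) \<subseteq> pverts G" if "e \<in> parcs T" for e
        using path[of "fst e" "snd e"] that unfolding J_def by auto
      ultimately show ?thesis unfolding K_def pair_pre_digraph.select_convs by blast
    qed
    moreover have "parcs K \<subseteq> parcs G" using arc by auto
    ultimately show ?thesis unfolding subgraph_def compatible_def by simp
  qed
  ultimately show False using T(2) unfolding shallow_topological_minor_def by blast
qed

text \<open>\<open>q\<close> and \<open>d\<close> determine \<open>r\<close>, the tree excluded for
  this \<open>r\<close> determines the cut size, and all of them determine the batch size.
  \<open>2 * q\<close> bounds the number of free variables, and \<open>Suc\<close> makes the batches
  nonempty, as the features require.\<close>

lemma collapse_formula: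
  fixes C :: "'a pair_pre_digraph set"
  assumes C: "\<And>G. G \<in> C \<Longrightarrow> pair_graph G"
    and T: "T \<in> trees_of_depth (Suc d)" "T \<notin> TopMinors r C"
    and q: "fo_size \<phi> \<le> q" and r: "r = needed_radius d q (2 * q)"
    and xs: "fv \<phi> \<subseteq> set xs"
  shows "\<exists>\<psi>. fv \<psi> \<subseteq> set xs \<and> equivalent_on C xs \<phi> \<psi> \<and> alternation_rank \<psi> \<le> 3 * d - 1
    \<and> fo_size \<psi> \<le> formula_bound (3 * d)
         (Suc (needed_batch (card (pverts T) * Suc r) r d q (2 * q))) (card (fv \<phi>))"
proof (rule game_imp_equivalent_formula[OF C _ _ xs])
  let ?m = "card (pverts T) * Suc r"
  let ?s = "needed_batch ?m r d q (2 * q)"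
  have "undirected_tree T" using T(1) unfolding trees_of_depth_def by blast
  then have "pair_graph T" unfolding undirected_tree_def by blast
  then have norich: "\<not> all_graphs.rich ?m r d (vertices G) v" if "G \<in> C" for G v
    using T that unfolding TopMinors_def
    by (intro excluded_tree_imp_not_rich[OF C[OF that] T(1)]) auto
  have coll: "all_graphs.collapses TYPE('a) ?m r d (2 * q) (3 * d) ?s q"
    by (rule all_graphs.collapses_needed) (simp add: r)
  fix G H :: "'a pair_pre_digraph" and a b
  assume GH: "G \<in> C" "H \<in> C" and ab: "a ` fv \<phi> \<subseteq> pverts G" "b ` fv \<phi> \<subseteq> pverts H"
    and BG: "all_graphs.BG (3 * d) (Suc ?s) (vertices G) (vertices H) (position G a H b (fv \<phi>))"
  have fin: "finite (position G a H b (fv \<phi>))" "card (position G a H b (fv \<phi>)) \<le> card (fv \<phi>)"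
    unfolding position_def using fv_le_size[of \<phi>] card_image_le by auto
  have "all_graphs.EF q (vertices G) (vertices H) ({} \<union> position G a H b (fv \<phi>))"
  proof (rule coll[unfolded all_graphs.collapses_def, rule_format], intro conjI allI)
    show "position G a H b (fv \<phi>) \<subseteq> vertices G \<times> vertices H" using ab unfolding position_def by auto
    show "card (position G a H b (fv \<phi>)) \<le> 2 * q" using fin(2) fv_le_size[of \<phi>] q by linarith
    show "all_graphs.BG (3 * d) ?s (vertices G) (vertices H) ({} \<union> position G a H b (fv \<phi>))"
      using all_graphs.BG_mono_batch[OF BG, of ?s] by simp
  qed (use norich GH fin in auto)
  from all_graphs.EF_le[OF this q]
  show "all_graphs.EF (fo_size \<phi>) (vertices G) (vertices H) (position G a H b (fv \<phi>))" by simp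
qed simp_all

theorem theorem6p1:
  fixes C :: "'a pair_pre_digraph set" and d :: nat
  assumes "\<And>G. G \<in> C \<Longrightarrow> pair_graph G"
    and "has_tree_rank C d"
  shows "(\<forall>xs \<phi>. fv \<phi> \<subseteq> set xs \<longrightarrow>
            (\<exists>\<psi>. fv \<psi> \<subseteq> set xs \<and> equivalent_on C xs \<phi> \<psi> \<and>
                 alternation_rank \<psi> \<le> 3 * d - 1))
       \<and> (has_elementary_tree_rank C d \<longrightarrow>
            (\<exists>f. elementary f \<and>
              (\<forall>xs \<phi>. fv \<phi> \<subseteq> set xs \<longrightarrow>
                (\<exists>\<psi>. fv \<psi> \<subseteq> set xs \<and> equivalent_on C xs \<phi> \<psi> \<and>
                     alternation_rank \<psi> \<le> 3 * d - 1 \<and> fo_size \<psi> \<le> f (fo_size \<phi>)))))"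
proof (intro conjI allI impI)
  fix xs \<phi> assume xs: "fv \<phi> \<subseteq> set xs"
  let ?r = "needed_radius d (fo_size \<phi>) (2 * fo_size \<phi>)"
  \<comment> \<open>Maximality of \<open>d\<close> excludes a tree for every \<open>r\<close>, in
    particular for this one. Nothing is known about its size, so only the alternation rank is
    bounded here.\<close>
  have "\<not> trees_of_depth (Suc d) \<subseteq> TopMinors ?r C"
    using assms(2) unfolding has_tree_rank_def by (meson not_less_eq_eq order_refl)
  then obtain T where "T \<in> trees_of_depth (Suc d)" "T \<notin> TopMinors ?r C" by blast
  from collapse_formula[OF assms(1) this order_refl refl xs]
  show "\<exists>\<psi>. fv \<psi> \<subseteq> set xs \<and> equivalent_on C xs \<phi> \<psi> \<and> alternation_rank \<psi> \<le> 3 * d - 1" by blast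
next
  assume "has_elementary_tree_rank C d"
  then obtain f where f: "elementary f"
    "\<And>r. \<exists>T\<in>trees_of_depth (Suc d). card (pverts T) = f r \<and> T \<notin> TopMinors r C"
    unfolding has_elementary_tree_rank_def elementary_excludes_def by auto
  define r where "r = (\<lambda>n. needed_radius d n (2 * n))"
  \<comment> \<open>The excluded tree now has \<open>f (r n)\<close> vertices, so the cut size, and
    with it the batch size, is elementary in \<open>n\<close>.\<close>
  define s where "s = (\<lambda>n. Suc (needed_batch (f (r n) * Suc (r n)) (r n) d n (2 * n)))"
  define F where "F = (\<lambda>n. formula_bound (3 * d) (s n) (2 * n))"
  have r: "elementary r" unfolding r_def by (intro elementary_needed_radius elementary_intros)
  have s: "elementary s" unfolding s_def
    by (intro elementary_intros elementary_needed_batch elementary_comp[OF f(1)] r)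
  have "elementary F" unfolding F_def by (intro elementary_formula_bound s elementary_intros)
  moreover have "\<exists>\<psi>. fv \<psi> \<subseteq> set xs \<and> equivalent_on C xs \<phi> \<psi> \<and> alternation_rank \<psi> \<le> 3 * d - 1
      \<and> fo_size \<psi> \<le> F (fo_size \<phi>)" if xs: "fv \<phi> \<subseteq> set xs" for xs \<phi>
  proof -
    let ?n = "fo_size \<phi>"
    obtain T where T: "T \<in> trees_of_depth (Suc d)" "card (pverts T) = f (r ?n)" "T \<notin> TopMinors (r ?n) C"
      using f(2) by blast
    have "formula_bound (3 * d) (s ?n) (card (fv \<phi>)) \<le> F ?n"
      unfolding F_def using formula_bound_mono fv_le_size[of \<phi>] by blast
    moreover from collapse_formula[OF assms(1) T(1,3) order_refl _ xs]
    have "\<exists>\<psi>. fv \<psi> \<subseteq> set xs \<and> equivalent_on C xs \<phi> \<psi> \<and> alternation_rank \<psi> \<le> 3 * d - 1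
        \<and> fo_size \<psi> \<le> formula_bound (3 * d) (s ?n) (card (fv \<phi>))"
      unfolding T(2) s_def r_def by simp
    ultimately show ?thesis using le_trans by blast
  qed
  ultimately show "\<exists>f. elementary f \<and> (\<forall>xs \<phi>. fv \<phi> \<subseteq> set xs \<longrightarrow>
      (\<exists>\<psi>. fv \<psi> \<subseteq> set xs \<and> equivalent_on C xs \<phi> \<psi> \<and> alternation_rank \<psi> \<le> 3 * d - 1
        \<and> fo_size \<psi> \<le> f (fo_size \<phi>)))" by blast
qed

end
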